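(* Let $\kappa\in\mathbb{Z}_p\setminus\mathbb{Z}_{\ge0}$, $\frac{1}{p-1}<b\le\frac{p}{p-1}$ and $c=b-\frac{1}{p-1}$. Then $\mathcal{R}(b,c)\cap\partial\,\mathcal{S}(b,c)=\{0\}$. Consequently $H^1(\mathcal{S}(b,c),\partial):=\mathcal{S}(b,c)/\partial\mathcal{S}(b,c)\cong\mathcal{R}(b,c)$ and $H^0(\mathcal{S}(b,c),\partial):=\ker(\partial|_{\mathcal{S}(b,c)})=0$.
   Context: Let $p$ be a prime, $q=p^a$, $\mathbb{Q}_q$ the unramified extension of $\mathbb{Q}_p$ of degree $a$, $\gamma\in\bar{\mathbb{Q}}_p$ a root of $\sum_{j\ge0}T^{p^j}/p^j$ with ${\rm ord}_p\gamma=\frac1{p-1}$, and $\Omega=\mathbb{Q}_q(\gamma^{1/q})$. Fix $n\ge1$. Spaces: for $\underline i\in\mathbb{Z}_{\ge0}^n$ let $|\underline i|=\sum i_j$, $w(\underline i)=\sum_j j\,i_j$, $\kappa^{\underline i}=\kappa(\kappa-1)\cdots(\kappa-|\underline i|+1)$. With formal symbols $e_1,\dots,e_n$, $e^{\underline i}=\prod e_j^{i_j}$, $e_\kappa^{\underline i}=\kappa^{\underline i}e^{\underline i}$. $\mathcal{S}(b,c;\rho)$ is the set of series $\sum_{r\ge0,\underline i}a(r,\underline i)t^re_\kappa^{\underline i}$, $a(r,\underline i)\in\Omega$, ${\rm ord}_p a(r,\underline i)\ge b(n+1)r+c\,w(\underline i)+\rho$, and $\mathcal{S}(b,c)=\bigcup_\rho\mathcal{S}(b,c;\rho)$;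 $\mathcal{R}(b,c;\rho)$ is the subspace where $a(r,\underline i)=0$ whenever $i_1\ne0$, and $\mathcal{R}(b,c)=\bigcup_\rho\mathcal{R}(b,c;\rho)$. The connection $\partial$: let $f(t,x)=x_1+\cdots+x_n+t/(x_1\cdots x_n)$, $\gamma_i=\sum_{j=0}^i\gamma^{p^j}/p^j$, $H(t,x)=\sum_{i\ge0}\gamma_i f(t^{p^i},x^{p^i})$. For $\mathbf v\in\mathbb{Z}^n$ let $m(\mathbf v)=\max\{0,-v_1,\dots,-v_n\}$, $w(\mathbf v)=\sum v_i+(n+1)m(\mathbf v)$. Let $\mathcal{K}(b,b)$ be the space of series $\sum_{r\ge0,\mathbf v\in\mathbb{Z}^n}a(r,\mathbf v)t^{r+m(\mathbf v)}x^{\mathbf v}$ with ${\rm ord}_pa(r,\mathbf v)\ge b(n+1)r+b\,w(\mathbf v)+\rho$ for some $\rho$, and $\mathcal{L}(b)$ the ring of series $\sum_r a(r)t^r$ with ${\rm ord}_pa(r)\ge b(n+1)r+\rho$ for some $\rho$. Let $D_l=x_l\frac{\partial}{\partial x_l}+x_l\frac{\partial H}{\partial x_l}$ ($1\le l\le n$). The quotient $\mathcal{H}=\mathcal{K}(b,b)/\sum_lD_l\mathcal{K}(b,b)$ is a free $\mathcal{L}(b)$-module with basis $e_i=\gamma^ix_1\cdots x_i$, $i=0,\dots,n$ ($e_0=1$). The operator $t\frac{d}{dt}+t\frac{\partial H}{\partial t}$ commutes with all $D_l$ and induces a connection $\partial$ on $\mathcal{H}$. This is extended to $\mathcal{S}(b,c)$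 termwise by $$\partial(t^re_\kappa^{\underline i})=r\,t^re_\kappa^{\underline i}+\kappa^{\underline i}(\kappa-|\underline i|)\,t^r\,e^{\underline i}\partial(e_0)+\sum_{j=1}^n\kappa^{\underline i}i_j\,t^r\,e^{\underline i-u_j}\partial(e_j),$$ where $\partial(e_j)$ is written in the basis $e_0,\dots,e_n$, products $e^{\underline i'}e_m$ are computed as monomials in $e_1,\dots,e_n$ with $e_0=1$, and each $e^{\underline\mu}$ is rewritten as $(\kappa^{\underline\mu})^{-1}e_\kappa^{\underline\mu}$ ($u_j$ the standard unit vectors). *)

theory Defs
  imports
    "HOL-Algebra.Algebraic_Closure_Type"
    "HOL-Algebra.Generated_Fields"
    "HOL-Library.Extended_Real"
    "HOL-Library.Groups_Big_Fun"
begin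

section \<open>An algebraic closure of the p-adic numbers\<close>

text \<open>
  The ambient field is a type \<open>'k\<close> with a valuation \<open>ord\<close>. The field of p-adic numbers is the set of
  limits of sequences of rationals, and \<open>'k\<close> is required to be an algebraic closure of it.
\<close>

definition ord_tendsto :: "('k::field_char_0 \<Rightarrow> ereal) \<Rightarrow> (nat \<Rightarrow> 'k) \<Rightarrow> 'k \<Rightarrow> bool" where
  "ord_tendsto ord s x \<longleftrightarrow> (\<lambda>k. ord (s k - x)) \<longlonglongrightarrow> \<infinity>"

definition Qp :: "('k::field_char_0 \<Rightarrow> ereal) \<Rightarrow> 'k set" where
  "Qp ord = {x. \<exists>s :: nat \<Rightarrow> rat. ord_tendsto ord (\<lambda>k. of_rat (s k)) x}"

definition Zp :: "('k::field_char_0 \<Rightarrow> ereal) \<Rightarrow> 'k set" where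
  "Zp ord = {x \<in> Qp ord. ord x \<ge> 0}"

text \<open>
  The conditions below determine the pair \<open>('k, ord)\<close> up to isomorphism. That \<open>ord\<close> restricts to the
  usual p-adic valuation on the rationals follows from the ultrametric inequality and \<open>ord p = 1\<close>.
\<close>

locale padic_closure =
  fixes p :: nat and ord :: "'k::field_char_0 \<Rightarrow> ereal"
  assumes prime_p: "Factorial_Ring.prime p"
    and ord_eq_infinity_iff: "ord x = \<infinity> \<longleftrightarrow> x = 0"
    and ord_neq_minus_infinity: "ord x \<noteq> -\<infinity>"
    and ord_mult: "ord (x * y) = ord x + ord y"
    and ord_add: "ord (x + y) \<ge> min (ord x) (ord y)"
    and ord_p: "ord (of_nat p) = 1"
    and Qp_complete: "\<And>s :: nat \<Rightarrow> rat.
          (\<forall>M :: real. \<exists>N. \<forall>k\<ge>N. \<forall>l\<ge>N. ord (of_rat (s k) - of_rat (s l)) \<ge> ereal M) \<Longrightarrow>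
          \<exists>x. ord_tendsto ord (\<lambda>k. of_rat (s k)) x"
    and algebraic_closure_Qp: "algebraic_closure (ring_of_type_algebra :: 'k ring) (Qp ord)"

text \<open>Unramified means that the value group is still that of the p-adic numbers.\<close>

definition unramified_extension :: "('k::field_char_0 \<Rightarrow> ereal) \<Rightarrow> nat \<Rightarrow> 'k set \<Rightarrow> bool" where
  "unramified_extension ord d L \<longleftrightarrow>
     subfield L ring_of_type_algebra \<and> Qp ord \<subseteq> L \<and>
     ring.dimension ring_of_type_algebra d (Qp ord) L \<and>
     ord ` (L - {0}) = range (\<lambda>m :: int. ereal (of_int m))"

text \<open>The series \<open>\<Sum>j. T ^ (p ^ j) / p ^ j\<close> converges to \<open>0\<close> at \<open>T = \<gamma>\<close>.\<close>

definition is_gamma :: "nat \<Rightarrow> ('k::field_char_0 \<Rightarrow> ereal) \<Rightarrow> 'k \<Rightarrow> bool" where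
  "is_gamma p ord \<gamma> \<longleftrightarrow>
     ord_tendsto ord (\<lambda>N. \<Sum>j<N. \<gamma> ^ (p ^ j) / of_nat p ^ j) 0 \<and>
     ord \<gamma> = ereal (1 / (real p - 1))"


section \<open>Exponents and spaces of series\<close>

text \<open>Exponent vectors are functions vanishing outside the index range \<open>{1..n}\<close>.\<close>

definition exps :: "nat \<Rightarrow> (nat \<Rightarrow> 'z::zero) set" where
  "exps n = {v. \<forall>j. j \<notin> {1..n} \<longrightarrow> v j = 0}"

definition len :: "nat \<Rightarrow> (nat \<Rightarrow> nat) \<Rightarrow> nat" where
  "len n i = (\<Sum>j=1..n. i j)"

definition wt :: "nat \<Rightarrow> (nat \<Rightarrow> nat) \<Rightarrow> nat" where
  "wt n i = (\<Sum>j=1..n. j * i j)"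

definition mneg :: "nat \<Rightarrow> (nat \<Rightarrow> int) \<Rightarrow> int" where
  "mneg n v = Max (insert 0 ((\<lambda>j. - v j) ` {1..n}))"

definition wtZ :: "nat \<Rightarrow> (nat \<Rightarrow> int) \<Rightarrow> int" where
  "wtZ n v = (\<Sum>j=1..n. v j) + (int n + 1) * mneg n v"

text \<open>
  \<open>F s v\<close> is the coefficient of \<open>t ^ s x ^ v\<close>, and \<open>\<xi> r i\<close> is the coefficient of \<open>t ^ r e\<^sub>\<kappa> ^ i\<close>.
\<close>

type_synonym 'k tx_series = "nat \<Rightarrow> (nat \<Rightarrow> int) \<Rightarrow> 'k"
type_synonym 'k te_series = "nat \<Rightarrow> (nat \<Rightarrow> nat) \<Rightarrow> 'k"

definition S_space_rho ::
    "('k::field_char_0 \<Rightarrow> ereal) \<Rightarrow> 'k set \<Rightarrow> nat \<Rightarrow> real \<Rightarrow> real \<Rightarrow> real \<Rightarrow> 'k te_series set" where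
  "S_space_rho ord \<Omega> n b c \<rho> =
     {\<xi>. (\<forall>r i. i \<notin> exps n \<longrightarrow> \<xi> r i = 0) \<and>
         (\<forall>r. \<forall>i\<in>exps n. \<xi> r i \<in> \<Omega> \<and>
            ord (\<xi> r i) \<ge> ereal (b * (real n + 1) * real r + c * real (wt n i) + \<rho>))}"

definition S_space ::
    "('k::field_char_0 \<Rightarrow> ereal) \<Rightarrow> 'k set \<Rightarrow> nat \<Rightarrow> real \<Rightarrow> real \<Rightarrow> 'k te_series set" where
  "S_space ord \<Omega> n b c = (\<Union>\<rho>. S_space_rho ord \<Omega> n b c \<rho>)"

definition R_space_rho ::
    "('k::field_char_0 \<Rightarrow> ereal) \<Rightarrow> 'k set \<Rightarrow> nat \<Rightarrow> real \<Rightarrow> real \<Rightarrow> real \<Rightarrow> 'k te_series set" where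
  "R_space_rho ord \<Omega> n b c \<rho> =
     {\<xi> \<in> S_space_rho ord \<Omega> n b c \<rho>. \<forall>r i. i 1 \<noteq> 0 \<longrightarrow> \<xi> r i = 0}"

definition R_space ::
    "('k::field_char_0 \<Rightarrow> ereal) \<Rightarrow> 'k set \<Rightarrow> nat \<Rightarrow> real \<Rightarrow> real \<Rightarrow> 'k te_series set" where
  "R_space ord \<Omega> n b c = (\<Union>\<rho>. R_space_rho ord \<Omega> n b c \<rho>)"

definition L_space ::
    "('k::field_char_0 \<Rightarrow> ereal) \<Rightarrow> 'k set \<Rightarrow> nat \<Rightarrow> real \<Rightarrow> (nat \<Rightarrow> 'k) set" where
  "L_space ord \<Omega> n b =
     {g. \<exists>\<rho> :: real. \<forall>r. g r \<in> \<Omega> \<and> ord (g r) \<ge> ereal (b * (real n + 1) * real r + \<rho>)}"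

text \<open>
  The space \<open>K(b,b)\<close>. The coefficient \<open>a(r,v)\<close> belongs to the monomial \<open>t ^ (r + m(v)) x ^ v\<close>, so that
  only monomials \<open>t ^ s x ^ v\<close> with \<open>s \<ge> m(v)\<close> occur.
\<close>

definition K_space ::
    "('k::field_char_0 \<Rightarrow> ereal) \<Rightarrow> 'k set \<Rightarrow> nat \<Rightarrow> real \<Rightarrow> 'k tx_series set" where
  "K_space ord \<Omega> n b =
     {F. (\<forall>s v. v \<notin> exps n \<or> int s < mneg n v \<longrightarrow> F s v = 0) \<and>
         (\<exists>\<rho> :: real. \<forall>r. \<forall>v\<in>exps n. F (r + nat (mneg n v)) v \<in> \<Omega> \<and>
            ord (F (r + nat (mneg n v)) v)
              \<ge> ereal (b * (real n + 1) * real r + b * real_of_int (wtZ n v) + \<rho>))}"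


section \<open>The operators on \<open>K(b,b)\<close>\<close>

text \<open>
  In each coefficient of a product of two series supported on \<open>s \<ge> m(v)\<close> only finitely many terms are
  nonzero, since \<open>s \<ge> m(v)\<close> forces \<open>v j \<ge> - s\<close> for all \<open>j\<close>.
\<close>

definition tx_mult :: "'k::field_char_0 tx_series \<Rightarrow> 'k tx_series \<Rightarrow> 'k tx_series" where
  "tx_mult G F = (\<lambda>s v. Sum_any (\<lambda>(s', v').
     if s' \<le> s then G s' v' * F (s - s') (\<lambda>j. v j - v' j) else 0))"

definition t_mult :: "(nat \<Rightarrow> 'k::field_char_0) \<Rightarrow> 'k tx_series \<Rightarrow> 'k tx_series" where
  "t_mult g F = (\<lambda>s v. \<Sum>r\<le>s. g r * F (s - r) v)"

definition theta_t :: "'k::field_char_0 tx_series \<Rightarrow> 'k tx_series" where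
  "theta_t F = (\<lambda>s v. of_nat s * F s v)"

definition theta_x :: "nat \<Rightarrow> 'k::field_char_0 tx_series \<Rightarrow> 'k tx_series" where
  "theta_x l F = (\<lambda>s v. of_int (v l) * F s v)"

definition f_series :: "nat \<Rightarrow> 'k::field_char_0 tx_series" where
  "f_series n = (\<lambda>s v.
     if s = 0 \<and> (\<exists>j\<in>{1..n}. v = (\<lambda>k. if k = j then 1 else 0)) then 1
     else if s = 1 \<and> v = (\<lambda>k. if k \<in> {1..n} then - 1 else 0) then 1 else 0)"

text \<open>The substitution \<open>F(t ^ P, x ^ P)\<close>.\<close>

definition subst_pow :: "nat \<Rightarrow> 'k::field_char_0 tx_series \<Rightarrow> 'k tx_series" where
  "subst_pow P F = (\<lambda>s v.
     if P dvd s \<and> (\<forall>j. int P dvd v j) then F (s div P) (\<lambda>j. v j div int P) else 0)"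

definition gamma_sum :: "nat \<Rightarrow> 'k::field_char_0 \<Rightarrow> nat \<Rightarrow> 'k" where
  "gamma_sum p \<gamma> i = (\<Sum>j\<le>i. \<gamma> ^ (p ^ j) / of_nat p ^ j)"

text \<open>For \<open>n \<ge> 1\<close> every monomial occurs in \<open>f(t ^ (p ^ i), x ^ (p ^ i))\<close> for at most one \<open>i\<close>.\<close>

definition H_series :: "nat \<Rightarrow> 'k::field_char_0 \<Rightarrow> nat \<Rightarrow> 'k tx_series" where
  "H_series p \<gamma> n = (\<lambda>s v. Sum_any (\<lambda>i. gamma_sum p \<gamma> i * subst_pow (p ^ i) (f_series n) s v))"

definition D_op :: "nat \<Rightarrow> 'k::field_char_0 \<Rightarrow> nat \<Rightarrow> nat \<Rightarrow> 'k tx_series \<Rightarrow> 'k tx_series" where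
  "D_op p \<gamma> n l F = (\<lambda>s v. theta_x l F s v + tx_mult (theta_x l (H_series p \<gamma> n)) F s v)"

definition Dt_op :: "nat \<Rightarrow> 'k::field_char_0 \<Rightarrow> nat \<Rightarrow> 'k tx_series \<Rightarrow> 'k tx_series" where
  "Dt_op p \<gamma> n F = (\<lambda>s v. theta_t F s v + tx_mult (theta_t (H_series p \<gamma> n)) F s v)"

text \<open>\<open>\<Sum>l. D\<^sub>l K(b,b)\<close>\<close>

definition DK_space ::
    "nat \<Rightarrow> ('k::field_char_0 \<Rightarrow> ereal) \<Rightarrow> 'k set \<Rightarrow> 'k \<Rightarrow> nat \<Rightarrow> real \<Rightarrow> 'k tx_series set" where
  "DK_space p ord \<Omega> \<gamma> n b =
     {\<lambda>s v. \<Sum>l=1..n. D_op p \<gamma> n l (G l) s v | G. \<forall>l\<in>{1..n}. G l \<in> K_space ord \<Omega> n b}"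

definition basis_e :: "'k::field_char_0 \<Rightarrow> nat \<Rightarrow> 'k tx_series" where
  "basis_e \<gamma> m = (\<lambda>s v. if s = 0 \<and> v = (\<lambda>k. if k \<in> {1..m} then 1 else 0) then \<gamma> ^ m else 0)"

text \<open>
  The coordinates, with respect to the \<open>L(b)\<close>-basis \<open>e\<^sub>0, \<dots>, e\<^sub>n\<close> of \<open>K(b,b) / \<Sum>l. D\<^sub>l K(b,b)\<close>, of the
  class of \<open>F\<close>. The coordinate functions are padded by \<open>0\<close> beyond \<open>n\<close> to make them unique.
\<close>

definition coords ::
    "nat \<Rightarrow> ('k::field_char_0 \<Rightarrow> ereal) \<Rightarrow> 'k set \<Rightarrow> 'k \<Rightarrow> nat \<Rightarrow> real \<Rightarrow> 'k tx_series \<Rightarrow>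
       nat \<Rightarrow> nat \<Rightarrow> 'k" where
  "coords p ord \<Omega> \<gamma> n b F = (THE g.
     (\<forall>m\<le>n. g m \<in> L_space ord \<Omega> n b) \<and> (\<forall>m>n. g m = (\<lambda>_. 0)) \<and>
     (\<lambda>s v. F s v - (\<Sum>m\<le>n. t_mult (g m) (basis_e \<gamma> m) s v)) \<in> DK_space p ord \<Omega> \<gamma> n b)"

text \<open>\<open>\<partial>(e\<^sub>j) = \<Sum>m\<le>n. conn_matrix j m \<cdot> e\<^sub>m\<close>, with \<open>conn_matrix j m\<close> a power series in \<open>t\<close>\<close>

definition conn_matrix ::
    "nat \<Rightarrow> ('k::field_char_0 \<Rightarrow> ereal) \<Rightarrow> 'k set \<Rightarrow> 'k \<Rightarrow> nat \<Rightarrow> real \<Rightarrow>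
       nat \<Rightarrow> nat \<Rightarrow> nat \<Rightarrow> 'k" where
  "conn_matrix p ord \<Omega> \<gamma> n b j = coords p ord \<Omega> \<gamma> n b (Dt_op p \<gamma> n (basis_e \<gamma> j))"


section \<open>The connection on \<open>S(b,c)\<close>\<close>

definition kfall :: "'k::field_char_0 \<Rightarrow> nat \<Rightarrow> (nat \<Rightarrow> nat) \<Rightarrow> 'k" where
  "kfall \<kappa> n i = (\<Prod>k<len n i. \<kappa> - of_nat k)"

text \<open>The exponent of \<open>e ^ \<mu> \<cdot> e\<^sub>m\<close>, where \<open>e\<^sub>0 = 1\<close>.\<close>

definition mul_e :: "nat \<Rightarrow> (nat \<Rightarrow> nat) \<Rightarrow> (nat \<Rightarrow> nat)" where
  "mul_e m \<mu> = (if m = 0 then \<mu> else \<mu>(m := \<mu> m + 1))"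

text \<open>
  \<open>t ^ r e ^ \<mu> \<partial>(e\<^sub>j)\<close> as a series in the \<open>t ^ s e\<^sub>\<kappa> ^ \<nu>\<close>, where \<open>A\<close> is the matrix of the connection;
  the inverse comes from \<open>e ^ \<nu> = (\<kappa> ^ \<nu>)\<inverse> e\<^sub>\<kappa> ^ \<nu>\<close>.
\<close>

definition mono_times_conn ::
    "'k::field_char_0 \<Rightarrow> nat \<Rightarrow> (nat \<Rightarrow> nat \<Rightarrow> nat \<Rightarrow> 'k) \<Rightarrow> nat \<Rightarrow> (nat \<Rightarrow> nat) \<Rightarrow> nat \<Rightarrow> 'k te_series" where
  "mono_times_conn \<kappa> n A r \<mu> j = (\<lambda>s \<nu>.
     \<Sum>m\<le>n. if \<nu> = mul_e m \<mu> \<and> r \<le> s then A j m (s - r) * inverse (kfall \<kappa> n \<nu>) else 0)"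

text \<open>
  \<open>\<partial>(t ^ r e\<^sub>\<kappa> ^ i)\<close>. The truncated subtraction is harmless because its terms carry the factor \<open>i j\<close>.
\<close>

definition conn_mono ::
    "'k::field_char_0 \<Rightarrow> nat \<Rightarrow> (nat \<Rightarrow> nat \<Rightarrow> nat \<Rightarrow> 'k) \<Rightarrow> nat \<Rightarrow> (nat \<Rightarrow> nat) \<Rightarrow> 'k te_series" where
  "conn_mono \<kappa> n A r i = (\<lambda>s \<nu>.
     (if s = r \<and> \<nu> = i then of_nat r else 0)
     + kfall \<kappa> n i * (\<kappa> - of_nat (len n i)) * mono_times_conn \<kappa> n A r i 0 s \<nu>
     + (\<Sum>j=1..n. kfall \<kappa> n i * of_nat (i j) *
          mono_times_conn \<kappa> n A r (i(j := i j - 1)) j s \<nu>))"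

text \<open>
  The termwise extension. A given monomial \<open>t ^ s e\<^sub>\<kappa> ^ \<nu>\<close> occurs in \<open>\<partial>(t ^ r e\<^sub>\<kappa> ^ i)\<close> for only finitely
  many \<open>(r, i)\<close>.
\<close>

definition connection ::
    "'k::field_char_0 \<Rightarrow> nat \<Rightarrow> (nat \<Rightarrow> nat \<Rightarrow> nat \<Rightarrow> 'k) \<Rightarrow> 'k te_series \<Rightarrow> 'k te_series" where
  "connection \<kappa> n A \<xi> = (\<lambda>s \<nu>. Sum_any (\<lambda>(r, i). \<xi> r i * conn_mono \<kappa> n A r i s \<nu>))"


section \<open>Vector spaces and quotients\<close>

definition scalars :: "'k::field_char_0 set \<Rightarrow> 'k ring" where
  "scalars \<Omega> = ring_of_type_algebra\<lparr>carrier := \<Omega>\<rparr>"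

text \<open>The ring multiplication of a module record plays no role and is left unspecified.\<close>

definition te_module :: "'k::field_char_0 te_series set \<Rightarrow> ('k, 'k te_series) module" where
  "te_module V = \<lparr>carrier = V, monoid.mult = undefined, one = undefined,
     ring.zero = (\<lambda>_ _. 0), add = (\<lambda>\<xi> \<eta> r i. \<xi> r i + \<eta> r i),
     module.smult = (\<lambda>a \<xi> r i. a * \<xi> r i)\<rparr>"

definition quotient_module :: "('a, 'b) module \<Rightarrow> 'b set \<Rightarrow> ('a, 'b set) module" where
  "quotient_module M N = \<lparr>carrier = a_rcosets\<^bsub>M\<^esub> N, monoid.mult = undefined, one = undefined,
     ring.zero = N, add = set_add M,
     module.smult = (\<lambda>a Y. \<Union>x\<in>Y. N +>\<^bsub>M\<^esub> (a \<odot>\<^bsub>M\<^esub> x))\<rparr>"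

definition module_iso :: "('a, 'r) ring_scheme \<Rightarrow> ('a, 'b) module \<Rightarrow> ('a, 'c) module \<Rightarrow> ('b \<Rightarrow> 'c) set" where
  "module_iso R M N = {h. bij_betw h (carrier M) (carrier N) \<and>
     (\<forall>x\<in>carrier M. \<forall>y\<in>carrier M. h (x \<oplus>\<^bsub>M\<^esub> y) = h x \<oplus>\<^bsub>N\<^esub> h y) \<and>
     (\<forall>a\<in>carrier R. \<forall>x\<in>carrier M. h (a \<odot>\<^bsub>M\<^esub> x) = a \<odot>\<^bsub>N\<^esub> h x)}"

end

theory Submission
  imports Defs
begin

text \<open>
  In the variables \<open>x\<^sub>0 = t / (x\<^sub>1 \<cdots> x\<^sub>n), x\<^sub>1, \<dots>, x\<^sub>n\<close> everything becomes symmetric: \<open>t = x\<^sub>0 \<cdots> x\<^sub>n\<close>,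
  \<open>H\<close> is a sum of series in the single variables, \<open>D\<^sub>l = \<nabla>\<^sub>l - \<nabla>\<^sub>0\<close> and \<open>t d/dt + t \<partial>H/\<partial>t = \<nabla>\<^sub>0\<close>, where
  \<open>\<nabla>\<^sub>k\<close> only involves \<open>x\<^sub>k\<close>. To leading order \<open>D\<^sub>l\<close> is multiplication by \<open>\<gamma> (x\<^sub>l - x\<^sub>0)\<close>, so that reduction
  modulo the \<open>D\<^sub>l\<close> is a \<open>p\<close>-adic perturbation of the substitution of \<open>x\<^sub>0\<close> for \<open>x\<^sub>1, \<dots>, x\<^sub>n\<close>. It yields
  unique coordinates with respect to \<open>e\<^sub>0, \<dots>, e\<^sub>n\<close> and the estimate
  \<open>ord A\<^sub>j\<^sub>m(s) \<ge> b (n + 1) s + c (m - j - 1)\<close> for the coefficients of the connection matrix, with a gain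
  if \<open>(n + 1) s + m \<le> j\<close>, and \<open>ord (A\<^sub>0\<^sub>1(0) - 1) \<ge> c\<close>. For \<open>b = p / (p - 1)\<close> the terms of \<open>H\<close> of higher
  degree do not gain valuation; convergence is then measured with a smaller \<open>b\<close>, and membership in the
  original space is preserved because it is a closed condition.

  Hence, up to terms that gain valuation, raise the degree, or have smaller length, \<open>\<partial>\<close> is
  multiplication by \<open>e\<^sub>1\<close>. In a weight combining these three, \<open>e\<^sub>1\<^sup>-\<^sup>1 \<partial>\<close> differs from the identity by a
  contraction of \<open>S(b,c)\<close>, so every \<open>\<zeta> \<in> S(b,c)\<close> is \<open>\<partial>\<xi> + \<eta>\<close> for unique \<open>\<xi> \<in> S(b,c)\<close> and \<open>\<eta> \<in> R(b,c)\<close>.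
\<close>

section \<open>Valuations and completeness\<close>

text \<open>The constants come from two competing rates. As the series defining \<gamma> vanishes
  there, each \<gamma>_i is minus a tail, and the degree \<open>d\<close> coefficient of
  \<open>x dH/dx\<close> in one variable has order at least \<open>(e + 1) d - 1\<close>, where
  \<open>e = 1 / (p - 1)\<close> and \<open>e + 1 = p / (p - 1)\<close>. Inverting
  \<open>\<gamma> (x_l - x_0)\<close> lowers the degree by one and costs \<open>e\<close>. Against a
  bound growing by \<open>b\<close> per degree, the derivation part of \<open>D_l\<close> then gains
  \<open>b - e = c\<close>, and the terms of degree at least two gain at least
  \<open>e + 1 - b\<close>. Hence the two limits for \<open>b\<close>; and \<open>c\<close> is what
  is left of \<open>b\<close> per factor once \<open>e_m\<close> carries \<gamma>^m.

  The obstacle in S(b,c) is that the bounds for the entries of the connection balance its weight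
  exactly: the difference of the identity and \<open>e_1^-1\<close> times the connection keeps such
  bounds but need not improve them. One weight therefore controls membership and a second one
  convergence. The endpoint \<open>b = p / (p - 1)\<close> has the same shape, so a single
  approximation lemma serves both. Limits exist because \<Omega> is finite over Q_p, hence complete,
  and \<kappa> outside the natural numbers makes every falling factorial of \<kappa>
  invertible.\<close>

lemma subfield_of_typeD:
  fixes K :: "'k::field_char_0 set"
  assumes "subfield K ring_of_type_algebra"
  shows "0 \<in> K" "1 \<in> K" "x \<in> K \<Longrightarrow> y \<in> K \<Longrightarrow> x + y \<in> K" "x \<in> K \<Longrightarrow> y \<in> K \<Longrightarrow> x * y \<in> K"
    "x \<in> K \<Longrightarrow> - x \<in> K" "x \<in> K \<Longrightarrow> inverse x \<in> K"
proof -
  interpret F: field "ring_of_type_algebra :: 'k ring" by (rule field_from_type_algebra)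
  have sr: "subring K ring_of_type_algebra" using subfieldE(1)[OF assms] .
  have s: "carrier (ring_of_type_algebra :: 'k ring) = UNIV" "\<zero>\<^bsub>ring_of_type_algebra\<^esub> = (0::'k)"
    "\<one>\<^bsub>ring_of_type_algebra\<^esub> = (1::'k)"
    "\<And>x y::'k. x \<oplus>\<^bsub>ring_of_type_algebra\<^esub> y = x + y"
    "\<And>x y::'k. x \<otimes>\<^bsub>ring_of_type_algebra\<^esub> y = x * y"
    by (simp_all add: ring_of_type_algebra_def)
  have neg: "\<ominus>\<^bsub>ring_of_type_algebra\<^esub> x = - x" for x :: 'k
    using F.minus_equality[of "- x" x] s by simp
  have inv: "x \<noteq> 0 \<Longrightarrow> inv\<^bsub>ring_of_type_algebra\<^esub> x = inverse x" for x :: 'k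
    using F.inv_unique'[of x "inverse x"] s by simp
  show z: "0 \<in> K" and "1 \<in> K" and "x \<in> K \<Longrightarrow> y \<in> K \<Longrightarrow> x + y \<in> K"
    and "x \<in> K \<Longrightarrow> y \<in> K \<Longrightarrow> x * y \<in> K" and "x \<in> K \<Longrightarrow> - x \<in> K"
    using subringE(2,3,5,6,7)[OF sr] s neg by metis+
  show "x \<in> K \<Longrightarrow> inverse x \<in> K"
    using F.subfield_m_inv(1)[OF assms, of x] s inv[of x] z by (cases "x = 0") auto
qed

context padic_closure
begin

text \<open>Real thresholds keep the arithmetic of bounds out of \<open>ereal\<close>; zero
  satisfies all of them.\<close>

definition ordge :: "real \<Rightarrow> 'k \<Rightarrow> bool" where
  "ordge r x \<longleftrightarrow> ereal r \<le> ord x"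

lemma ord_0 [simp]: "ord 0 = \<infinity>"
  by (simp add: ord_eq_infinity_iff)

lemma ord_cases:
  obtains "x = 0" "ord x = \<infinity>" | r where "x \<noteq> 0" "ord x = ereal r"
  using ord_neq_minus_infinity[of x] ord_eq_infinity_iff[of x] by (cases "ord x") auto

lemma ord_1: "ord 1 = 0"
  using ord_mult[of 1 1] by (cases rule: ord_cases[of 1]) auto

lemma ord_minus1: "ord (- 1) = 0"
  using ord_mult[of "-1" "-1"] ord_1 by (cases rule: ord_cases[of "-1"]) (auto simp: zero_ereal_def)

lemma ord_uminus [simp]: "ord (- x) = ord x"
  using ord_mult[of "-1" x] by (simp add: ord_minus1)

lemma ord_inverse: "x \<noteq> 0 \<Longrightarrow> ord x = ereal r \<Longrightarrow> ord (inverse x) = ereal (- r)"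
  using ord_mult[of x "inverse x"] ord_1 by (cases rule: ord_cases[of "inverse x"]) (auto simp: zero_ereal_def)

lemma ord_power: "ord x = ereal r \<Longrightarrow> ord (x ^ m) = ereal (real m * r)"
  by (induct m) (auto simp: ord_1 ord_mult zero_ereal_def algebra_simps)

lemma ordge_0 [simp, intro]: "ordge r 0"
  by (simp add: ordge_def)

lemma ordge_uminus [simp]: "ordge r (- x) \<longleftrightarrow> ordge r x"
  by (simp add: ordge_def)

lemma ordge_mono: "ordge r x \<Longrightarrow> s \<le> r \<Longrightarrow> ordge s x"
  unfolding ordge_def by (meson ereal_less_eq(3) order_trans)

lemma ordge_add: "ordge r x \<Longrightarrow> ordge r y \<Longrightarrow> ordge r (x + y)"
  unfolding ordge_def using ord_add[of x y] by (meson min.boundedI order_trans)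

lemma ordge_diff: "ordge r x \<Longrightarrow> ordge r y \<Longrightarrow> ordge r (x - y)"
  using ordge_add[of r x "- y"] by simp

lemma ordge_minus_commute: "ordge r (x - y) \<longleftrightarrow> ordge r (y - x)"
  using ordge_uminus[of r "x - y"] by simp

lemma ordge_mult: "ordge r x \<Longrightarrow> ordge s y \<Longrightarrow> ordge (r + s) (x * y)"
  unfolding ordge_def ord_mult using add_mono[of "ereal r" "ord x" "ereal s" "ord y"] by simp

lemma ordge_mult_le: "ordge r x \<Longrightarrow> ordge s y \<Longrightarrow> t \<le> r + s \<Longrightarrow> ordge t (x * y)"
  using ordge_mult ordge_mono by blast

lemma ordge_sum: "(\<And>i. i \<in> I \<Longrightarrow> ordge r (f i)) \<Longrightarrow> ordge r (\<Sum>i\<in>I. f i)"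
  by (induct I rule: infinite_finite_induct) (auto intro: ordge_add)

lemma ordge_1: "ordge 0 1"
  by (simp add: ordge_def ord_1)

lemma ordge_of_nat: "ordge 0 (of_nat m)"
  by (induct m) (auto intro: ordge_add ordge_1)

lemma ordge_imp_0: "(\<And>r. ordge r x) \<Longrightarrow> x = 0"
proof (rule ccontr)
  assume *: "\<And>r. ordge r x" and "x \<noteq> 0"
  then obtain r where "ord x = ereal r" by (cases rule: ord_cases[of x]) auto
  with *[of "r + 1"] show False by (simp add: ordge_def)
qed

lemma ord_tendsto_iff: "ord_tendsto ord s x \<longleftrightarrow> (\<forall>M. \<exists>N. \<forall>k\<ge>N. ordge M (s k - x))"
proof
  assume "ord_tendsto ord s x"
  then show "\<forall>M. \<exists>N. \<forall>k\<ge>N. ordge M (s k - x)"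
    unfolding ord_tendsto_def tendsto_PInfty eventually_sequentially ordge_def
    by (meson less_imp_le)
next
  assume *: "\<forall>M. \<exists>N. \<forall>k\<ge>N. ordge M (s k - x)"
  show "ord_tendsto ord s x"
    unfolding ord_tendsto_def tendsto_PInfty eventually_sequentially
  proof
    fix r :: real
    obtain N where "\<forall>k\<ge>N. ordge (r + 1) (s k - x)" using * by blast
    moreover have "ereal r < ereal (r + 1)" by simp
    ultimately show "\<exists>N. \<forall>k\<ge>N. ereal r < ord (s k - x)"
      unfolding ordge_def using less_le_trans by blast
  qed
qed

lemma ord_tendsto_unique:
  assumes "ord_tendsto ord s x" "ord_tendsto ord s y"
  shows "x = y"
proof -
  have "ordge r (x - y)" for r
  proof -
    obtain N N' where "\<forall>k\<ge>N. ordge r (s k - x)" "\<forall>k\<ge>N'. ordge r (s k - y)"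
      using assms unfolding ord_tendsto_iff by meson
    then have "ordge r (s (max N N') - y)" "ordge r (s (max N N') - x)" by auto
    from ordge_diff[OF this] show ?thesis by simp
  qed
  then show ?thesis using ordge_imp_0[of "x - y"] by simp
qed

section \<open>Completeness of Q_p and of its finite extensions\<close>

definition ord_Cauchy :: "(nat \<Rightarrow> 'k) \<Rightarrow> bool" where
  "ord_Cauchy s \<longleftrightarrow> (\<forall>M. \<exists>N. \<forall>k\<ge>N. \<forall>l\<ge>N. ordge M (s k - s l))"

definition complete_set :: "'k set \<Rightarrow> bool" where
  "complete_set V \<longleftrightarrow> (\<forall>s. (\<forall>k. s k \<in> V) \<and> ord_Cauchy s \<longrightarrow> (\<exists>x\<in>V. ord_tendsto ord s x))"

lemma ord_tendsto_imp_Cauchy: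
  assumes "ord_tendsto ord s x"
  shows "ord_Cauchy s"
  unfolding ord_Cauchy_def
proof
  fix M
  obtain N where N: "\<forall>k\<ge>N. ordge M (s k - x)" using assms ord_tendsto_iff by blast
  have "ordge M (s k - s l)" if "k \<ge> N" "l \<ge> N" for k l
    using ordge_diff[of M "s k - x" "s l - x"] N that by simp
  then show "\<exists>N. \<forall>k\<ge>N. \<forall>l\<ge>N. ordge M (s k - s l)" by blast
qed

lemma subfield_Qp: "subfield (Qp ord) ring_of_type_algebra"
  using algebraic_closure_Qp by (simp add: algebraic_closure_def)

text \<open>The axiom \<open>Qp_complete\<close> only speaks of sequences of rationals.
  Approximating the \<open>k\<close>-th member by a rational up to order \<open>k\<close> gives a
  rational Cauchy sequence with the same limit.\<close>

lemma complete_Qp: "complete_set (Qp ord)"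
  unfolding complete_set_def
proof (intro allI impI, elim conjE)
  fix s assume s: "\<forall>k. s k \<in> Qp ord" and C: "ord_Cauchy s"
  have "\<exists>q. ordge (real k) (of_rat q - s k)" for k
  proof -
    obtain t :: "nat \<Rightarrow> rat" where "ord_tendsto ord (\<lambda>k. of_rat (t k)) (s k)"
      using s unfolding Qp_def by blast
    then obtain N where "\<forall>j\<ge>N. ordge (real k) (of_rat (t j) - s k)"
      unfolding ord_tendsto_iff by meson
    then show ?thesis by blast
  qed
  then obtain q where q: "\<And>k. ordge (real k) (of_rat (q k) - s k)" by metis
  have "\<exists>N. \<forall>k\<ge>N. \<forall>l\<ge>N. ord (of_rat (q k) - of_rat (q l)) \<ge> ereal M" for M
  proof -
    obtain N where N: "\<forall>k\<ge>N. \<forall>l\<ge>N. ordge M (s k - s l)" using C ord_Cauchy_def by blast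
    have "ordge M (of_rat (q k) - of_rat (q l))" if "k \<ge> max N (nat \<lceil>M\<rceil>)" "l \<ge> max N (nat \<lceil>M\<rceil>)" for k l
    proof -
      have "ordge M (of_rat (q k) - s k)" "ordge M (of_rat (q l) - s l)"
        using that by (auto intro: ordge_mono[OF q])
      from ordge_diff[OF this] have "ordge M ((of_rat (q k) - s k) - (of_rat (q l) - s l) + (s k - s l))"
        using N that by (intro ordge_add) auto
      then show ?thesis by simp
    qed
    then show ?thesis unfolding ordge_def by blast
  qed
  then obtain x where x: "ord_tendsto ord (\<lambda>k. of_rat (q k)) x" using Qp_complete by blast
  have "ord_tendsto ord s x" unfolding ord_tendsto_iff
  proof
    fix M
    obtain N where N: "\<forall>k\<ge>N. ordge M (of_rat (q k) - x)"
      using x unfolding ord_tendsto_iff by blast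
    have "ordge M (s k - x)" if "k \<ge> max N (nat \<lceil>M\<rceil>)" for k
    proof -
      have "ordge M (of_rat (q k) - s k)" using that by (auto intro: ordge_mono[OF q])
      then have "ordge M ((of_rat (q k) - x) - (of_rat (q k) - s k))" using N that by - (rule ordge_diff, auto)
      then show ?thesis by simp
    qed
    then show "\<exists>N. \<forall>k\<ge>N. ordge M (s k - x)" by blast
  qed
  moreover have "x \<in> Qp ord" using x unfolding Qp_def by blast
  ultimately show "\<exists>x\<in>Qp ord. ord_tendsto ord s x" by blast
qed

text \<open>
  A vector \<open>v\<close> outside the complete space \<open>V\<close> has bounded \<open>ord (v - e)\<close>, \<open>e \<in> V\<close>. Hence the coefficients
  of \<open>v\<close> in a Cauchy sequence of \<open>K v + V\<close> form a Cauchy sequence.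
\<close>

lemma complete_line_extension:
  assumes K: "subfield K ring_of_type_algebra" "complete_set K"
    and V: "complete_set V" "0 \<in> V" "\<And>x y. x \<in> V \<Longrightarrow> y \<in> V \<Longrightarrow> x + y \<in> V"
      "\<And>k x. k \<in> K \<Longrightarrow> x \<in> V \<Longrightarrow> k * x \<in> V"
    and v: "v \<notin> V"
  shows "complete_set {k * v + e | k e. k \<in> K \<and> e \<in> V}"
proof -
  note Kc = subfield_of_typeD[OF K(1)]
  have Vn: "- x \<in> V" if "x \<in> V" for x using V(4)[of "-1" x] Kc that by force
  have "\<exists>C. \<forall>e\<in>V. \<not> ordge C (v - e)"
  proof (rule ccontr)
    assume "\<nexists>C. \<forall>e\<in>V. \<not> ordge C (v - e)"
    then have "\<forall>k::nat. \<exists>e\<in>V. ordge (real k) (v - e)" by blast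
    then obtain e where e: "\<And>k. e k \<in> V" "\<And>k. ordge (real k) (v - e k)" by metis
    \<comment> \<open>Approximations of \<open>v\<close> from \<open>V\<close> of every order would
      converge to \<open>v\<close> and, by completeness, put it into \<open>V\<close>.\<close>
    have "ord_tendsto ord e v" unfolding ord_tendsto_iff
    proof
      fix M
      have "ordge M (e k - v)" if "k \<ge> nat \<lceil>M\<rceil>" for k
        using ordge_mono[OF e(2)[of k], of M] that ordge_minus_commute by auto
      then show "\<exists>N. \<forall>k\<ge>N. ordge M (e k - v)" by blast
    qed
    then obtain x where "x \<in> V" "ord_tendsto ord e x"
      using V(1) ord_tendsto_imp_Cauchy e(1) unfolding complete_set_def by blast
    then show False using ord_tendsto_unique \<open>ord_tendsto ord e v\<close> v by blast
  qed
  then obtain C where C: "\<And>e. e \<in> V \<Longrightarrow> \<not> ordge C (v - e)" by blast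
  \<comment> \<open>Dividing by \<open>k\<close> turns \<open>k * v + e\<close> into
    \<open>k * (v - e')\<close> with \<open>e'\<close> in \<open>V\<close>. Since
    \<open>v - e'\<close> has order below \<open>C\<close>, smallness of the product must come from
    \<open>k\<close>.\<close>
  have coeff: "ordge (M - C) k" if k: "k \<in> K" and e: "e \<in> V" and M: "ordge M (k * v + e)" for k e M
  proof (cases "k = 0")
    case False
    define e' where "e' = inverse k * (- e)"
    have "e' \<in> V" unfolding e'_def using Kc(6) k V(4) Vn e by blast
    have "k * v + e = k * (v - e')" using False by (simp add: e'_def field_simps)
    then have "ereal M \<le> ord k + ord (v - e')" using M by (simp add: ordge_def ord_mult)
    moreover have "ord (v - e') < ereal C" using C[OF \<open>e' \<in> V\<close>] by (simp add: ordge_def)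
    ultimately show ?thesis unfolding ordge_def
      by (cases rule: ord_cases[of k]; cases rule: ord_cases[of "v - e'"]) auto
  qed auto
  have "v \<noteq> 0" using V(2) v by blast
  then obtain w where w: "ord v = ereal w" by (cases rule: ord_cases[of v]) auto
  then have w': "ordge w v" by (simp add: ordge_def)
  show ?thesis unfolding complete_set_def
  proof (intro allI impI, elim conjE)
    fix s assume "\<forall>k. s k \<in> {k * v + e | k e. k \<in> K \<and> e \<in> V}" and Cs: "ord_Cauchy s"
    then have "\<forall>i. \<exists>a e. s i = a * v + e \<and> a \<in> K \<and> e \<in> V" by blast
    then obtain a e where ae: "\<And>i. s i = a i * v + e i" "\<And>i. a i \<in> K" "\<And>i. e i \<in> V" by metis
    have Ca: "ord_Cauchy a" unfolding ord_Cauchy_def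
    proof
      fix M
      obtain N where N: "\<forall>k\<ge>N. \<forall>l\<ge>N. ordge (M + C) (s k - s l)" using Cs ord_Cauchy_def by blast
      have "ordge M (a k - a l)" if "k \<ge> N" "l \<ge> N" for k l
      proof -
        have "ordge (M + C) ((a k - a l) * v + (e k - e l))"
          using N that by (simp add: ae(1) algebra_simps)
        moreover have "a k - a l \<in> K" using Kc(3)[OF ae(2) Kc(5)[OF ae(2)]] by (metis uminus_add_conv_diff add.commute)
        moreover have "e k - e l \<in> V" using V(3)[OF ae(3) Vn[OF ae(3)]] by (metis uminus_add_conv_diff add.commute)
        ultimately show ?thesis using coeff by fastforce
      qed
      then show "\<exists>N. \<forall>k\<ge>N. \<forall>l\<ge>N. ordge M (a k - a l)" by blast
    qed
    then obtain x where x: "x \<in> K" "ord_tendsto ord a x" using K(2) ae(2) unfolding complete_set_def by blast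
    have "ord_Cauchy e" unfolding ord_Cauchy_def
    proof
      fix M
      obtain N where N: "\<forall>k\<ge>N. \<forall>l\<ge>N. ordge M (s k - s l)" using Cs ord_Cauchy_def by blast
      obtain N' where N': "\<forall>k\<ge>N'. \<forall>l\<ge>N'. ordge (M - w) (a k - a l)" using Ca ord_Cauchy_def by blast
      have "ordge M (e k - e l)" if "k \<ge> max N N'" "l \<ge> max N N'" for k l
      proof -
        have "ordge M ((a k - a l) * v)" using N' that by (intro ordge_mult_le[OF _ w', of "M - w"]) auto
        then have "ordge M ((s k - s l) - (a k - a l) * v)" using N that by - (rule ordge_diff, auto)
        then show ?thesis by (simp add: ae(1) algebra_simps)
      qed
      then show "\<exists>N. \<forall>k\<ge>N. \<forall>l\<ge>N. ordge M (e k - e l)" by blast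
    qed
    then obtain y where y: "y \<in> V" "ord_tendsto ord e y" using V(1) ae(3) unfolding complete_set_def by blast
    have "ord_tendsto ord s (x * v + y)" unfolding ord_tendsto_iff
    proof
      fix M
      obtain N where N: "\<forall>k\<ge>N. ordge M (e k - y)" using y ord_tendsto_iff by blast
      obtain N' where N': "\<forall>k\<ge>N'. ordge (M - w) (a k - x)" using x ord_tendsto_iff by blast
      have "ordge M (s k - (x * v + y))" if "k \<ge> max N N'" for k
      proof -
        have "ordge M ((a k - x) * v)" using N' that by (intro ordge_mult_le[OF _ w', of "M - w"]) auto
        then have "ordge M ((a k - x) * v + (e k - y))" using N that by (intro ordge_add) auto
        then show ?thesis by (simp add: ae(1) algebra_simps)
      qed
      then show "\<exists>N. \<forall>k\<ge>N. ordge M (s k - (x * v + y))" by blast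
    qed
    then show "\<exists>x\<in>{k * v + e | k e. k \<in> K \<and> e \<in> V}. ord_tendsto ord s x" using x y by blast
  qed
qed

text \<open>Induction along the construction of a finite-dimensional space by adding one line at a
  time. The closure properties of the space are carried along because
  \<open>complete_line_extension\<close> needs them.\<close>

lemma complete_finite_dimension:
  assumes K: "subfield K ring_of_type_algebra" "complete_set K"
    and V: "ring.dimension ring_of_type_algebra d K V"
  shows "complete_set V"
proof -
  interpret F: field "ring_of_type_algebra :: 'k ring" by (rule field_from_type_algebra)
  have s: "carrier (ring_of_type_algebra :: 'k ring) = UNIV" "\<zero>\<^bsub>ring_of_type_algebra\<^esub> = (0::'k)"
    "\<And>x y::'k. x \<oplus>\<^bsub>ring_of_type_algebra\<^esub> y = x + y"
    "\<And>x y::'k. x \<otimes>\<^bsub>ring_of_type_algebra\<^esub> y = x * y"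
    by (simp_all add: ring_of_type_algebra_def)
  have "complete_set V \<and> 0 \<in> V \<and> (\<forall>x\<in>V. \<forall>y\<in>V. x + y \<in> V) \<and> (\<forall>k\<in>K. \<forall>x\<in>V. k * x \<in> V)"
    using V K
  proof (induct rule: F.dimension.induct)
    case (zero_dim K)
    have "ord_tendsto ord s 0" if "\<forall>k. s k = 0" for s
      using that by (simp add: ord_tendsto_iff)
    then show ?case by (simp add: s complete_set_def)
  next
    case (Suc_dim v E d K)
    note Kc = subfield_of_typeD[OF Suc_dim.prems(1)]
    have "x \<in> F.line_extension K v E \<longleftrightarrow> (\<exists>k\<in>K. \<exists>e\<in>E. x = k * v + e)" for x
      unfolding F.line_extension_mem_iff by (simp only: s)
    then have le: "F.line_extension K v E = {k * v + e | k e. k \<in> K \<and> e \<in> E}" by blast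
    have E: "complete_set E" "0 \<in> E" "\<And>x y. x \<in> E \<Longrightarrow> y \<in> E \<Longrightarrow> x + y \<in> E"
      "\<And>k x. k \<in> K \<Longrightarrow> x \<in> E \<Longrightarrow> k * x \<in> E"
      using Suc_dim by blast+
    have "complete_set {k * v + e | k e. k \<in> K \<and> e \<in> E}"
      using complete_line_extension[OF Suc_dim.prems E] Suc_dim(2) by blast
    moreover have "\<exists>k e. 0 = k * v + e \<and> k \<in> K \<and> e \<in> E"
      using Kc(1) E(2) by (intro exI[of _ 0]) auto
    moreover have "\<exists>k' e'. (k1 * v + e1) + (k2 * v + e2) = k' * v + e' \<and> k' \<in> K \<and> e' \<in> E"
      if "k1 \<in> K" "k2 \<in> K" "e1 \<in> E" "e2 \<in> E" for k1 k2 e1 e2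
      using Kc(3) E(3) that by - (rule exI[of _ "k1 + k2"], rule exI[of _ "e1 + e2"], simp add: algebra_simps)
    moreover have "\<exists>k' e'. k * (k1 * v + e1) = k' * v + e' \<and> k' \<in> K \<and> e' \<in> E"
      if "k1 \<in> K" "k \<in> K" "e1 \<in> E" for k k1 e1
    proof -
      have "k * (k1 * v + e1) = (k * k1) * v + k * e1" by (simp only: distrib_left mult.assoc)
      moreover have "k * k1 \<in> K" "k * e1 \<in> E" using Kc(4) E(4) that by blast+
      ultimately show ?thesis by blast
    qed
    ultimately show ?case unfolding le by blast
  qed
  then show ?thesis by blast
qed

text \<open>The ambient field is algebraic over Q_p, so adjoining \<open>x\<close> to
  \<open>Q\<close> gives a simple algebraic extension. It has finite dimension over
  \<open>Q\<close>, which is itself finite over the complete field Q_p.\<close>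

lemma subfield_and_complete_generate_field:
  fixes x :: "'k"
  assumes Q: "unramified_extension ord d Q"
  defines "\<Omega> \<equiv> generate_field ring_of_type_algebra (insert x Q)"
  shows "subfield \<Omega> ring_of_type_algebra" "complete_set \<Omega>" "Qp ord \<subseteq> \<Omega>" "x \<in> \<Omega>"
proof -
  interpret F: field "ring_of_type_algebra :: 'k ring" by (rule field_from_type_algebra)
  have car: "carrier (ring_of_type_algebra :: 'k ring) = UNIV"
    by (simp add: ring_of_type_algebra_def)
  have sQ: "subfield Q ring_of_type_algebra" and QpQ: "Qp ord \<subseteq> Q"
    and dQ: "ring.dimension ring_of_type_algebra d (Qp ord) Q"
    using Q by (auto simp: unramified_extension_def)
  show sO: "subfield \<Omega> ring_of_type_algebra"
    unfolding \<Omega>_def by (rule F.generate_field_is_subfield) (simp add: car)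
  have inc: "insert x Q \<subseteq> \<Omega>" unfolding \<Omega>_def by (auto intro: generate_field.incl)
  then show "Qp ord \<subseteq> \<Omega>" "x \<in> \<Omega>" using QpQ by auto
  have alg: "(ring.algebraic ring_of_type_algebra over (Qp ord)) x"
    using algebraic_closure.algebraic_extension[OF algebraic_closure_Qp, of x] by (simp add: car)
  then have alg: "(ring.algebraic ring_of_type_algebra over Q) x"
    using F.algebraic_mono[OF QpQ] by blast
  have "subfield (F.simple_extension Q x) ring_of_type_algebra"
    using F.simple_extension_is_subfield[OF sQ] alg car by auto
  moreover have "insert x Q \<subseteq> F.simple_extension Q x"
    using F.simple_extension_incl[of Q x] F.simple_extension_mem[OF subfieldE(1)[OF sQ]] by (simp add: car)
  ultimately have "\<Omega> \<subseteq> F.simple_extension Q x"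
    unfolding \<Omega>_def using F.generate_field_min_subfield1 by (simp add: car)
  moreover have "F.simple_extension Q x \<subseteq> \<Omega>"
    using F.simple_extension_subring_incl[OF subfieldE(1)[OF sO]] inc by simp
  ultimately have eq: "\<Omega> = F.simple_extension Q x" by blast
  have "complete_set Q"
    by (rule complete_finite_dimension[OF subfield_Qp complete_Qp dQ])
  then show "complete_set \<Omega>"
    unfolding eq using complete_finite_dimension[OF sQ _ F.dimension_simple_extension[OF sQ _ alg]]
    by (simp add: car)
qed

end

section \<open>Complete coefficient fields and weighted spaces\<close>

locale complete_coefficients = padic_closure p ord
  for p :: nat and ord :: "'k::field_char_0 \<Rightarrow> ereal" +
  fixes \<Omega> :: "'k set"
  assumes subfield_\<Omega>: "subfield \<Omega> ring_of_type_algebra"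
    and complete_\<Omega>: "complete_set \<Omega>"
    and Qp_subset: "Qp ord \<subseteq> \<Omega>"
begin

lemmas \<Omega>_closed [simp, intro] = subfield_of_typeD[OF subfield_\<Omega>]

lemma \<Omega>_diff [simp, intro]: "x \<in> \<Omega> \<Longrightarrow> y \<in> \<Omega> \<Longrightarrow> x - y \<in> \<Omega>"
  using \<Omega>_closed(3)[of x "- y"] by simp

lemma \<Omega>_divide [simp, intro]: "x \<in> \<Omega> \<Longrightarrow> y \<in> \<Omega> \<Longrightarrow> x / y \<in> \<Omega>"
  by (simp add: divide_inverse)

lemma \<Omega>_sum [simp, intro]: "(\<And>i. i \<in> I \<Longrightarrow> f i \<in> \<Omega>) \<Longrightarrow> (\<Sum>i\<in>I. f i) \<in> \<Omega>"
  by (induct I rule: infinite_finite_induct) auto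

lemma \<Omega>_of_nat [simp, intro]: "of_nat m \<in> \<Omega>"
  by (induct m) auto

lemma \<Omega>_power [simp, intro]: "x \<in> \<Omega> \<Longrightarrow> x ^ m \<in> \<Omega>"
  by (induct m) auto

lemma ord_sum_ge:
  fixes B :: ereal
  assumes "\<And>i. i \<in> I \<Longrightarrow> B \<le> ord (f i)"
  shows "B \<le> ord (\<Sum>i\<in>I. f i)"
  using assms
proof (induct I rule: infinite_finite_induct)
  case (insert i I)
  then have "B \<le> min (ord (f i)) (ord (\<Sum>i\<in>I. f i))" by simp
  also have "\<dots> \<le> ord (f i + (\<Sum>i\<in>I. f i))" by (rule ord_add)
  finally show ?case using insert by simp
qed auto

text \<open>The geometric bound with rate \<epsilon> gives existence of the sum. The last conclusion
  is separate: any bound \<open>B\<close> shared by all terms, even one unrelated to that rate or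
  infinite, passes to the sum.\<close>

lemma series_limit:
  assumes f: "\<And>k. f k \<in> \<Omega>" "\<And>k. ordge (A + real k * \<epsilon>) (f k)" and \<epsilon>: "\<epsilon> > 0"
  obtains y where "y \<in> \<Omega>" "\<And>N. ordge (A + real N * \<epsilon>) (y - (\<Sum>k<N. f k))"
    "\<And>B. (\<And>k. B \<le> ord (f k)) \<Longrightarrow> B \<le> ord y"
proof -
  define s where "s N = (\<Sum>k<N. f k)" for N
  have tail: "ordge (A + real N * \<epsilon>) (s (N + M) - s N)" for N M
  proof (induct M)
    case (Suc M)
    have "A + real N * \<epsilon> \<le> A + real (N + M) * \<epsilon>" using \<epsilon> by simp
    then have "ordge (A + real N * \<epsilon>) (f (N + M))" using f(2) ordge_mono by blast
    then have "ordge (A + real N * \<epsilon>) ((s (N + M) - s N) + f (N + M))" using Suc by (rule ordge_add[rotated])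
    then show ?case by (simp add: s_def algebra_simps)
  qed simp
  have tail': "ordge (A + real N * \<epsilon>) (s k - s N)" if "k \<ge> N" for k N
    using tail[of N "k - N"] that by simp
  have arch: "\<exists>N. M \<le> A + real N * \<epsilon>" for M
  proof -
    obtain N where "(M - A) / \<epsilon> \<le> real N" using real_arch_simple by blast
    then show ?thesis using \<epsilon> by (intro exI[of _ N]) (simp add: field_simps)
  qed
  have "ord_Cauchy s" unfolding ord_Cauchy_def
  proof
    fix M
    obtain N where N: "M \<le> A + real N * \<epsilon>" using arch by blast
    have "ordge M (s k - s l)" if "k \<ge> N" "l \<ge> N" for k l
      using ordge_diff[OF tail'[OF that(1)] tail'[OF that(2)]] N ordge_mono by fastforce
    then show "\<exists>N. \<forall>k\<ge>N. \<forall>l\<ge>N. ordge M (s k - s l)" by blast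
  qed
  moreover have "\<forall>k. s k \<in> \<Omega>" using f(1) by (auto simp: s_def)
  ultimately obtain y where y: "y \<in> \<Omega>" "ord_tendsto ord s y"
    using complete_\<Omega> unfolding complete_set_def by blast
  have lim: "ordge (A + real N * \<epsilon>) (y - s N)" for N
  proof -
    obtain N' where "\<forall>k\<ge>N'. ordge (A + real N * \<epsilon>) (s k - y)" using y ord_tendsto_iff by blast
    then have "ordge (A + real N * \<epsilon>) (s (max N N') - y)" by simp
    from ordge_diff[OF tail'[of N "max N N'"] this] show ?thesis by simp
  qed
  have "B \<le> ord y" if B: "\<And>k. B \<le> ord (f k)" for B
  proof (rule ccontr)
    assume "\<not> B \<le> ord y"
    then have less: "ord y < B" by simp
    then obtain r where r: "ord y = ereal r" by (cases rule: ord_cases[of y]) auto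
    obtain N where N: "r + 1 \<le> A + real N * \<epsilon>" using arch by blast
    have "ereal r < ord (y - s N)"
      using lim[of N] N unfolding ordge_def by (cases "ord (y - s N)") auto
    moreover have "ereal r < ord (s N)"
      using ord_sum_ge[of "{..<N}" B f] B less r unfolding s_def by auto
    ultimately have "ereal r < min (ord (y - s N)) (ord (s N))" by simp
    also have "\<dots> \<le> ord y" using ord_add[of "y - s N" "s N"] by simp
    finally show False using r by simp
  qed
  with y(1) lim show ?thesis using that unfolding s_def by blast
qed

definition weighted :: "('i \<Rightarrow> ereal) \<Rightarrow> ('i \<Rightarrow> 'k) set" where
  "weighted \<alpha> = {F. \<forall>u. F u \<in> \<Omega> \<and> \<alpha> u \<le> ord (F u)}"

abbreviation rweighted :: "('i \<Rightarrow> real) \<Rightarrow> real \<Rightarrow> ('i \<Rightarrow> 'k) set" where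
  "rweighted \<alpha> \<sigma> \<equiv> weighted (\<lambda>u. ereal (\<alpha> u + \<sigma>))"

lemma weighted_add: "F \<in> weighted \<alpha> \<Longrightarrow> G \<in> weighted \<alpha> \<Longrightarrow> (\<lambda>u. F u + G u) \<in> weighted \<alpha>"
  unfolding weighted_def using ord_add by (fastforce intro: order_trans[rotated])

lemma weighted_uminus: "F \<in> weighted \<alpha> \<Longrightarrow> (\<lambda>u. - F u) \<in> weighted \<alpha>"
  by (simp add: weighted_def)

lemma weighted_diff: "F \<in> weighted \<alpha> \<Longrightarrow> G \<in> weighted \<alpha> \<Longrightarrow> (\<lambda>u. F u - G u) \<in> weighted \<alpha>"
  using weighted_add[OF _ weighted_uminus, of F \<alpha> G] by simp

lemma weighted_sum:
  "(\<And>i. i \<in> I \<Longrightarrow> F i \<in> weighted \<alpha>) \<Longrightarrow> (\<lambda>u. \<Sum>i\<in>I. F i u) \<in> weighted \<alpha>"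
  unfolding weighted_def by (auto intro!: ord_sum_ge)

lemma rweighted_iff: "F \<in> rweighted \<alpha> \<sigma> \<longleftrightarrow> (\<forall>u. F u \<in> \<Omega> \<and> ordge (\<alpha> u + \<sigma>) (F u))"
  by (simp add: weighted_def ordge_def)

lemma rweighted_mono: "F \<in> rweighted \<alpha> \<sigma> \<Longrightarrow> \<tau> \<le> \<sigma> \<Longrightarrow> F \<in> rweighted \<alpha> \<tau>"
  unfolding rweighted_iff by (auto intro: ordge_mono)

lemma rweighted_all_imp_0:
  assumes "\<And>N::nat. F \<in> rweighted \<alpha> (\<sigma> + real N * \<epsilon>)" "\<epsilon> > 0"
  shows "F u = 0"
proof (rule ordge_imp_0)
  fix r
  obtain N where "(r - \<alpha> u - \<sigma>) / \<epsilon> \<le> real N" using real_arch_simple by blast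
  then have "r \<le> \<alpha> u + (\<sigma> + real N * \<epsilon>)" using assms(2) by (simp add: field_simps)
  then show "ordge r (F u)" using assms(1)[of N] ordge_mono unfolding rweighted_iff by blast
qed

text \<open>
  Convergence of the iteration is measured in the real weights \<open>\<alpha>'\<close>, \<open>\<beta>'\<close>, in which every step gains
  \<open>\<epsilon>\<close>; the weights \<open>\<alpha>\<close>, \<open>\<beta>\<close> need only be preserved, since the bounds they impose are closed
  conditions. The value \<open>\<infinity>\<close> of \<open>\<alpha>\<close> or \<open>\<beta>\<close> encodes a restriction of the support.
\<close>

lemma successive_approximation:
  fixes T :: "('i \<Rightarrow> 'k) \<Rightarrow> 'j \<Rightarrow> 'k" and \<Phi> :: "('j \<Rightarrow> 'k) \<Rightarrow> 'i \<Rightarrow> 'k"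
  assumes \<epsilon>: "\<epsilon> > 0"
    and res: "\<And>F. F \<in> weighted \<alpha> \<Longrightarrow> (\<lambda>u. F u - T (\<Phi> F) u) \<in> weighted \<alpha>"
    and res': "\<And>F \<sigma>. F \<in> weighted \<alpha> \<Longrightarrow> F \<in> rweighted \<alpha>' \<sigma> \<Longrightarrow>
          (\<lambda>u. F u - T (\<Phi> F) u) \<in> rweighted \<alpha>' (\<sigma> + \<epsilon>)"
    and Phi: "\<And>F. F \<in> weighted \<alpha> \<Longrightarrow> \<Phi> F \<in> weighted \<beta>"
    and Phi': "\<And>F \<sigma>. F \<in> weighted \<alpha> \<Longrightarrow> F \<in> rweighted \<alpha>' \<sigma> \<Longrightarrow> \<Phi> F \<in> rweighted \<beta>' \<sigma>"
    and T_add: "\<And>y z \<sigma>. y \<in> rweighted \<beta>' \<sigma> \<Longrightarrow> z \<in> rweighted \<beta>' \<sigma> \<Longrightarrow>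
          T (\<lambda>i. y i + z i) = (\<lambda>u. T y u + T z u)"
    and T: "\<And>y \<sigma>. y \<in> rweighted \<beta>' \<sigma> \<Longrightarrow> T y \<in> rweighted \<alpha>' (\<sigma> - C)"
    and F: "F \<in> weighted \<alpha>" "F \<in> rweighted \<alpha>' \<sigma>"
  shows "\<exists>y. y \<in> weighted \<beta> \<and> y \<in> rweighted \<beta>' \<sigma> \<and> T y = F"
proof -
  define R where "R = (\<lambda>F u. F u - T (\<Phi> F) u)"
  define Fs where "Fs k = (R ^^ k) F" for k
  have Fs: "Fs k \<in> weighted \<alpha> \<and> Fs k \<in> rweighted \<alpha>' (\<sigma> + real k * \<epsilon>)" for k
  proof (induct k)
    case (Suc k)
    then have "R (Fs k) \<in> weighted \<alpha>" "R (Fs k) \<in> rweighted \<alpha>' (\<sigma> + real k * \<epsilon> + \<epsilon>)"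
      unfolding R_def using res res' by blast+
    then show ?case by (simp add: Fs_def algebra_simps)
  qed (use F in \<open>simp add: Fs_def\<close>)
  define ys where "ys k = \<Phi> (Fs k)" for k
  have ys: "ys k \<in> weighted \<beta>" "ys k \<in> rweighted \<beta>' (\<sigma> + real k * \<epsilon>)" for k
    unfolding ys_def using Phi Phi' Fs by blast+
  have "\<exists>y. y \<in> \<Omega> \<and> (\<forall>N. ordge (\<beta>' i + \<sigma> + real N * \<epsilon>) (y - (\<Sum>k<N. ys k i))) \<and>
      (\<forall>B. (\<forall>k. B \<le> ord (ys k i)) \<longrightarrow> B \<le> ord y)" for i
  proof -
    have "\<And>k. ys k i \<in> \<Omega>" "\<And>k. ordge (\<beta>' i + \<sigma> + real k * \<epsilon>) (ys k i)"
      using ys(2) unfolding rweighted_iff by (auto simp: add.assoc)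
    from series_limit[OF this \<epsilon>] show ?thesis by metis
  qed
  then obtain y where y: "\<And>i. y i \<in> \<Omega>"
      "\<And>i N. ordge (\<beta>' i + \<sigma> + real N * \<epsilon>) (y i - (\<Sum>k<N. ys k i))"
      "\<And>i B. (\<And>k. B \<le> ord (ys k i)) \<Longrightarrow> B \<le> ord (y i)" by metis
  have yw: "y \<in> weighted \<beta>" using y(1,3) ys(1) by (auto simp: weighted_def)
  define S where "S N = (\<lambda>i. \<Sum>k<N. ys k i)" for N
  have S: "S N \<in> rweighted \<beta>' \<sigma>" for N
    unfolding S_def using ys(2) \<epsilon> by (intro weighted_sum rweighted_mono[OF ys(2)]) auto
  have rest: "(\<lambda>i. y i - S N i) \<in> rweighted \<beta>' (\<sigma> + real N * \<epsilon>)" for N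
    unfolding rweighted_iff S_def using y(1,2) ys(1) by (auto simp: add.assoc weighted_def)
  have yw': "y \<in> rweighted \<beta>' \<sigma>" using rest[of 0] by (simp add: S_def)
  have TS: "(\<lambda>u. F u - T (S N) u) = Fs N" for N
  proof (induct N)
    case 0
    have "(\<lambda>_. 0) \<in> rweighted \<beta>' 0" by (simp add: weighted_def)
    from T_add[OF this this] have "T (\<lambda>_. 0) = (\<lambda>_. 0)" by (metis add_cancel_right_right)
    then show ?case by (simp add: S_def Fs_def)
  next
    case (Suc N)
    have "ys N \<in> rweighted \<beta>' \<sigma>" using \<epsilon> by (intro rweighted_mono[OF ys(2)]) auto
    from T_add[OF S this] have "T (S (Suc N)) = (\<lambda>u. T (S N) u + T (ys N) u)"
      by (simp add: S_def)
    then have "(\<lambda>u. F u - T (S (Suc N)) u) = (\<lambda>u. (F u - T (S N) u) - T (ys N) u)" by (simp add: algebra_simps)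
    also have "\<dots> = R (Fs N)" using Suc by (simp add: R_def ys_def fun_eq_iff)
    finally show ?case by (simp add: Fs_def)
  qed
  \<comment> \<open>The residual \<open>Fs N\<close> and the image of the rest of the series are
    both small; the absolute value of \<open>C\<close> accommodates both with one constant.\<close>
  have "(\<lambda>u. F u - T y u) \<in> rweighted \<alpha>' ((\<sigma> - \<bar>C\<bar>) + real N * \<epsilon>)" for N
  proof -
    have "(\<lambda>i. y i - S N i) \<in> rweighted \<beta>' \<sigma>" using \<epsilon> by (intro rweighted_mono[OF rest]) auto
    from T_add[OF S[of N] this] have "T y = (\<lambda>u. T (S N) u + T (\<lambda>i. y i - S N i) u)" by simp
    then have *: "(\<lambda>u. F u - T y u) = (\<lambda>u. Fs N u - T (\<lambda>i. y i - S N i) u)"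
      by (simp add: TS[symmetric] fun_eq_iff)
    show ?thesis unfolding *
      by (intro weighted_diff rweighted_mono[OF conjunct2[OF Fs]] rweighted_mono[OF T[OF rest]]) auto
  qed
  from rweighted_all_imp_0[OF this \<epsilon>] have "T y = F" by (simp add: fun_eq_iff)
  with yw yw' show ?thesis by blast
qed

end

text \<open>The full sum vanishes, so \<gamma>_i is minus the sum of the terms with index at least
  \<open>i + 1\<close>. The term of index \<open>j\<close> has order
  \<open>p^j / (p - 1) - j\<close>, which is nondecreasing in \<open>j\<close>, so the first omitted
  index decides.\<close>

lemma (in padic_closure) ordge_gamma_sum:
  assumes "is_gamma p ord \<gamma>"
  shows "ordge (real p ^ (i + 1) / (real p - 1) - real (i + 1)) (gamma_sum p \<gamma> i)"
proof -
  have p: "real p > 1" using prime_gt_1_nat[OF prime_p] by simp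
  define e where "e j = real p ^ j / (real p - 1) - real j" for j
  have e_Suc: "e j \<le> e (Suc j)" for j
  proof -
    have "real p ^ Suc j / (real p - 1) - real p ^ j / (real p - 1) = (real p - 1) * real p ^ j / (real p - 1)"
      by (simp only: diff_divide_distrib[symmetric] left_diff_distrib power_Suc mult_1)
    also have "\<dots> = real p ^ j" using p by simp
    finally have "e (Suc j) - e j = real p ^ j - 1" unfolding e_def of_nat_Suc by linarith
    then show ?thesis using p one_le_power[of "real p" j] by linarith
  qed
  have emono: "e j \<le> e k" if "j \<le> k" for j k using lift_Suc_mono_le[of e, OF e_Suc that] .
  have "p \<noteq> 0" using p by auto
  have op: "ord (of_nat p ^ j) = ereal (real j)" for j
    using ord_power[of "of_nat p" 1 j] ord_p by (simp add: one_ereal_def)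
  have summand: "ordge (e j) (\<gamma> ^ (p ^ j) / of_nat p ^ j)" for j
  proof -
    have "ord (\<gamma> ^ (p ^ j)) = ereal (real (p ^ j) * (1 / (real p - 1)))"
      using assms by (intro ord_power) (simp add: is_gamma_def)
    moreover have "ord (inverse (of_nat p ^ j :: 'k)) = ereal (- real j)"
      using \<open>p \<noteq> 0\<close> op by (intro ord_inverse) auto
    ultimately show ?thesis unfolding divide_inverse ordge_def ord_mult e_def by simp
  qed
  have "ord_tendsto ord (\<lambda>N. \<Sum>j<N. \<gamma> ^ (p ^ j) / of_nat p ^ j) 0"
    using assms by (simp add: is_gamma_def)
  then have "\<exists>N. \<forall>k\<ge>N. ordge (e (i + 1)) ((\<Sum>j<k. \<gamma> ^ (p ^ j) / of_nat p ^ j) - 0)"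
    unfolding ord_tendsto_iff by (rule spec)
  then obtain N where N: "\<forall>k\<ge>N. ordge (e (i + 1)) (\<Sum>j<k. \<gamma> ^ (p ^ j) / of_nat p ^ j)"
    unfolding diff_zero by (rule exE)
  \<comment> \<open>A long partial sum stands in for the vanishing total: \<open>N\<close> makes it
    small enough, and \<open>i + 1\<close> makes it contain all terms of \<gamma>_i.\<close>
  define M where "M = max N (i + 1)"
  have split: "sum g {..<M} = sum g {..i} + sum g {i+1..<M}" for g :: "nat \<Rightarrow> 'k"
  proof -
    have "{..<M} = {..i} \<union> {i+1..<M}" by (auto simp: M_def)
    moreover have "sum g ({..i} \<union> {i+1..<M}) = sum g {..i} + sum g {i+1..<M}"
      by (rule sum.union_disjoint) auto
    ultimately show ?thesis by (simp only:)
  qed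
  have "(\<Sum>j<M. \<gamma> ^ (p ^ j) / of_nat p ^ j) =
      gamma_sum p \<gamma> i + (\<Sum>j\<in>{i+1..<M}. \<gamma> ^ (p ^ j) / of_nat p ^ j)"
    unfolding gamma_sum_def by (rule split)
  then have "gamma_sum p \<gamma> i =
      (\<Sum>j<M. \<gamma> ^ (p ^ j) / of_nat p ^ j) - (\<Sum>j\<in>{i+1..<M}. \<gamma> ^ (p ^ j) / of_nat p ^ j)" by (simp only: add_diff_cancel_right')
  moreover have "ordge (e (i + 1)) (\<Sum>j<M. \<gamma> ^ (p ^ j) / of_nat p ^ j)" using N by (simp add: M_def)
  moreover have "ordge (e (i + 1)) (\<Sum>j\<in>{i+1..<M}. \<gamma> ^ (p ^ j) / of_nat p ^ j)"
    by (intro ordge_sum ordge_mono[OF summand] emono) auto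
  ultimately have "ordge (e (i + 1)) (gamma_sum p \<gamma> i)" using ordge_diff by simp
  then show ?thesis by (simp only: e_def)
qed

section \<open>Series in the variables \<open>x\<^sub>0, \<dots>, x\<^sub>n\<close>\<close>

definition uexps :: "nat \<Rightarrow> (nat \<Rightarrow> nat) set" where
  "uexps n = {u. \<forall>k>n. u k = 0}"

definition udeg :: "nat \<Rightarrow> (nat \<Rightarrow> nat) \<Rightarrow> nat" where
  "udeg n u = (\<Sum>k\<le>n. u k)"

definition xmul :: "nat \<Rightarrow> ((nat \<Rightarrow> nat) \<Rightarrow> 'a::comm_ring_1) \<Rightarrow> (nat \<Rightarrow> nat) \<Rightarrow> 'a" where
  "xmul k F = (\<lambda>u. if u k = 0 then 0 else F (u(k := u k - 1)))"

definition gmul :: "(nat \<Rightarrow> 'a::comm_ring_1) \<Rightarrow> nat \<Rightarrow> ((nat \<Rightarrow> nat) \<Rightarrow> 'a) \<Rightarrow> (nat \<Rightarrow> nat) \<Rightarrow> 'a" where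
  "gmul h k F = (\<lambda>u. \<Sum>d=1..u k. h d * F (u(k := u k - d)))"

text \<open>If \<open>h d\<close> is \<open>d\<close> times the coefficient of \<open>x^d\<close> in
  a one-variable series \<open>H\<close>, this is the derivation \<open>x_k d/dx_k\<close>
  conjugated by \<open>exp H(x_k)\<close>.\<close>

definition nabla :: "(nat \<Rightarrow> 'a::comm_ring_1) \<Rightarrow> nat \<Rightarrow> ((nat \<Rightarrow> nat) \<Rightarrow> 'a) \<Rightarrow> (nat \<Rightarrow> nat) \<Rightarrow> 'a" where
  "nabla h k F = (\<lambda>u. of_nat (u k) * F u + gmul h k F u)"

definition Dop :: "(nat \<Rightarrow> 'a::comm_ring_1) \<Rightarrow> nat \<Rightarrow> ((nat \<Rightarrow> nat) \<Rightarrow> 'a) \<Rightarrow> (nat \<Rightarrow> nat) \<Rightarrow> 'a" where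
  "Dop h l F = (\<lambda>u. nabla h l F u - nabla h 0 F u)"

text \<open>\<open>xsub l\<close> is the substitution of \<open>x\<^sub>0\<close> for \<open>x\<^sub>l\<close>, and \<open>xdiff l F\<close> is \<open>(F - xsub l F) / (x\<^sub>l - x\<^sub>0)\<close>.\<close>

definition xsub :: "nat \<Rightarrow> ((nat \<Rightarrow> nat) \<Rightarrow> 'a::comm_ring_1) \<Rightarrow> (nat \<Rightarrow> nat) \<Rightarrow> 'a" where
  "xsub l F = (\<lambda>u. if u l = 0 then \<Sum>i\<le>u 0. F (u(0 := u 0 - i, l := i)) else 0)"

definition xdiff :: "nat \<Rightarrow> ((nat \<Rightarrow> nat) \<Rightarrow> 'a::comm_ring_1) \<Rightarrow> (nat \<Rightarrow> nat) \<Rightarrow> 'a" where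
  "xdiff l F = (\<lambda>u. \<Sum>i\<le>u 0. F (u(0 := i, l := u l + 1 + u 0 - i)))"

text \<open>The coefficient of \<open>T^D\<close> after all variables are set equal to
  \<open>T\<close>. It kills multiples of \<open>x_l - x_0\<close>, so it reads off what survives
  reduction to leading order.\<close>

definition diag_sum :: "nat \<Rightarrow> ((nat \<Rightarrow> nat) \<Rightarrow> 'a::comm_ring_1) \<Rightarrow> nat \<Rightarrow> 'a" where
  "diag_sum n F D = (\<Sum>u\<in>{u \<in> uexps n. udeg n u = D}. F u)"

text \<open>The exponent of \<open>t ^ s x\<^sub>1 \<cdots> x\<^sub>m\<close>, where \<open>t = x\<^sub>0 \<cdots> x\<^sub>n\<close> and \<open>D = (n + 1) s + m\<close> with \<open>m \<le> n\<close>.\<close>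

definition stair :: "nat \<Rightarrow> nat \<Rightarrow> nat \<Rightarrow> nat" where
  "stair n D = (\<lambda>k. if k > n then 0
     else D div (n + 1) + (if 1 \<le> k \<and> k \<le> D mod (n + 1) then 1 else 0))"

text \<open>A section of \<open>diag_sum\<close> with one monomial per degree, chosen so that the
  monomials are those of \<open>t^s e_m\<close> up to the factor \<gamma>^m.\<close>

definition lift_stair :: "nat \<Rightarrow> (nat \<Rightarrow> 'a::comm_ring_1) \<Rightarrow> (nat \<Rightarrow> nat) \<Rightarrow> 'a" where
  "lift_stair n a = (\<lambda>u. if u = stair n (udeg n u) then a (udeg n u) else 0)"

definition free_of :: "nat \<Rightarrow> ((nat \<Rightarrow> nat) \<Rightarrow> 'a::comm_ring_1) \<Rightarrow> bool" where
  "free_of k F \<longleftrightarrow> (\<forall>u. u k \<noteq> 0 \<longrightarrow> F u = 0)"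

lemma uexps_upd: "k \<le> n \<Longrightarrow> u(k := a) \<in> uexps n \<longleftrightarrow> u \<in> uexps n"
  by (auto simp: uexps_def)

lemma udeg_upd: "k \<le> n \<Longrightarrow> udeg n (u(k := a)) + u k = udeg n u + a"
proof -
  assume k: "k \<le> n"
  have "udeg n v = v k + (\<Sum>j\<in>{..n} - {k}. v j)" for v
    unfolding udeg_def using k by (intro sum.remove) auto
  moreover have "(\<Sum>j\<in>{..n} - {k}. (u(k := a)) j) = (\<Sum>j\<in>{..n} - {k}. u j)"
    by (rule sum.cong) auto
  ultimately show ?thesis by simp
qed

lemma udeg_upd_diff: "k \<le> n \<Longrightarrow> d \<le> u k \<Longrightarrow> udeg n (u(k := u k - d)) + d = udeg n u"
  using udeg_upd[of k n u "u k - d"] by simp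

lemma le_udeg: "k \<le> n \<Longrightarrow> u k \<le> udeg n u"
  unfolding udeg_def by (rule member_le_sum) auto

lemma finite_udeg: "finite {u \<in> uexps n. udeg n u = D}"
proof (rule finite_subset)
  show "{u \<in> uexps n. udeg n u = D} \<subseteq> {f. \<forall>k. (k \<in> {..n} \<longrightarrow> f k \<in> {..D}) \<and> (k \<notin> {..n} \<longrightarrow> f k = 0)}"
    using le_udeg by (auto simp: uexps_def)
  show "finite {f. \<forall>k. (k \<in> {..n} \<longrightarrow> f k \<in> {..D}) \<and> (k \<notin> {..n} \<longrightarrow> f k = (0::nat))}"
    by (rule finite_set_of_finite_funs) auto
qed

section \<open>Linearity and commutation of the operators\<close>

lemma gmul_add: "gmul h k (\<lambda>u. F u + G u) = (\<lambda>u. gmul h k F u + gmul h k G u)"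
  by (simp add: gmul_def fun_eq_iff distrib_left sum.distrib)

lemma gmul_cmult: "gmul h k (\<lambda>u. a * F u) = (\<lambda>u. a * gmul h k F u)"
  by (simp add: gmul_def fun_eq_iff sum_distrib_left mult.left_commute)

lemma nabla_add: "nabla h k (\<lambda>u. F u + G u) = (\<lambda>u. nabla h k F u + nabla h k G u)"
  by (simp add: nabla_def gmul_add fun_eq_iff algebra_simps)

lemma nabla_cmult: "nabla h k (\<lambda>u. a * F u) = (\<lambda>u. a * nabla h k F u)"
  by (simp add: nabla_def gmul_cmult fun_eq_iff algebra_simps)

lemma Dop_add: "Dop h l (\<lambda>u. F u + G u) = (\<lambda>u. Dop h l F u + Dop h l G u)"
  by (simp add: Dop_def nabla_add fun_eq_iff)

lemma Dop_cmult: "Dop h l (\<lambda>u. a * F u) = (\<lambda>u. a * Dop h l F u)"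
  by (simp add: Dop_def nabla_cmult fun_eq_iff algebra_simps)

lemma nabla_diff: "nabla h k (\<lambda>u. F u - G u) = (\<lambda>u. nabla h k F u - nabla h k G u)"
  using nabla_add[of h k F "\<lambda>u. - 1 * G u"] unfolding nabla_cmult by simp

lemma Dop_diff: "Dop h l (\<lambda>u. F u - G u) = (\<lambda>u. Dop h l F u - Dop h l G u)"
  by (simp add: Dop_def nabla_diff fun_eq_iff)

lemma Dop_0: "Dop h l (\<lambda>u. 0) = (\<lambda>u. 0)"
  using Dop_cmult[of h l 0 "\<lambda>_. 0"] by simp

lemma Dop_sum: "Dop h l (\<lambda>u. \<Sum>i\<in>I. F i u) = (\<lambda>u. \<Sum>i\<in>I. Dop h l (F i) u)"
  by (induct I rule: infinite_finite_induct) (simp_all add: Dop_0 Dop_add)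

lemma gmul_commute:
  assumes "k \<noteq> l"
  shows "gmul h k (gmul h l F) = gmul h l (gmul h k F)"
proof
  fix u
  have "gmul h k (gmul h l F) u =
      (\<Sum>d=1..u k. \<Sum>e=1..u l. h d * (h e * F (u(k := u k - d, l := u l - e))))"
    using assms by (simp add: gmul_def sum_distrib_left)
  also have "\<dots> = (\<Sum>e=1..u l. \<Sum>d=1..u k. h e * (h d * F (u(l := u l - e, k := u k - d))))"
    using assms by (subst sum.swap) (simp add: fun_upd_twist mult.left_commute)
  also have "\<dots> = gmul h l (gmul h k F) u"
    using assms by (simp add: gmul_def sum_distrib_left)
  finally show "gmul h k (gmul h l F) u = gmul h l (gmul h k F) u" .
qed

lemma nabla_commute: "nabla h k (nabla h l F) = nabla h l (nabla h k F)"
proof (cases "k = l")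
  case False
  have *: "gmul h k (\<lambda>u. of_nat (u l) * F u) = (\<lambda>u. of_nat (u l) * gmul h k F u)"
    if "k \<noteq> l" for k l F
    using that by (simp add: gmul_def fun_eq_iff sum_distrib_left mult.left_commute)
  show ?thesis
    using False gmul_commute[OF False, of h F]
    by (simp only: nabla_def[abs_def] gmul_add *[OF False] *[OF False[symmetric]]) (simp add: algebra_simps)
qed simp

lemma Dop_commute: "Dop h k (Dop h l F) = Dop h l (Dop h k F)"
proof -
  have "Dop h k (Dop h l F) = (\<lambda>u. (nabla h k (nabla h l F) u - nabla h k (nabla h 0 F) u)
      - (nabla h 0 (nabla h l F) u - nabla h 0 (nabla h 0 F) u))" for k l
    by (simp add: Dop_def nabla_diff)
  from this[of k l] this[of l k] show ?thesis
    by (simp only: nabla_commute[of h k l] nabla_commute[of h 0 k] nabla_commute[of h 0 l])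
      (simp add: algebra_simps)
qed

lemma free_of_gmul: "free_of k F \<Longrightarrow> k \<noteq> l \<Longrightarrow> free_of k (gmul h l F)"
  by (simp add: free_of_def gmul_def)

lemma free_of_Dop: "free_of k F \<Longrightarrow> k \<noteq> l \<Longrightarrow> k \<noteq> 0 \<Longrightarrow> free_of k (Dop h l F)"
  using free_of_gmul[of k F] by (simp add: Dop_def nabla_def free_of_def)

lemma free_of_xmul: "free_of k F \<Longrightarrow> k \<noteq> l \<Longrightarrow> free_of k (xmul l F)"
  by (simp add: free_of_def xmul_def)

lemma free_of_xsub: "free_of k F \<Longrightarrow> k \<noteq> 0 \<Longrightarrow> free_of k (xsub l F)"
  by (cases "k = l") (simp_all add: free_of_def xsub_def)

lemma free_of_xsub_self: "free_of l (xsub l F)"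
  by (simp add: free_of_def xsub_def)

lemma free_of_xdiff: "free_of k F \<Longrightarrow> k \<noteq> l \<Longrightarrow> k \<noteq> 0 \<Longrightarrow> free_of k (xdiff l F)"
  by (simp add: free_of_def xdiff_def)

lemma free_of_diff: "free_of k F \<Longrightarrow> free_of k G \<Longrightarrow> free_of k (\<lambda>u. F u - G u)"
  by (simp add: free_of_def)

lemma free_of_cmult: "free_of k F \<Longrightarrow> free_of k (\<lambda>u. a * F u)"
  by (simp add: free_of_def)

lemma free_of_sum: "(\<And>i. i \<in> I \<Longrightarrow> free_of k (F i)) \<Longrightarrow> free_of k (\<lambda>u. \<Sum>i\<in>I. F i u)"
  by (simp add: free_of_def)

section \<open>Division by \<open>x_l - x_0\<close>\<close>

lemma xsub_add: "xsub l (\<lambda>u. F u + G u) = (\<lambda>u. xsub l F u + xsub l G u)"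
  by (simp add: xsub_def fun_eq_iff sum.distrib)

lemma xsub_cmult: "xsub l (\<lambda>u. a * F u) = (\<lambda>u. a * xsub l F u)"
  by (simp add: xsub_def fun_eq_iff sum_distrib_left)

lemma xdiff_add: "xdiff l (\<lambda>u. F u + G u) = (\<lambda>u. xdiff l F u + xdiff l G u)"
  by (simp add: xdiff_def fun_eq_iff sum.distrib)

lemma xdiff_cmult: "xdiff l (\<lambda>u. a * F u) = (\<lambda>u. a * xdiff l F u)"
  by (simp add: xdiff_def fun_eq_iff sum_distrib_left)

lemma xsub_xdiff:
  assumes "l \<noteq> 0"
  shows "F u = xsub l F u + xmul l (xdiff l F) u - xmul 0 (xdiff l F) u"
proof -
  have eq: "u(0 := u 0, l := u l) = u" by simp
  show ?thesis
  proof (cases "u l = 0")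
    case True
    have "xmul 0 (xdiff l F) u = (\<Sum>i<u 0. F (u(0 := i, l := u 0 - i)))"
      using assms True by (cases "u 0") (simp_all add: xmul_def xdiff_def lessThan_Suc_atMost)
    moreover have "xsub l F u = (\<Sum>i\<le>u 0. F (u(0 := i, l := u 0 - i)))"
      unfolding xsub_def using True by (simp add: sum.nat_diff_reindex atMost_atLeast0
        sum.atLeastAtMost_rev[of "\<lambda>i. F (u(0 := i, l := u 0 - i))" 0 "u 0"])
    moreover have "\<dots> = (\<Sum>i<u 0. F (u(0 := i, l := u 0 - i))) + F u"
      using eq True by (simp add: lessThan_Suc_atMost[symmetric])
    ultimately show ?thesis using True by (simp add: xmul_def)
  next
    case False
    have "xmul 0 (xdiff l F) u = (\<Sum>i<u 0. F (u(0 := i, l := u l + u 0 - i)))"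
      using assms by (cases "u 0") (simp_all add: xmul_def xdiff_def lessThan_Suc_atMost)
    moreover have "xmul l (xdiff l F) u = (\<Sum>i\<le>u 0. F (u(0 := i, l := u l + u 0 - i)))"
      unfolding xmul_def xdiff_def using False assms
      by (auto intro!: sum.cong simp: fun_upd_twist)
    moreover have "\<dots> = (\<Sum>i<u 0. F (u(0 := i, l := u l + u 0 - i))) + F u"
      using eq by (simp add: lessThan_Suc_atMost[symmetric])
    ultimately show ?thesis using False by (simp add: xsub_def)
  qed
qed

text \<open>Together with \<open>xsub_xmul\<close>, \<open>xdiff_free\<close> and
  \<open>xsub_free\<close> this makes quotient and remainder unique, so that a summand can be
  recovered from a sum.\<close>

lemma xdiff_xmul:
  assumes "l \<noteq> 0"
  shows "xdiff l (\<lambda>u. xmul l G u - xmul 0 G u) = G"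
proof
  fix u
  have "(\<Sum>i\<le>u 0. xmul l G (u(0 := i, l := u l + 1 + u 0 - i))) =
      (\<Sum>i\<le>u 0. G (u(0 := i, l := u l + u 0 - i)))"
    using assms by (intro sum.cong) (auto simp: xmul_def)
  also have "\<dots> = (\<Sum>i<u 0. G (u(0 := i, l := u l + u 0 - i))) + G u"
    by (simp add: lessThan_Suc_atMost[symmetric])
  moreover have "(\<Sum>i\<le>u 0. xmul 0 G (u(0 := i, l := u l + 1 + u 0 - i))) =
      (\<Sum>i<u 0. G (u(0 := i, l := u l + u 0 - i)))"
  proof (cases "u 0")
    case (Suc m)
    have "(\<Sum>i\<le>Suc m. xmul 0 G (u(0 := i, l := u l + 1 + Suc m - i))) =
        (\<Sum>i\<le>m. xmul 0 G (u(0 := Suc i, l := u l + 1 + Suc m - Suc i)))"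
      using assms by (subst sum.atMost_Suc_shift) (simp add: xmul_def)
    also have "\<dots> = (\<Sum>i\<le>m. G (u(0 := i, l := u l + Suc m - i)))"
      using assms by (intro sum.cong) (auto simp: xmul_def fun_upd_twist)
    finally show ?thesis using Suc by (simp add: lessThan_Suc_atMost)
  qed (use assms in \<open>simp add: xmul_def\<close>)
  ultimately show "xdiff l (\<lambda>u. xmul l G u - xmul 0 G u) u = G u"
    by (simp add: xdiff_def sum_subtractf)
qed

lemma xsub_xmul:
  assumes "l \<noteq> 0"
  shows "xsub l (\<lambda>u. xmul l G u - xmul 0 G u) = (\<lambda>u. 0)"
proof
  fix u
  have "xsub l (\<lambda>u. xmul l G u - xmul 0 G u) u = (\<lambda>u. xmul l G u - xmul 0 G u) u
      - (xmul l (xdiff l (\<lambda>u. xmul l G u - xmul 0 G u)) u - xmul 0 (xdiff l (\<lambda>u. xmul l G u - xmul 0 G u)) u)"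
    using xsub_xdiff[OF assms, of "\<lambda>u. xmul l G u - xmul 0 G u" u] by simp
  then show "xsub l (\<lambda>u. xmul l G u - xmul 0 G u) u = 0"
    by (simp add: xdiff_xmul[OF assms])
qed

lemma xdiff_free: "free_of l F \<Longrightarrow> xdiff l F = (\<lambda>u. 0)"
  by (auto simp: free_of_def xdiff_def fun_eq_iff intro!: sum.neutral)

lemma xsub_free:
  assumes "free_of l F" "l \<noteq> 0"
  shows "xsub l F = F"
  using xsub_xdiff[OF assms(2), of F] xdiff_free[OF assms(1)] by (auto simp: fun_eq_iff xmul_def)

section \<open>Diagonal sums and staircase monomials\<close>

lemma diag_sum_add: "diag_sum n (\<lambda>u. F u + G u) D = diag_sum n F D + diag_sum n G D"
  by (simp add: diag_sum_def sum.distrib)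

lemma diag_sum_diff: "diag_sum n (\<lambda>u. F u - G u) D = diag_sum n F D - diag_sum n G D"
  by (simp add: diag_sum_def sum_subtractf)

lemma diag_sum_cmult: "diag_sum n (\<lambda>u. a * F u) D = a * diag_sum n F D"
  by (simp add: diag_sum_def sum_distrib_left)

lemma diag_sum_sum: "diag_sum n (\<lambda>u. \<Sum>i\<in>I. F i u) D = (\<Sum>i\<in>I. diag_sum n (F i) D)"
  unfolding diag_sum_def by (rule sum.swap)

lemma diag_sum_xmul:
  assumes "k \<le> n"
  shows "diag_sum n (xmul k F) D = (if D = 0 then 0 else diag_sum n F (D - 1))"
proof -
  let ?A = "\<lambda>D. {u \<in> uexps n. udeg n u = D}"
  have "diag_sum n (xmul k F) D = (\<Sum>u\<in>{u\<in>?A D. u k \<noteq> 0}. F (u(k := u k - 1)))"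
    unfolding diag_sum_def xmul_def by (subst sum.inter_filter[OF finite_udeg]) (auto intro: sum.cong)
  also have "\<dots> = (if D = 0 then 0 else diag_sum n F (D - 1))"
  proof (cases "D = 0")
    case True
    have "{u\<in>?A D. u k \<noteq> 0} = {}" using True by (auto intro: less_le_trans[OF _ le_udeg[OF assms]])
    then show ?thesis using True by (simp only: sum.empty) simp
  next
    case False
    have "(\<Sum>u\<in>{u\<in>?A D. u k \<noteq> 0}. F (u(k := u k - 1))) = (\<Sum>u\<in>?A (D - 1). F u)"
    proof (rule sum.reindex_bij_witness[of _ "\<lambda>u. u(k := u k + 1)" "\<lambda>u. u(k := u k - 1)"])
      fix u assume "u \<in> {u\<in>?A D. u k \<noteq> 0}"
      then show "u(k := u k - 1) \<in> ?A (D - 1)"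
        using udeg_upd_diff[OF assms, of 1 u] assms by (auto simp: uexps_upd)
    next
      fix u assume "u \<in> ?A (D - 1)"
      then show "u(k := u k + 1) \<in> {u\<in>?A D. u k \<noteq> 0}"
        using udeg_upd[OF assms, of u "u k + 1"] assms False by (auto simp: uexps_upd)
    qed auto
    then show ?thesis using False by (simp add: diag_sum_def)
  qed
  finally show ?thesis .
qed

text \<open>The two series differ by a multiple of \<open>x_l - x_0\<close>, and multiplication by
  any variable shifts the diagonal sums in the same way.\<close>

lemma diag_sum_xsub:
  assumes "l \<le> n" "l \<noteq> 0"
  shows "diag_sum n (xsub l F) D = diag_sum n F D"
proof -
  have F: "F = (\<lambda>u. xsub l F u + xmul l (xdiff l F) u - xmul 0 (xdiff l F) u)"
    using xsub_xdiff[OF assms(2), of F] by (simp add: fun_eq_iff)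
  have "diag_sum n F D = diag_sum n (xsub l F) D + diag_sum n (xmul l (xdiff l F)) D - diag_sum n (xmul 0 (xdiff l F)) D"
    by (subst F) (simp only: diag_sum_add diag_sum_diff)
  then show ?thesis using assms by (simp add: diag_sum_xmul)
qed

lemma stair_in_uexps: "stair n D \<in> uexps n"
  by (simp add: stair_def uexps_def)

lemma udeg_stair: "udeg n (stair n D) = D"
proof -
  have m: "D mod (n + 1) \<le> n" by (simp add: less_Suc_eq_le[symmetric])
  have "udeg n (stair n D) = (\<Sum>k\<le>n. D div (n + 1) + (if k \<in> {1..D mod (n + 1)} then 1 else 0))"
    unfolding udeg_def by (intro sum.cong) (auto simp: stair_def)
  also have "\<dots> = (n + 1) * (D div (n + 1)) + card ({..n} \<inter> {1..D mod (n + 1)})"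
    unfolding sum.distrib by (simp only: sum.inter_restrict[OF finite_atMost, symmetric]) simp
  also have "{..n} \<inter> {1..D mod (n + 1)} = {1..D mod (n + 1)}" using m by auto
  finally show ?thesis by (simp del: mult_Suc)
qed

lemma diag_sum_lift_stair: "diag_sum n (lift_stair n a) D = a D"
proof -
  have "diag_sum n (lift_stair n a) D = (\<Sum>u\<in>{u \<in> uexps n. udeg n u = D}. if u = stair n D then a D else 0)"
    unfolding diag_sum_def lift_stair_def by (intro sum.cong) auto
  also have "\<dots> = a D" by (simp add: finite_udeg stair_in_uexps udeg_stair)
  finally show ?thesis .
qed

text \<open>A series in \<open>x_0\<close> alone has one monomial in each degree, so its diagonal
  sums are its coefficients.\<close>

lemma diag_sum_eq_0_imp_eq_0:
  assumes "\<And>D. diag_sum n F D = 0" "\<And>l. l \<in> {1..n} \<Longrightarrow> free_of l F" "\<And>u. u \<notin> uexps n \<Longrightarrow> F u = 0"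
  shows "F = (\<lambda>u. 0)"
proof
  fix u
  show "F u = 0"
  proof (cases "\<exists>k. k \<noteq> 0 \<and> u k \<noteq> 0")
    case True
    then obtain k where "k \<noteq> 0" "u k \<noteq> 0" by blast
    then show ?thesis using assms(2)[of k] assms(3)[of u] unfolding free_of_def uexps_def
      by (metis (mono_tags, lifting) atLeastAtMost_iff less_one linorder_not_less mem_Collect_eq)
  next
    case False
    have "F u = diag_sum n F (udeg n u)"
    proof -
      have "diag_sum n F (udeg n u) = (\<Sum>v\<in>{v \<in> uexps n. udeg n v = udeg n u}. if v = u then F u else 0)"
        unfolding diag_sum_def
      proof (rule sum.cong[OF refl])
        fix v assume v: "v \<in> {v \<in> uexps n. udeg n v = udeg n u}"
        show "F v = (if v = u then F u else 0)"
        proof (cases "\<exists>k\<in>{1..n}. v k \<noteq> 0")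
          case True
          then show ?thesis using assms(2) False by (auto simp: free_of_def)
        next
          case nex: False
          have s: "udeg n w = w 0" if "\<forall>k\<in>{1..n}. w k = 0" for w :: "nat \<Rightarrow> nat"
          proof -
            have "udeg n w = w 0 + (\<Sum>k=1..n. w k)"
              unfolding udeg_def by (simp add: atMost_atLeast0 sum.atLeast_Suc_atMost)
            then show ?thesis using that by simp
          qed
          have "\<forall>k\<in>{1..n}. u k = 0" "\<forall>k\<in>{1..n}. v k = 0"
            using False nex by (metis atLeastAtMost_iff not_one_le_zero)+
          then have "v 0 = u 0" using s[of v] s[of u] v by simp
          moreover have "v k = u k" if "k \<noteq> 0" for k
          proof -
            have "u k = 0" using False that by blast
            then show ?thesis using nex v that by (cases "k \<le> n") (auto simp: uexps_def)
          qed
          ultimately have "v = u" by (metis ext)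
          then show ?thesis by simp
        qed
      qed
      moreover have "u \<in> uexps n"
      proof -
        have "u k = 0" if "k > n" for k
        proof -
          have "k \<noteq> 0" using that by simp
          then show ?thesis using False by blast
        qed
        then show ?thesis by (simp add: uexps_def)
      qed
      then have "(\<Sum>v\<in>{v \<in> uexps n. udeg n v = udeg n u}. if v = u then F u else 0) = F u"
        by (simp add: finite_udeg)
      ultimately show ?thesis by simp
    qed
    then show ?thesis using assms(1) by simp
  qed
qed

section \<open>Reduction modulo the operators \<open>D\<^sub>l\<close>\<close>

text \<open>The reduction only needs these facts about \<open>h\<close>. The lower bound equals
  \<open>(e + 1) d - 1\<close>; at \<open>d = 1\<close> it is \<open>e\<close>, which
  \<open>h 1 = \<gamma>\<close> attains.\<close>

locale dwork_operators = complete_coefficients p ord \<Omega>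
  for p :: nat and ord :: "'k::field_char_0 \<Rightarrow> ereal" and \<Omega> :: "'k set" +
  fixes n :: nat and \<gamma> :: 'k and h :: "nat \<Rightarrow> 'k" and e :: real
  assumes ord_\<gamma>: "ord \<gamma> = ereal e" and \<gamma>_in: "\<gamma> \<in> \<Omega>" and e_pos: "e > 0"
    and h_1: "h 1 = \<gamma>" and h_in: "h d \<in> \<Omega>"
    and ordge_h: "d \<ge> 1 \<Longrightarrow> ordge ((e + 1) * (real d - 1) + e) (h d)"
begin

lemma \<gamma>_nz: "\<gamma> \<noteq> 0"
  using ord_\<gamma> by auto

lemma ordge_\<gamma>: "ordge e \<gamma>"
  by (simp add: ordge_def ord_\<gamma>)

lemma ordge_inverse_\<gamma>: "ordge (- e) (inverse \<gamma>)"
  using ord_inverse[OF \<gamma>_nz ord_\<gamma>] by (simp add: ordge_def)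

definition level :: "(nat \<Rightarrow> real) \<Rightarrow> ((nat \<Rightarrow> nat) \<Rightarrow> 'k) set" where
  "level \<phi> = {F. \<forall>u. F u \<in> \<Omega> \<and> ordge (\<phi> (udeg n u)) (F u)}"

definition supp_in :: "'i set \<Rightarrow> ('i \<Rightarrow> 'k) \<Rightarrow> bool" where
  "supp_in U F \<longleftrightarrow> (\<forall>u. u \<notin> U \<longrightarrow> F u = 0)"

text \<open>A preimage under \<open>\<gamma> (x_l - x_0)\<close> of a series with bound \<phi> has
  the bound \<open>\<phi> (Suc D) - e\<close>. The lower slope makes the derivation term of
  \<open>nabla\<close> gain \<epsilon> over \<phi>, the upper slope makes the terms
  \<open>h d\<close> with \<open>d \<ge> 2\<close> gain \<epsilon>.\<close>

definition slope :: "real \<Rightarrow> (nat \<Rightarrow> real) \<Rightarrow> bool" where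
  "slope \<epsilon> \<phi> \<longleftrightarrow> (\<forall>D. \<phi> D + e + \<epsilon> \<le> \<phi> (Suc D) \<and> \<phi> (Suc D) + \<epsilon> \<le> \<phi> D + (e + 1))"

lemma levelD: "F \<in> level \<phi> \<Longrightarrow> F u \<in> \<Omega>" "F \<in> level \<phi> \<Longrightarrow> r \<le> \<phi> (udeg n u) \<Longrightarrow> ordge r (F u)"
  by (auto simp: level_def intro: ordge_mono)

lemma levelI: "(\<And>u. F u \<in> \<Omega>) \<Longrightarrow> (\<And>u. ordge (\<phi> (udeg n u)) (F u)) \<Longrightarrow> F \<in> level \<phi>"
  by (simp add: level_def)

lemma level_mono: "F \<in> level \<phi> \<Longrightarrow> (\<And>D. \<psi> D \<le> \<phi> D) \<Longrightarrow> F \<in> level \<psi>"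
  by (auto simp: level_def intro: ordge_mono)

lemma level_add: "F \<in> level \<phi> \<Longrightarrow> G \<in> level \<phi> \<Longrightarrow> (\<lambda>u. F u + G u) \<in> level \<phi>"
  by (auto simp: level_def intro: ordge_add)

lemma level_diff: "F \<in> level \<phi> \<Longrightarrow> G \<in> level \<phi> \<Longrightarrow> (\<lambda>u. F u - G u) \<in> level \<phi>"
  by (auto simp: level_def intro: ordge_diff)

lemma level_uminus: "F \<in> level \<phi> \<Longrightarrow> (\<lambda>u. - F u) \<in> level \<phi>"
  by (auto simp: level_def)

lemma level_sum: "(\<And>i. i \<in> I \<Longrightarrow> F i \<in> level \<phi>) \<Longrightarrow> (\<lambda>u. \<Sum>i\<in>I. F i u) \<in> level \<phi>"
  by (auto simp: level_def intro: ordge_sum)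

lemma level_cmult:
  assumes "F \<in> level \<phi>" "a \<in> \<Omega>" "ordge r a" "\<And>D. \<psi> D \<le> r + \<phi> D"
  shows "(\<lambda>u. a * F u) \<in> level \<psi>"
  using assms by (auto simp: level_def intro!: ordge_mult_le[of r _ "\<phi> _"])

lemma slope_const: "slope \<epsilon> \<phi> \<Longrightarrow> slope \<epsilon> (\<lambda>D. \<phi> D + \<sigma>)"
  by (auto simp: slope_def algebra_simps)

lemma slope_weaken: "slope \<epsilon> \<psi> \<Longrightarrow> \<epsilon> \<ge> 0 \<Longrightarrow> slope 0 \<psi>"
  unfolding slope_def by (metis add.right_neutral add_increasing2 add_le_cancel_left order_trans)

lemma slope_add:
  assumes "slope \<epsilon> \<phi>" "\<epsilon> \<ge> 0" "d \<ge> 1"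
  shows "\<phi> (D + d) + \<epsilon> \<le> \<phi> D + (e + 1) * real d"
  using assms(3)
proof (induct d rule: dec_induct)
  case base
  then show ?case using assms(1) by (simp add: slope_def)
next
  case (step d)
  have "\<phi> (Suc (D + d)) + \<epsilon> \<le> \<phi> (D + d) + (e + 1)" using assms(1) by (simp add: slope_def)
  then show ?case using step assms(2) by (simp add: algebra_simps)
qed

lemma level_xmul:
  assumes "k \<le> n" "G \<in> level (\<lambda>D. \<phi> (Suc D))"
  shows "xmul k G \<in> level \<phi>"
proof (rule levelI)
  fix u
  show "xmul k G u \<in> \<Omega>" using levelD(1)[OF assms(2)] by (simp add: xmul_def)
  show "ordge (\<phi> (udeg n u)) (xmul k G u)"
  proof (cases "u k = 0")
    case False
    have "Suc (udeg n (u(k := u k - 1))) = udeg n u"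
      using udeg_upd_diff[OF assms(1), of 1 u] False by simp
    then have "ordge (\<phi> (udeg n u)) (G (u(k := u k - 1)))" using levelD(2)[OF assms(2)] by simp
    then show ?thesis using False by (simp add: xmul_def)
  qed (simp add: xmul_def)
qed

lemma udeg_move: "l \<le> n \<Longrightarrow> l \<noteq> 0 \<Longrightarrow> udeg n (u(0 := i, l := j)) + u 0 + u l = udeg n u + i + j"
  using udeg_upd[of 0 n u i] udeg_upd[of l n "u(0 := i)" j] by simp

lemma level_xsub:
  assumes "l \<le> n" "l \<noteq> 0" "F \<in> level \<phi>"
  shows "xsub l F \<in> level \<phi>"
proof (rule levelI)
  fix u
  show "xsub l F u \<in> \<Omega>" using levelD(1)[OF assms(3)] by (auto simp: xsub_def)
  have "ordge (\<phi> (udeg n u)) (F (u(0 := u 0 - i, l := i)))" if "i \<le> u 0" "u l = 0" for i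
    using udeg_move[OF assms(1,2), of u "u 0 - i" i] that by (intro levelD(2)[OF assms(3)]) simp
  then show "ordge (\<phi> (udeg n u)) (xsub l F u)" by (auto simp: xsub_def intro: ordge_sum)
qed

lemma level_xdiff:
  assumes "l \<le> n" "l \<noteq> 0" "F \<in> level \<phi>"
  shows "xdiff l F \<in> level (\<lambda>D. \<phi> (Suc D))"
proof (rule levelI)
  fix u
  show "xdiff l F u \<in> \<Omega>" using levelD(1)[OF assms(3)] by (auto simp: xdiff_def)
  have "ordge (\<phi> (Suc (udeg n u))) (F (u(0 := i, l := u l + 1 + u 0 - i)))" if "i \<le> u 0" for i
    using udeg_move[OF assms(1,2), of u i "u l + 1 + u 0 - i"] that by (intro levelD(2)[OF assms(3)]) simp
  then show "ordge (\<phi> (Suc (udeg n u))) (xdiff l F u)" by (auto simp: xdiff_def intro: ordge_sum)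
qed

lemma diag_sum_level:
  assumes "F \<in> level \<phi>"
  shows "diag_sum n F D \<in> \<Omega>" "ordge (\<phi> D) (diag_sum n F D)"
  using assms by (auto simp: diag_sum_def level_def intro!: ordge_sum)

lemma level_lift_stair:
  assumes "\<And>D. a D \<in> \<Omega>" "\<And>D. ordge (\<phi> D) (a D)"
  shows "lift_stair n a \<in> level \<phi>"
  using assms by (auto simp: lift_stair_def level_def)

lemma nabla_remainder:
  assumes G: "G \<in> level (\<lambda>D. \<phi> (Suc D) - e)" and sl: "slope \<epsilon> \<phi>" "\<epsilon> \<ge> 0" and k: "k \<le> n"
  shows "(\<lambda>u. nabla h k G u - \<gamma> * xmul k G u) \<in> level (\<lambda>D. \<phi> D + \<epsilon>)"
proof (rule levelI)
  fix u
  note GO = levelD(1)[OF G]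
  have gm: "gmul h k G u = \<gamma> * xmul k G u + (\<Sum>d=2..u k. h d * G (u(k := u k - d)))"
  proof (cases "u k")
    case (Suc m)
    have "gmul h k G u = h 1 * G (u(k := u k - 1)) + (\<Sum>d=Suc 1..u k. h d * G (u(k := u k - d)))"
      unfolding gmul_def by (rule sum.atLeast_Suc_atMost) (simp add: Suc)
    then show ?thesis using Suc h_1 by (simp add: xmul_def numeral_2_eq_2)
  qed (simp add: gmul_def xmul_def)
  have eq: "nabla h k G u - \<gamma> * xmul k G u = of_nat (u k) * G u + (\<Sum>d=2..u k. h d * G (u(k := u k - d)))"
    by (simp add: nabla_def gm)
  show "nabla h k G u - \<gamma> * xmul k G u \<in> \<Omega>"
    unfolding eq using GO h_in by auto
  have "\<phi> (udeg n u) + \<epsilon> \<le> \<phi> (Suc (udeg n u)) - e" using sl(1) by (simp add: slope_def algebra_simps)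
  then have 1: "ordge (\<phi> (udeg n u) + \<epsilon>) (of_nat (u k) * G u)"
    by (intro ordge_mult_le[OF ordge_of_nat levelD(2)[OF G order_refl]]) simp
  have 2: "ordge (\<phi> (udeg n u) + \<epsilon>) (h d * G (u(k := u k - d)))" if d: "d \<in> {2..u k}" for d
  proof -
    let ?D = "udeg n (u(k := u k - d))"
    have D: "?D + d = udeg n u" using udeg_upd_diff[OF k, of d u] d by simp
    have "\<phi> (Suc ?D + (d - 1)) + \<epsilon> \<le> \<phi> (Suc ?D) + (e + 1) * real (d - 1)"
      using d by (intro slope_add[OF sl]) auto
    then have "\<phi> (udeg n u) + \<epsilon> \<le> \<phi> (Suc ?D) + (e + 1) * (real d - 1)"
      using d D by (simp add: of_nat_diff)
    then show ?thesis
      using d by (intro ordge_mult_le[OF ordge_h levelD(2)[OF G order_refl]]) auto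
  qed
  show "ordge (\<phi> (udeg n u) + \<epsilon>) (nabla h k G u - \<gamma> * xmul k G u)"
    unfolding eq by (intro ordge_add ordge_sum 1 2)
qed

lemma Dop_remainder:
  assumes "G \<in> level (\<lambda>D. \<phi> (Suc D) - e)" "slope \<epsilon> \<phi>" "\<epsilon> \<ge> 0" "l \<le> n"
  shows "(\<lambda>u. Dop h l G u - \<gamma> * (xmul l G u - xmul 0 G u)) \<in> level (\<lambda>D. \<phi> D + \<epsilon>)"
  using level_diff[OF nabla_remainder[OF assms] nabla_remainder[OF assms(1-3), of 0]]
  by (simp add: Dop_def algebra_simps)

lemma level_Dop:
  assumes G: "G \<in> level (\<lambda>D. \<phi> (Suc D) - e)" and sl: "slope 0 \<phi>" and l: "l \<le> n"
  shows "Dop h l G \<in> level \<phi>"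
proof -
  have "(\<lambda>u. \<gamma> * (xmul l G u - xmul 0 G u)) \<in> level \<phi>"
    by (rule level_cmult[OF level_diff \<gamma>_in ordge_\<gamma>, of _ "\<lambda>D. \<phi> D - e"]) (use l G level_xmul in auto)
  moreover have "(\<lambda>u. Dop h l G u - \<gamma> * (xmul l G u - xmul 0 G u)) \<in> level \<phi>"
    using Dop_remainder[OF G sl _ l] by simp
  ultimately show ?thesis using level_add by fastforce
qed

text \<open>
  The maps \<open>v\<close> and \<open>g\<close> decompose a series exactly with respect to the operators \<open>\<gamma> (x\<^sub>l - x\<^sub>0)\<close>, which
  approximate \<open>D\<^sub>l\<close>. The bounds \<open>\<phi>\<close> may be any function whose slopes lie between those of the two parts
  \<open>x\<^sub>l \<partial> / \<partial>x\<^sub>l\<close> and \<open>h\<close> of \<open>D\<^sub>l\<close>.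
\<close>

lemma reduction_general:
  assumes \<phi>: "slope 0 \<phi>" and \<psi>: "slope \<epsilon> \<psi>" "\<epsilon> > 0" and \<phi>\<psi>: "\<And>D. \<psi> D + \<sigma> \<le> \<phi> D"
    and I: "finite I" "I \<subseteq> {1..n}"
    and v: "\<And>F \<chi>. F \<in> level \<chi> \<Longrightarrow> supp_in U F \<Longrightarrow> v F \<in> level \<chi> \<and> supp_in U0 (v F)"
    and g: "\<And>F \<chi> l. F \<in> level \<chi> \<Longrightarrow> supp_in U F \<Longrightarrow> l \<in> I \<Longrightarrow>
        g l F \<in> level (\<lambda>D. \<chi> (Suc D) - e) \<and> supp_in U (g l F)"
    and ident: "\<And>F. supp_in U F \<Longrightarrow>
        F = (\<lambda>u. v F u + (\<Sum>l\<in>I. \<gamma> * (xmul l (g l F) u - xmul 0 (g l F) u)))"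
    and U: "U0 \<subseteq> U" "\<And>l F. l \<in> I \<Longrightarrow> supp_in U F \<Longrightarrow> supp_in U (Dop h l F)"
    and F: "F \<in> level \<phi>" "supp_in U F"
  shows "\<exists>w G. w \<in> level \<phi> \<and> supp_in U0 w \<and>
    (\<forall>l\<in>I. G l \<in> level (\<lambda>D. \<phi> (Suc D) - e) \<and> supp_in U (G l)) \<and>
    F = (\<lambda>u. w u + (\<Sum>l\<in>I. Dop h l (G l) u))"
proof -
  \<comment> \<open>Remainder and preimages are packed into one function of pairs. The index
    \<open>0\<close> is free for the remainder because \<open>I\<close> lies in
    \<open>{1..n}\<close>.\<close>
  define T where "T y = (\<lambda>u. y (0, u) + (\<Sum>l\<in>I. Dop h l (\<lambda>u. y (l, u)) u))" for y :: "nat \<times> (nat \<Rightarrow> nat) \<Rightarrow> 'k"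
  define \<Phi> where "\<Phi> F = (\<lambda>(l, u). if l = 0 then v F u else if l \<in> I then g l F u else 0)" for F
  define \<alpha> where "\<alpha> u = (if u \<in> U then ereal (\<phi> (udeg n u)) else \<infinity>)" for u
  define \<alpha>' where "\<alpha>' u = \<psi> (udeg n u)" for u
  define \<beta> where "\<beta> = (\<lambda>(l, u). if l = 0 then (if u \<in> U0 then ereal (\<phi> (udeg n u)) else \<infinity>)
     else if l \<in> I \<and> u \<in> U then ereal (\<phi> (Suc (udeg n u)) - e) else \<infinity>)"
  define \<beta>' where "\<beta>' = (\<lambda>(l::nat, u). if l = 0 then \<psi> (udeg n u) else \<psi> (Suc (udeg n u)) - e)"
  have I0: "0 \<notin> I" using I by auto
  have \<alpha>: "F \<in> weighted \<alpha> \<longleftrightarrow> F \<in> level \<phi> \<and> supp_in U F" for F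
    unfolding weighted_def level_def supp_in_def \<alpha>_def ordge_def
    by (auto simp: ord_eq_infinity_iff split: if_splits) (metis ord_0 ereal_less_eq(1))
  have \<alpha>': "F \<in> rweighted \<alpha>' \<sigma> \<longleftrightarrow> F \<in> level (\<lambda>D. \<psi> D + \<sigma>)" for F \<sigma>
    by (auto simp: rweighted_iff level_def \<alpha>'_def)
  have T\<Phi>: "T (\<Phi> F) u = v F u + (\<Sum>l\<in>I. Dop h l (g l F) u)" for F u
  proof -
    have "(\<lambda>u. \<Phi> F (l, u)) = g l F" if "l \<in> I" for l
    proof -
      have "l \<noteq> 0" using I0 that by metis
      then show ?thesis using that by (simp add: \<Phi>_def)
    qed
    then have "(\<Sum>l\<in>I. Dop h l (\<lambda>u. \<Phi> F (l, u)) u) = (\<Sum>l\<in>I. Dop h l (g l F) u)"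
      by (intro sum.cong) auto
    then show ?thesis by (simp add: T_def \<Phi>_def)
  qed
  have R: "(\<lambda>u. F u - T (\<Phi> F) u) = (\<lambda>u. - (\<Sum>l\<in>I. Dop h l (g l F) u - \<gamma> * (xmul l (g l F) u - xmul 0 (g l F) u)))"
    if "supp_in U F" for F
  proof
    fix u
    show "F u - T (\<Phi> F) u = - (\<Sum>l\<in>I. Dop h l (g l F) u - \<gamma> * (xmul l (g l F) u - xmul 0 (g l F) u))"
      using fun_cong[OF ident[OF that], of u] by (simp add: T\<Phi> sum_subtractf)
  qed
  \<comment> \<open>By the exactness of \<open>ident\<close>, the residual consists only of the
    differences between \<open>D_l\<close> and its leading part. This is used twice: with gain zero
    for \<phi>, so that membership is kept, and with positive gain for \<psi>, so that the iteration
    converges.\<close>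
  have R_level: "(\<lambda>u. F u - T (\<Phi> F) u) \<in> level (\<lambda>D. \<chi> D + \<epsilon>)"
    if "F \<in> level \<chi>" "supp_in U F" "slope \<epsilon> \<chi>" "\<epsilon> \<ge> 0" for F \<chi> \<epsilon>
    unfolding R[OF that(2)] using g[OF that(1,2)] I that
    by (intro level_uminus level_sum Dop_remainder) auto
  have \<epsilon>: "slope 0 \<psi>" using slope_weaken \<psi> by simp
  have "\<exists>y. y \<in> weighted \<beta> \<and> y \<in> rweighted \<beta>' \<sigma> \<and> T y = F"
  proof (rule successive_approximation[where \<alpha> = \<alpha> and \<alpha>' = \<alpha>' and \<epsilon> = \<epsilon> and C = 0 and \<Phi> = \<Phi>])
    show "\<epsilon> > 0" by fact
    show "(\<lambda>u. F u - T (\<Phi> F) u) \<in> weighted \<alpha>" if "F \<in> weighted \<alpha>" for F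
    proof -
      have Fl: "F \<in> level \<phi>" "supp_in U F" using that \<alpha> by auto
      have "supp_in U (Dop h l (g l F))" if "l \<in> I" for l using U(2) g Fl that by blast
      moreover have "supp_in U (v F)" using v[OF Fl] U(1) by (auto simp: supp_in_def)
      ultimately have "supp_in U (\<lambda>u. F u - T (\<Phi> F) u)"
        using Fl(2) by (simp add: supp_in_def T\<Phi>)
      then show ?thesis using R_level[OF Fl \<phi>] \<alpha> by simp
    qed
    show "(\<lambda>u. F u - T (\<Phi> F) u) \<in> rweighted \<alpha>' (\<sigma> + \<epsilon>)"
      if "F \<in> weighted \<alpha>" "F \<in> rweighted \<alpha>' \<sigma>" for F \<sigma>
      using R_level[of F "\<lambda>D. \<psi> D + \<sigma>" \<epsilon>] that \<psi> slope_const[OF \<psi>(1)] unfolding \<alpha> \<alpha>' by (simp add: add.assoc)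
    show "\<Phi> F \<in> weighted \<beta>" if "F \<in> weighted \<alpha>" for F
    proof -
      have Fl: "F \<in> level \<phi>" "supp_in U F" using that \<alpha> by auto
      show ?thesis using v[OF Fl] g[OF Fl] I0
        by (auto simp: weighted_def \<beta>_def \<Phi>_def level_def supp_in_def ordge_def)
    qed
    show "\<Phi> F \<in> rweighted \<beta>' \<sigma>" if "F \<in> weighted \<alpha>" "F \<in> rweighted \<alpha>' \<sigma>" for F \<sigma>
    proof -
      have Fl: "F \<in> level (\<lambda>D. \<psi> D + \<sigma>)" "supp_in U F" using that \<alpha> \<alpha>' by auto
      have "v F \<in> level (\<lambda>D. \<psi> D + \<sigma>)" "\<And>l. l \<in> I \<Longrightarrow> g l F \<in> level (\<lambda>D. \<psi> (Suc D) + \<sigma> - e)"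
        using v[OF Fl] g[OF Fl] by auto
      then show ?thesis unfolding rweighted_iff
        by (auto simp: \<beta>'_def \<Phi>_def level_def diff_add_eq)
    qed
    show "T (\<lambda>i. y i + z i) = (\<lambda>u. T y u + T z u)" for y z
      by (simp add: T_def Dop_add sum.distrib fun_eq_iff)
    show "T y \<in> rweighted \<alpha>' (\<sigma> - 0)" if y: "y \<in> rweighted \<beta>' \<sigma>" for y \<sigma>
    proof -
      have "(\<lambda>u. y (0, u)) \<in> level (\<lambda>D. \<psi> D + \<sigma>)"
      proof -
        have "y (0, u) \<in> \<Omega> \<and> ordge (\<beta>' (0, u) + \<sigma>) (y (0, u))" for u
          using y unfolding rweighted_iff by blast
        then show ?thesis by (simp add: \<beta>'_def level_def)
      qed
      moreover have "(\<lambda>u. y (l, u)) \<in> level (\<lambda>D. \<psi> (Suc D) + \<sigma> - e)" if "l \<in> I" for l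
      proof -
        have "y (l, u) \<in> \<Omega> \<and> ordge (\<beta>' (l, u) + \<sigma>) (y (l, u))" for u
          using y unfolding rweighted_iff by blast
        moreover have "l \<noteq> 0" using I0 that by metis
        ultimately show ?thesis by (simp add: \<beta>'_def level_def diff_add_eq)
      qed
      then have "Dop h l (\<lambda>u. y (l, u)) \<in> level (\<lambda>D. \<psi> D + \<sigma>)" if "l \<in> I" for l
        using slope_const[OF \<epsilon>] I that by (intro level_Dop) auto
      ultimately show ?thesis unfolding \<alpha>' T_def by (intro level_add level_sum) auto
    qed
    show "F \<in> weighted \<alpha>" using F \<alpha> by simp
    show "F \<in> rweighted \<alpha>' \<sigma>" unfolding \<alpha>' by (rule level_mono[OF F(1) \<phi>\<psi>])
  qed
  then obtain y where y: "y \<in> weighted \<beta>" "T y = F" by blast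
  have yl: "y (l, u) \<in> \<Omega>" "\<beta> (l, u) \<le> ord (y (l, u))" for l u
    using y(1) by (auto simp: weighted_def)
  have "(\<lambda>u. y (0, u)) \<in> level \<phi>" "supp_in U0 (\<lambda>u. y (0, u))"
  proof -
    show "supp_in U0 (\<lambda>u. y (0, u))" unfolding supp_in_def
    proof (intro allI impI)
      fix u assume "u \<notin> U0"
      then show "y (0, u) = 0" using yl(2)[of 0 u] by (simp add: \<beta>_def ord_eq_infinity_iff)
    qed
    then have "ordge (\<phi> (udeg n u)) (y (0, u))" for u
      using yl(2)[of 0 u] by (cases "u \<in> U0") (simp_all add: \<beta>_def supp_in_def ordge_def)
    then show "(\<lambda>u. y (0, u)) \<in> level \<phi>" using yl(1) by (simp add: level_def)
  qed
  moreover have "(\<lambda>u. y (l, u)) \<in> level (\<lambda>D. \<phi> (Suc D) - e) \<and> supp_in U (\<lambda>u. y (l, u))" if "l \<in> I" for l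
  proof -
    have l0: "l \<noteq> 0" using that I0 by metis
    have "supp_in U (\<lambda>u. y (l, u))" unfolding supp_in_def
    proof (intro allI impI)
      fix u assume "u \<notin> U"
      then show "y (l, u) = 0" using yl(2)[of l u] l0 by (simp add: \<beta>_def ord_eq_infinity_iff)
    qed
    moreover from this have "ordge (\<phi> (Suc (udeg n u)) - e) (y (l, u))" for u
      using yl(2)[of l u] l0 that by (cases "u \<in> U") (simp_all add: \<beta>_def supp_in_def ordge_def)
    ultimately show ?thesis using yl(1) by (simp add: level_def)
  qed
  moreover have "F = (\<lambda>u. y (0, u) + (\<Sum>l\<in>I. Dop h l (\<lambda>u. y (l, u)) u))"
    using y(2) by (simp add: T_def)
  ultimately show ?thesis
    by - (rule exI[of _ "\<lambda>u. y (0, u)"], rule exI[of _ "\<lambda>l u. y (l, u)"], blast)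
qed

section \<open>Existence of the staircase form\<close>

definition zexps :: "nat set \<Rightarrow> (nat \<Rightarrow> nat) set" where
  "zexps K = {u \<in> uexps n. \<forall>k\<in>K. u k = 0}"

lemma supp_zexps: "supp_in (zexps K) F \<longleftrightarrow> supp_in (uexps n) F \<and> (\<forall>k\<in>K. free_of k F)"
  by (auto simp: supp_in_def zexps_def free_of_def)

lemma zexps_empty: "zexps {} = uexps n"
  by (simp add: zexps_def)

lemma supp_uexps_closed:
  assumes "supp_in (uexps n) F" "l \<le> n"
  shows "supp_in (uexps n) (xsub l F)" "supp_in (uexps n) (xdiff l F)" "supp_in (uexps n) (Dop h l F)"
  using assms by (simp_all add: supp_in_def xsub_def xdiff_def Dop_def nabla_def gmul_def uexps_upd)

lemma supp_in_add: "supp_in U F \<Longrightarrow> supp_in U G \<Longrightarrow> supp_in U (\<lambda>u. F u + G u)"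
  by (simp add: supp_in_def)

lemma supp_in_diff: "supp_in U F \<Longrightarrow> supp_in U G \<Longrightarrow> supp_in U (\<lambda>u. F u - G u)"
  by (simp add: supp_in_def)

lemma supp_in_cmult: "supp_in U F \<Longrightarrow> supp_in U (\<lambda>u. a * F u)"
  by (simp add: supp_in_def)

lemma supp_lift_stair: "supp_in (range (stair n)) (lift_stair n a)"
  by (auto simp: supp_in_def lift_stair_def)

lemma supp_in_mono: "supp_in U F \<Longrightarrow> U \<subseteq> V \<Longrightarrow> supp_in V F"
  by (auto simp: supp_in_def)

lemma range_stair_subset: "range (stair n) \<subseteq> uexps n"
  using stair_in_uexps by auto

text \<open>Removing the staircase representative first makes all diagonal sums zero. Once
  \<open>x_1, ..., x_n\<close> are all replaced by \<open>x_0\<close>, a series in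
  \<open>x_0\<close> alone with zero diagonal sums is left, which is zero.\<close>

primrec sub_chain :: "nat \<Rightarrow> ((nat \<Rightarrow> nat) \<Rightarrow> 'k) \<Rightarrow> (nat \<Rightarrow> nat) \<Rightarrow> 'k" where
  "sub_chain 0 F = (\<lambda>u. F u - lift_stair n (diag_sum n F) u)"
| "sub_chain (Suc l) F = xsub (Suc l) (sub_chain l F)"

lemma sub_chain:
  assumes "supp_in (uexps n) F" "l \<le> n"
  shows "supp_in (uexps n) (sub_chain l F)" "\<And>k. k \<in> {1..l} \<Longrightarrow> free_of k (sub_chain l F)"
    "\<And>D. diag_sum n (sub_chain l F) D = 0" "\<And>\<chi>. F \<in> level \<chi> \<Longrightarrow> sub_chain l F \<in> level \<chi>"
  using assms
proof (induct l)
  case 0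
  { case 1 then show ?case using supp_in_mono[OF supp_lift_stair range_stair_subset] by (simp add: supp_in_diff) }
  { case 2 then show ?case by simp }
  { case 3 then show ?case by (simp add: diag_sum_diff diag_sum_lift_stair) }
  { case 4 then show ?case by (simp add: level_diff level_lift_stair diag_sum_level) }
next
  case (Suc l)
  { case 1 then show ?case using Suc(1) by (simp add: supp_uexps_closed) }
  { case 2
    show ?case
    proof (cases "k = Suc l")
      case False
      then have "free_of k (sub_chain l F)" "k \<noteq> 0" using 2 Suc(2)[of k] by auto
      then show ?thesis using free_of_xsub by simp
    qed (simp add: free_of_xsub_self) }
  { case 3 then show ?case using Suc(3) by (simp add: diag_sum_xsub) }
  { case 4 then show ?case using Suc(4) by (simp add: level_xsub) }
qed

text \<open>The chain loses a multiple of \<open>x_l - x_0\<close> at each stage and ends in zero.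
  Its quotients, divided by \<gamma>, telescope to the exact leading-order decomposition that
  \<open>reduction_general\<close> requires.\<close>

lemma reduction_to_stair:
  assumes \<phi>: "slope 0 \<phi>" and \<psi>: "slope \<epsilon> \<psi>" "\<epsilon> > 0" and \<phi>\<psi>: "\<And>D. \<psi> D + \<sigma> \<le> \<phi> D"
    and F: "F \<in> level \<phi>" "supp_in (uexps n) F"
  shows "\<exists>a G. (\<forall>D. a D \<in> \<Omega> \<and> ordge (\<phi> D) (a D)) \<and>
    (\<forall>l\<in>{1..n}. G l \<in> level (\<lambda>D. \<phi> (Suc D) - e) \<and> supp_in (uexps n) (G l)) \<and>
    F = (\<lambda>u. lift_stair n a u + (\<Sum>l=1..n. Dop h l (G l) u))"
proof -
  define g where "g l F = (\<lambda>u. inverse \<gamma> * xdiff l (sub_chain (l - 1) F) u)" for l F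
  have telescope: "sub_chain 0 F u = sub_chain m F u + (\<Sum>l=1..m. \<gamma> * (xmul l (g l F) u - xmul 0 (g l F) u))"
    for m F u
  proof (induct m)
    case (Suc m)
    have "xmul k (g (Suc m) F) u = inverse \<gamma> * xmul k (xdiff (Suc m) (sub_chain m F)) u" for k
      by (simp add: g_def xmul_def)
    then have "\<gamma> * (xmul (Suc m) (g (Suc m) F) u - xmul 0 (g (Suc m) F) u) =
        xmul (Suc m) (xdiff (Suc m) (sub_chain m F)) u - xmul 0 (xdiff (Suc m) (sub_chain m F)) u"
      using \<gamma>_nz by (simp add: right_diff_distrib mult.assoc[symmetric])
    then show ?case using Suc xsub_xdiff[of "Suc m" "sub_chain m F" u] by simp
  qed simp
  have "\<exists>w G. w \<in> level \<phi> \<and> supp_in (range (stair n)) w \<and>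
    (\<forall>l\<in>{1..n}. G l \<in> level (\<lambda>D. \<phi> (Suc D) - e) \<and> supp_in (uexps n) (G l)) \<and>
    F = (\<lambda>u. w u + (\<Sum>l\<in>{1..n}. Dop h l (G l) u))"
  proof (rule reduction_general[OF \<phi> \<psi> \<phi>\<psi>, where v = "\<lambda>F. lift_stair n (diag_sum n F)" and g = g])
    show "lift_stair n (diag_sum n F) \<in> level \<chi> \<and> supp_in (range (stair n)) (lift_stair n (diag_sum n F))"
      if "F \<in> level \<chi>" "supp_in (uexps n) F" for F \<chi>
      using that by (simp add: supp_lift_stair level_lift_stair diag_sum_level)
    show "g l F \<in> level (\<lambda>D. \<chi> (Suc D) - e) \<and> supp_in (uexps n) (g l F)"
      if "F \<in> level \<chi>" "supp_in (uexps n) F" "l \<in> {1..n}" for F \<chi> l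
    proof
      have "l - 1 \<le> n" "l \<le> n" "l \<noteq> 0" using that by auto
      then show "g l F \<in> level (\<lambda>D. \<chi> (Suc D) - e)" unfolding g_def
        by (intro level_cmult[OF level_xdiff[OF _ _ sub_chain(4)] _ ordge_inverse_\<gamma>]) (use that \<gamma>_in in auto)
      show "supp_in (uexps n) (g l F)" unfolding g_def
        using \<open>l - 1 \<le> n\<close> \<open>l \<le> n\<close> that by (intro supp_in_cmult supp_uexps_closed sub_chain)
    qed
    show "F = (\<lambda>u. lift_stair n (diag_sum n F) u + (\<Sum>l\<in>{1..n}. \<gamma> * (xmul l (g l F) u - xmul 0 (g l F) u)))"
      if "supp_in (uexps n) F" for F
    proof
      fix u
      have "sub_chain n F = (\<lambda>u. 0)"
        using sub_chain[OF that order_refl] by (intro diag_sum_eq_0_imp_eq_0) (auto simp: supp_in_def)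
      then show "F u = lift_stair n (diag_sum n F) u + (\<Sum>l\<in>{1..n}. \<gamma> * (xmul l (g l F) u - xmul 0 (g l F) u))"
        using telescope[of F u n] by (simp add: diff_eq_eq add.commute)
    qed
    show "range (stair n) \<subseteq> uexps n" by (rule range_stair_subset)
    show "supp_in (uexps n) (Dop h l F)" if "l \<in> {1..n}" "supp_in (uexps n) F" for l F
      using that by (intro supp_uexps_closed) auto
  qed (use F in auto)
  then obtain w G where w: "w \<in> level \<phi>" "supp_in (range (stair n)) w"
    and G: "\<forall>l\<in>{1..n}. G l \<in> level (\<lambda>D. \<phi> (Suc D) - e) \<and> supp_in (uexps n) (G l)"
    and eq: "F = (\<lambda>u. w u + (\<Sum>l\<in>{1..n}. Dop h l (G l) u))" by blast
  define a where "a D = w (stair n D)" for D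
  have wa: "w = lift_stair n a"
  proof
    fix u
    show "w u = lift_stair n a u"
    proof (cases "u = stair n (udeg n u)")
      case True
      show ?thesis by (simp add: lift_stair_def a_def True[symmetric])
    next
      case False
      have nr: "u \<notin> range (stair n)"
      proof
        assume "u \<in> range (stair n)"
        then obtain D where D: "u = stair n D" by blast
        have deg: "udeg n u = D" unfolding D by (rule udeg_stair)
        have "u = stair n (udeg n u)" unfolding deg by (rule D)
        then show False using False by contradiction
      qed
      have "w u = 0" by (rule w(2)[unfolded supp_in_def, rule_format, OF nr])
      then show ?thesis using False by (simp add: lift_stair_def)
    qed
  qed
  have eq': "F = (\<lambda>u. lift_stair n a u + (\<Sum>l\<in>{1..n}. Dop h l (G l) u))"
    unfolding wa[symmetric] by (rule eq)
  have "a D \<in> \<Omega> \<and> ordge (\<phi> D) (a D)" for D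
    using levelD(1)[OF w(1)] levelD(2)[OF w(1), of "\<phi> D" "stair n D"] by (simp add: a_def udeg_stair)
  then show ?thesis
    by - (rule exI[of _ a], rule exI[of _ G], intro conjI allI G eq', simp_all)
qed

text \<open>Here only \<open>x_l\<close> is eliminated. As \<open>D_l\<close> and the division touch
  no variables other than \<open>x_0\<close> and \<open>x_l\<close>, those in \<open>K\<close> stay
  absent throughout, also from the preimage.\<close>

lemma reduction_step:
  assumes \<psi>: "slope \<epsilon> \<psi>" "\<epsilon> > 0" and l: "l \<in> {1..n}" "l \<notin> K" "0 \<notin> K"
    and F: "F \<in> level (\<lambda>D. \<psi> D + \<sigma>)" "supp_in (zexps K) F"
  shows "\<exists>w G. w \<in> level (\<lambda>D. \<psi> D + \<sigma>) \<and> supp_in (zexps (insert l K)) w \<and>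
    G \<in> level (\<lambda>D. \<psi> (Suc D) + \<sigma> - e) \<and> supp_in (zexps K) G \<and> F = (\<lambda>u. w u + Dop h l G u)"
proof -
  have \<psi>0: "slope 0 \<psi>" using slope_weaken \<psi> by simp
  have ln: "l \<le> n" "l \<noteq> 0" using l by auto
  have "\<exists>w G. w \<in> level (\<lambda>D. \<psi> D + \<sigma>) \<and> supp_in (zexps (insert l K)) w \<and>
    (\<forall>j\<in>{l}. G j \<in> level (\<lambda>D. \<psi> (Suc D) + \<sigma> - e) \<and> supp_in (zexps K) (G j)) \<and>
    F = (\<lambda>u. w u + (\<Sum>j\<in>{l}. Dop h j (G j) u))"
  proof (rule reduction_general[OF slope_const[OF \<psi>0] \<psi>, where v = "xsub l" and
        g = "\<lambda>l F u. inverse \<gamma> * xdiff l F u" and \<sigma> = \<sigma>])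
    show "xsub l F \<in> level \<chi> \<and> supp_in (zexps (insert l K)) (xsub l F)"
      if "F \<in> level \<chi>" "supp_in (zexps K) F" for F \<chi>
    proof -
      have "k \<noteq> 0" if "k \<in> K" for k using l(3) that by metis
      then show ?thesis
        using that ln by (auto simp: supp_zexps level_xsub supp_uexps_closed free_of_xsub_self free_of_xsub)
    qed
    show "(\<lambda>u. inverse \<gamma> * xdiff j F u) \<in> level (\<lambda>D. \<chi> (Suc D) - e) \<and>
        supp_in (zexps K) (\<lambda>u. inverse \<gamma> * xdiff j F u)"
      if "F \<in> level \<chi>" "supp_in (zexps K) F" "j \<in> {l}" for F \<chi> j
    proof
      have j: "j = l" using that by simp
      show "(\<lambda>u. inverse \<gamma> * xdiff j F u) \<in> level (\<lambda>D. \<chi> (Suc D) - e)" unfolding j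
        by (intro level_cmult[OF level_xdiff[OF ln that(1)] _ ordge_inverse_\<gamma>]) (use \<gamma>_in in auto)
      have "free_of k (xdiff l F)" if "k \<in> K" for k
      proof (rule free_of_xdiff)
        show "k \<noteq> l" "k \<noteq> 0" using that l by metis+
      qed (use \<open>supp_in (zexps K) F\<close> that in \<open>simp add: supp_zexps\<close>)
      then show "supp_in (zexps K) (\<lambda>u. inverse \<gamma> * xdiff j F u)"
        using that ln unfolding j supp_zexps by (auto intro: supp_in_cmult free_of_cmult supp_uexps_closed)
    qed
    show "F = (\<lambda>u. xsub l F u + (\<Sum>j\<in>{l}. \<gamma> * (xmul j (\<lambda>u. inverse \<gamma> * xdiff j F u) u -
        xmul 0 (\<lambda>u. inverse \<gamma> * xdiff j F u) u)))" for F
    proof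
      fix u
      have "xmul k (\<lambda>u. inverse \<gamma> * xdiff l F u) u = inverse \<gamma> * xmul k (xdiff l F) u" for k
        by (simp add: xmul_def)
      then show "F u = xsub l F u + (\<Sum>j\<in>{l}. \<gamma> * (xmul j (\<lambda>u. inverse \<gamma> * xdiff j F u) u -
          xmul 0 (\<lambda>u. inverse \<gamma> * xdiff j F u) u))"
        using \<gamma>_nz xsub_xdiff[OF ln(2), of F u] by (simp add: right_diff_distrib mult.assoc[symmetric])
    qed
    show "zexps (insert l K) \<subseteq> zexps K" by (auto simp: zexps_def)
    show "supp_in (zexps K) (Dop h j F)" if "j \<in> {l}" "supp_in (zexps K) F" for j F
    proof -
      have "free_of k (Dop h l F)" if "k \<in> K" for k
      proof (rule free_of_Dop)
        show "k \<noteq> l" "k \<noteq> 0" using that l by metis+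
      qed (use \<open>supp_in (zexps K) F\<close> that in \<open>simp add: supp_zexps\<close>)
      then show ?thesis using that ln by (auto simp: supp_zexps supp_uexps_closed)
    qed
  qed (use F l in auto)
  then show ?thesis by auto
qed

text \<open>
  Since \<open>D\<^sub>l\<close> only involves \<open>x\<^sub>0\<close> and \<open>x\<^sub>l\<close> and the \<open>D\<^sub>l\<close> commute, every element of the sum of their images
  is a combination in which \<open>G l\<close> does not involve \<open>x\<^sub>1, \<dots>, x\<^bsub>l-1\<^esub>\<close>. Such a combination is unique.
\<close>

definition bounded_series :: "(nat \<Rightarrow> real) \<Rightarrow> nat \<Rightarrow> ((nat \<Rightarrow> nat) \<Rightarrow> 'k) set" where
  "bounded_series \<psi> k = {F. supp_in (zexps {1..k}) F \<and> (\<exists>\<sigma>. F \<in> level (\<lambda>D. \<psi> (Suc D) - e + \<sigma>))}"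

lemma bounded_series_add:
  assumes "F \<in> bounded_series \<psi> k" "G \<in> bounded_series \<psi> k"
  shows "(\<lambda>u. F u + G u) \<in> bounded_series \<psi> k"
proof -
  obtain \<sigma> \<tau> where "F \<in> level (\<lambda>D. \<psi> (Suc D) - e + \<sigma>)" "G \<in> level (\<lambda>D. \<psi> (Suc D) - e + \<tau>)"
    using assms by (auto simp: bounded_series_def)
  then have "F \<in> level (\<lambda>D. \<psi> (Suc D) - e + min \<sigma> \<tau>)" "G \<in> level (\<lambda>D. \<psi> (Suc D) - e + min \<sigma> \<tau>)"
    by (auto intro: level_mono)
  then show ?thesis using assms by (auto simp: bounded_series_def intro: level_add supp_in_add)
qed

lemma bounded_series_0: "(\<lambda>u. 0) \<in> bounded_series \<psi> k"
  by (auto simp: bounded_series_def supp_in_def level_def)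

lemma bounded_series_sum:
  "(\<And>i. i \<in> I \<Longrightarrow> F i \<in> bounded_series \<psi> k) \<Longrightarrow> (\<lambda>u. \<Sum>i\<in>I. F i u) \<in> bounded_series \<psi> k"
  by (induct I rule: infinite_finite_induct) (simp_all add: bounded_series_0 bounded_series_add)

lemma bounded_series_Dop:
  assumes \<psi>: "slope 0 \<psi>" and F: "F \<in> bounded_series \<psi> k" and l: "l \<le> n" "l > k"
  shows "Dop h l F \<in> bounded_series \<psi> k"
proof -
  obtain \<sigma> where \<sigma>: "F \<in> level (\<lambda>D. \<psi> (Suc D) - e + \<sigma>)" and s: "supp_in (zexps {1..k}) F"
    using F by (auto simp: bounded_series_def)
  have "Dop h l F \<in> level (\<lambda>D. \<psi> D + \<sigma>)"
    using \<sigma> by (intro level_Dop slope_const \<psi> l) (simp add: algebra_simps)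
  \<comment> \<open>The upper slope turns the bound \<open>\<psi> D\<close> into
    \<open>\<psi> (Suc D) - e\<close> at the price of a constant \<open>1\<close>, which the free
    constant in \<open>bounded_series\<close> absorbs.\<close>
  then have "Dop h l F \<in> level (\<lambda>D. \<psi> (Suc D) - e + (\<sigma> - 1))"
  proof (rule level_mono)
    fix D
    have "\<psi> (Suc D) + 0 \<le> \<psi> D + (e + 1)" using \<psi> unfolding slope_def by blast
    then show "\<psi> (Suc D) - e + (\<sigma> - 1) \<le> \<psi> D + \<sigma>" by simp
  qed
  moreover have "supp_in (zexps {1..k}) (Dop h l F)"
    using s l unfolding supp_zexps by (auto simp: supp_uexps_closed intro!: free_of_Dop)
  ultimately show ?thesis by (auto simp: bounded_series_def)
qed

lemma slope_Suc: "slope \<epsilon> \<psi> \<Longrightarrow> slope \<epsilon> (\<lambda>D. \<psi> (Suc D))"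
  by (simp add: slope_def)

text \<open>For \<open>l > k + 1\<close> write \<open>G l = A + D_(k+1) B\<close> with
  \<open>A\<close> free of \<open>x_(k+1)\<close>. Then
  \<open>D_l D_(k+1) B = D_(k+1) (D_l B)\<close> moves into the summand of index
  \<open>k + 1\<close>, which may still involve \<open>x_(k+1)\<close>, and the recursion treats the
  parts \<open>A\<close>.\<close>

lemma normalize_images:
  assumes \<psi>: "slope \<epsilon> \<psi>" "\<epsilon> > 0"
  shows "k \<le> n \<Longrightarrow> (\<And>l. l \<in> {k<..n} \<Longrightarrow> G l \<in> bounded_series \<psi> k) \<Longrightarrow>
    \<exists>G'. (\<forall>l\<in>{k<..n}. G' l \<in> bounded_series \<psi> (l - 1)) \<and>
      (\<forall>u. (\<Sum>l\<in>{k<..n}. Dop h l (G l) u) = (\<Sum>l\<in>{k<..n}. Dop h l (G' l) u))"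
proof (induct "n - k" arbitrary: k G)
  case 0
  then show ?case by auto
next
  case (Suc m)
  have \<psi>0: "slope 0 \<psi>" using slope_weaken \<psi> by simp
  have k: "k < n" using Suc by simp
  have set: "{k<..n} = insert (Suc k) {Suc k<..n}" using k by auto
  have "\<exists>A B. A \<in> bounded_series \<psi> (Suc k) \<and> B \<in> bounded_series \<psi> k \<and> G l = (\<lambda>u. A u + Dop h (Suc k) B u)"
    if l: "l \<in> {Suc k<..n}" for l
  proof -
    have "G l \<in> bounded_series \<psi> k" using Suc.prems(2)[of l] l by auto
    then obtain \<sigma> where \<sigma>: "G l \<in> level (\<lambda>D. \<psi> (Suc D) - e + \<sigma>)" and s: "supp_in (zexps {1..k}) (G l)"
      by (auto simp: bounded_series_def)
    have "G l \<in> level (\<lambda>D. \<psi> (Suc D) + (\<sigma> - e))" using \<sigma> by (simp add: algebra_simps)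
    from reduction_step[OF slope_Suc[OF \<psi>(1)] \<psi>(2) _ _ _ this s, of "Suc k"] k
    obtain A B where AB: "A \<in> level (\<lambda>D. \<psi> (Suc D) + (\<sigma> - e))" "supp_in (zexps (insert (Suc k) {1..k})) A"
      "B \<in> level (\<lambda>D. \<psi> (Suc (Suc D)) + (\<sigma> - e) - e)" "supp_in (zexps {1..k}) B"
      "G l = (\<lambda>u. A u + Dop h (Suc k) B u)" by auto
    have "insert (Suc k) {1..k} = {1..Suc k}" by auto
    then have "A \<in> bounded_series \<psi> (Suc k)"
      using AB(1,2) unfolding bounded_series_def by (intro CollectI conjI exI[of _ \<sigma>]) (simp_all add: algebra_simps)
    moreover have "B \<in> level (\<lambda>D. \<psi> (Suc D) - e + (\<sigma> - e))"
    proof (rule level_mono[OF AB(3)])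
      fix D
      have "\<psi> (Suc D) + e + 0 \<le> \<psi> (Suc (Suc D))" using \<psi>0 unfolding slope_def by blast
      then show "\<psi> (Suc D) - e + (\<sigma> - e) \<le> \<psi> (Suc (Suc D)) + (\<sigma> - e) - e" using e_pos by simp
    qed
    then have "B \<in> bounded_series \<psi> k" using AB(4) unfolding bounded_series_def by blast
    ultimately show ?thesis using AB(5) by blast
  qed
  then obtain A B where A: "\<And>l. l \<in> {Suc k<..n} \<Longrightarrow> A l \<in> bounded_series \<psi> (Suc k)"
    and B: "\<And>l. l \<in> {Suc k<..n} \<Longrightarrow> B l \<in> bounded_series \<psi> k"
    and AB: "\<And>l. l \<in> {Suc k<..n} \<Longrightarrow> G l = (\<lambda>u. A l u + Dop h (Suc k) (B l) u)" by metis
  have "m = n - Suc k" "Suc k \<le> n" using Suc(2) k by auto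
  then have "\<exists>G'. (\<forall>l\<in>{Suc k<..n}. G' l \<in> bounded_series \<psi> (l - 1)) \<and>
      (\<forall>u. (\<Sum>l\<in>{Suc k<..n}. Dop h l (A l) u) = (\<Sum>l\<in>{Suc k<..n}. Dop h l (G' l) u))"
    by (rule Suc(1)) (rule A)
  then obtain G' where G': "\<And>l. l \<in> {Suc k<..n} \<Longrightarrow> G' l \<in> bounded_series \<psi> (l - 1)"
    and G'_sum: "\<And>u. (\<Sum>l\<in>{Suc k<..n}. Dop h l (A l) u) = (\<Sum>l\<in>{Suc k<..n}. Dop h l (G' l) u)"
    by blast
  define g where "g = (\<lambda>u. G (Suc k) u + (\<Sum>l\<in>{Suc k<..n}. Dop h l (B l) u))"
  have g: "g \<in> bounded_series \<psi> k" unfolding g_def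
    using Suc.prems(2)[of "Suc k"] k by (intro bounded_series_add bounded_series_sum bounded_series_Dop \<psi>0 B) auto
  have "(\<Sum>l\<in>{k<..n}. Dop h l (G l) u) = (\<Sum>l\<in>{k<..n}. Dop h l ((G'(Suc k := g)) l) u)" for u
  proof -
    have "(\<Sum>l\<in>{k<..n}. Dop h l (G l) u) = Dop h (Suc k) (G (Suc k)) u +
        (\<Sum>l\<in>{Suc k<..n}. Dop h l (\<lambda>u. A l u + Dop h (Suc k) (B l) u) u)"
      unfolding set by (simp add: AB)
    also have "(\<Sum>l\<in>{Suc k<..n}. Dop h l (\<lambda>u. A l u + Dop h (Suc k) (B l) u) u) =
        (\<Sum>l\<in>{Suc k<..n}. Dop h l (G' l) u) + (\<Sum>l\<in>{Suc k<..n}. Dop h (Suc k) (Dop h l (B l)) u)"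
      by (simp add: Dop_add sum.distrib G'_sum Dop_commute[of h _ "Suc k"])
    also have "Dop h (Suc k) (G (Suc k)) u + \<dots> = Dop h (Suc k) g u + (\<Sum>l\<in>{Suc k<..n}. Dop h l (G' l) u)"
      by (simp add: g_def Dop_add Dop_sum)
    also have "\<dots> = (\<Sum>l\<in>{k<..n}. Dop h l ((G'(Suc k := g)) l) u)"
      unfolding set by (subst sum.insert) (auto intro!: sum.cong)
    finally show ?thesis .
  qed
  moreover have "(G'(Suc k := g)) l \<in> bounded_series \<psi> (l - 1)" if "l \<in> {k<..n}" for l
    using that G' g by (cases "l = Suc k") auto
  ultimately show ?case by blast
qed

text \<open>The system is triangular: all summands with \<open>l > k + 1\<close> are free of
  \<open>x_(k+1)\<close>. Dividing \<open>E\<close> by \<open>x_(k+1) - x_0\<close> thus yields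
  \<open>\<gamma> * G (k + 1)\<close> as quotient and the other summands as remainder, both with the
  bound inherited from \<open>E\<close>.\<close>

lemma recover_summands:
  assumes "E \<in> level \<chi>" "k \<le> n"
    and E: "E = (\<lambda>u. \<Sum>l\<in>{k<..n}. \<gamma> * (xmul l (G l) u - xmul 0 (G l) u))"
    and G: "\<And>l j. l \<in> {k<..n} \<Longrightarrow> j \<in> {1..<l} \<Longrightarrow> free_of j (G l)"
  shows "l \<in> {k<..n} \<Longrightarrow> G l \<in> level (\<lambda>D. \<chi> (Suc D) - e)"
  using assms
proof (induct "n - k" arbitrary: k E)
  case (Suc m)
  let ?X = "\<lambda>l u. \<gamma> * (xmul l (G l) u - xmul 0 (G l) u)"
  have k: "k < n" using Suc by simp
  have set: "{k<..n} = insert (Suc k) {Suc k<..n}" using k by auto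
  define E' where "E' = (\<lambda>u. \<Sum>l\<in>{Suc k<..n}. ?X l u)"
  have E'_free: "free_of (Suc k) E'" unfolding E'_def
    using Suc.prems(5) by (intro free_of_sum free_of_cmult free_of_diff free_of_xmul) auto
  have E: "E = (\<lambda>u. ?X (Suc k) u + E' u)" unfolding Suc.prems(4) E'_def set by simp
  have "xsub (Suc k) E = E'"
    by (simp add: E xsub_add xsub_cmult xsub_xmul xsub_free[OF E'_free])
  then have E'_level: "E' \<in> level \<chi>" using level_xsub[of "Suc k" E \<chi>] Suc.prems k by simp
  have "xdiff (Suc k) E = (\<lambda>u. \<gamma> * G (Suc k) u)"
    by (simp add: E xdiff_add xdiff_cmult xdiff_xmul xdiff_free[OF E'_free])
  then have "(\<lambda>u. inverse \<gamma> * xdiff (Suc k) E u) = G (Suc k)"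
    using \<gamma>_nz by (simp add: mult.assoc[symmetric])
  moreover have "(\<lambda>u. inverse \<gamma> * xdiff (Suc k) E u) \<in> level (\<lambda>D. \<chi> (Suc D) - e)"
    using k Suc.prems(2) \<gamma>_in by (intro level_cmult[OF level_xdiff _ ordge_inverse_\<gamma>]) auto
  ultimately have "G (Suc k) \<in> level (\<lambda>D. \<chi> (Suc D) - e)" by simp
  moreover have "G l \<in> level (\<lambda>D. \<chi> (Suc D) - e)" if "l \<in> {Suc k<..n}"
    using Suc(2) k that Suc.prems(5) by (intro Suc(1)[OF _ that E'_level _ E'_def]) auto
  ultimately show ?case using Suc.prems(1) unfolding set by blast
qed auto

text \<open>In a normalized relation the leading parts equal minus the remainders, which gain
  \<epsilon>. The leading parts determine \<open>a\<close> and all \<open>G' l\<close>, so these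
  gain \<epsilon> as well; repeating this makes them zero.\<close>

lemma stair_unique:
  assumes \<psi>: "slope \<epsilon> \<psi>" "\<epsilon> > 0"
    and a: "\<And>D. a D \<in> \<Omega>" "\<And>D. ordge (\<psi> D + \<tau>) (a D)"
    and G: "\<And>l. l \<in> {1..n} \<Longrightarrow> G l \<in> bounded_series \<psi> 0"
    and eq: "\<And>u. lift_stair n a u + (\<Sum>l=1..n. Dop h l (G l) u) = 0"
  shows "a D = 0"
proof -
  have set: "{1..n} = {0<..n}" by auto
  obtain G' where G': "\<forall>l\<in>{0<..n}. G' l \<in> bounded_series \<psi> (l - 1)"
    "\<And>u. (\<Sum>l\<in>{0<..n}. Dop h l (G l) u) = (\<Sum>l\<in>{0<..n}. Dop h l (G' l) u)"
    using normalize_images[OF \<psi>, of 0 G] G set by auto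
  have eq': "lift_stair n a u + (\<Sum>l\<in>{0<..n}. Dop h l (G' l) u) = 0" for u
    using eq[of u] G'(2)[of u] set by simp
  have free: "free_of j (G' l)" if "l \<in> {0<..n}" "j \<in> {1..<l}" for l j
    using G'(1) that by (auto simp: bounded_series_def supp_zexps)
  have "\<forall>l\<in>{0<..n}. \<exists>\<sigma>. G' l \<in> level (\<lambda>D. \<psi> (Suc D) - e + \<sigma>)"
    using G'(1) by (auto simp: bounded_series_def)
  then obtain \<sigma> where \<sigma>: "\<And>l. l \<in> {0<..n} \<Longrightarrow> G' l \<in> level (\<lambda>D. \<psi> (Suc D) - e + \<sigma> l)" by metis
  \<comment> \<open>One common starting bound for the finitely many preimages, from which the
    repeated gain is counted.\<close>
  define \<sigma>0 where "\<sigma>0 = Min (insert \<tau> (\<sigma> ` {0<..n}))"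
  have \<sigma>0: "\<sigma>0 \<le> \<tau>" "\<And>l. l \<in> {0<..n} \<Longrightarrow> \<sigma>0 \<le> \<sigma> l" unfolding \<sigma>0_def by (intro Min_le; auto)+
  have step: "(\<forall>D. ordge (\<psi> D + s + \<epsilon>) (a D)) \<and> (\<forall>l\<in>{0<..n}. G' l \<in> level (\<lambda>D. \<psi> (Suc D) - e + (s + \<epsilon>)))"
    if "\<forall>l\<in>{0<..n}. G' l \<in> level (\<lambda>D. \<psi> (Suc D) - e + s)" for s
  proof -
    let ?X = "\<lambda>l u. \<gamma> * (xmul l (G' l) u - xmul 0 (G' l) u)"
    define E where "E = (\<lambda>u. lift_stair n a u + (\<Sum>l\<in>{0<..n}. ?X l u))"
    have "E = (\<lambda>u. - (\<Sum>l\<in>{0<..n}. Dop h l (G' l) u - ?X l u))"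
    proof
      fix u
      show "E u = - (\<Sum>l\<in>{0<..n}. Dop h l (G' l) u - ?X l u)"
        using eq'[of u] by (simp add: E_def sum_subtractf eq_neg_iff_add_eq_0)
    qed
    moreover have "\<dots> \<in> level (\<lambda>D. \<psi> D + s + \<epsilon>)"
      using that \<psi> by (intro level_uminus level_sum Dop_remainder slope_const) (auto simp: algebra_simps)
    ultimately have E: "E \<in> level (\<lambda>D. \<psi> D + s + \<epsilon>)" by simp
    \<comment> \<open>Multiples of \<open>x_l - x_0\<close> have zero diagonal sums, so only the
      staircase part contributes.\<close>
    have "diag_sum n E D = a D" for D
      by (simp add: E_def diag_sum_add diag_sum_sum diag_sum_cmult diag_sum_diff diag_sum_xmul diag_sum_lift_stair)
    then have a': "ordge (\<psi> D + s + \<epsilon>) (a D)" for D using diag_sum_level(2)[OF E] by metis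
    have "(\<lambda>u. E u - lift_stair n a u) \<in> level (\<lambda>D. \<psi> D + s + \<epsilon>)"
      by (intro level_diff E level_lift_stair a a')
    moreover have "(\<lambda>u. E u - lift_stair n a u) = (\<lambda>u. \<Sum>l\<in>{0<..n}. ?X l u)" by (simp add: E_def)
    ultimately have "G' l \<in> level (\<lambda>D. \<psi> (Suc D) + s + \<epsilon> - e)" if "l \<in> {0<..n}" for l
      using recover_summands[of "\<lambda>u. E u - lift_stair n a u" "\<lambda>D. \<psi> D + s + \<epsilon>" 0 G'] free that by simp
    then show ?thesis using a' by (simp add: algebra_simps)
  qed
  have all: "\<forall>l\<in>{0<..n}. G' l \<in> level (\<lambda>D. \<psi> (Suc D) - e + (\<sigma>0 + real N * \<epsilon>))" for N
  proof (induct N)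
    case 0
    show ?case
    proof
      fix l assume l: "l \<in> {0<..n}"
      show "G' l \<in> level (\<lambda>D. \<psi> (Suc D) - e + (\<sigma>0 + real 0 * \<epsilon>))"
        using \<sigma>0(2)[OF l] by (intro level_mono[OF \<sigma>[OF l]]) simp
    qed
  next
    case (Suc N)
    then show ?case using step[of "\<sigma>0 + real N * \<epsilon>"] by (simp add: algebra_simps)
  qed
  show ?thesis
  proof (rule ordge_imp_0)
    fix r
    obtain N where "(r - \<psi> D - \<sigma>0) / \<epsilon> \<le> real N" using real_arch_simple by blast
    then have "r \<le> \<psi> D + (\<sigma>0 + real N * \<epsilon>) + \<epsilon>" using \<psi>(2) by (simp add: field_simps)
    then show "ordge r (a D)" using step[OF all] ordge_mono by blast
  qed
qed

end

section \<open>The connection matrix\<close>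

text \<open>
  With \<open>x\<^sub>0 = t / (x\<^sub>1 \<cdots> x\<^sub>n)\<close> the monomials \<open>t ^ s x ^ v\<close>, \<open>s \<ge> m(v)\<close>, are the monomials in
  \<open>x\<^sub>0, \<dots>, x\<^sub>n\<close>, and the weight \<open>(n + 1) r + w(v)\<close> with \<open>s = r + m(v)\<close> is the total degree.
\<close>

definition uexp_of :: "nat \<Rightarrow> nat \<Rightarrow> (nat \<Rightarrow> int) \<Rightarrow> nat \<Rightarrow> nat" where
  "uexp_of n s v = (\<lambda>k. if k = 0 then s else if k \<le> n then nat (v k + int s) else 0)"

definition vexp_of :: "nat \<Rightarrow> (nat \<Rightarrow> nat) \<Rightarrow> nat \<Rightarrow> int" where
  "vexp_of n u = (\<lambda>k. if k \<in> {1..n} then int (u k) - int (u 0) else 0)"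

definition tx_of :: "nat \<Rightarrow> ((nat \<Rightarrow> nat) \<Rightarrow> 'k::field_char_0) \<Rightarrow> 'k tx_series" where
  "tx_of n G = (\<lambda>s v. if v \<in> exps n \<and> mneg n v \<le> int s then G (uexp_of n s v) else 0)"

definition ones :: "nat \<Rightarrow> nat \<Rightarrow> int" where
  "ones m = (\<lambda>k. if k \<in> {1..m} then 1 else 0)"

definition axis :: "nat \<Rightarrow> nat \<Rightarrow> nat \<Rightarrow> int" where
  "axis l d = (\<lambda>k. if k = l then int d else 0)"

text \<open>Together with \<open>t^d\<close> this is the exponent of \<open>x_0^d\<close>.\<close>

definition antidiag :: "nat \<Rightarrow> nat \<Rightarrow> nat \<Rightarrow> int" where
  "antidiag n d = (\<lambda>k. if k \<in> {1..n} then - int d else 0)"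

section \<open>Change of variables between \<open>t, x_1, ..., x_n\<close> and
  \<open>x_0, ..., x_n\<close>\<close>

lemma mneg_le_iff: "mneg n v \<le> int s \<longleftrightarrow> (\<forall>k\<in>{1..n}. 0 \<le> v k + int s)"
  unfolding mneg_def by (subst Max_le_iff) auto

lemma mneg_nonneg: "0 \<le> mneg n v"
  unfolding mneg_def by (rule Max_ge) auto

lemma uexp_of_in: "uexp_of n s v \<in> uexps n"
  by (simp add: uexp_of_def uexps_def)

lemma vexp_of_in: "vexp_of n u \<in> exps n"
  by (simp add: vexp_of_def exps_def)

lemma mneg_vexp_of: "mneg n (vexp_of n u) \<le> int (u 0)"
  unfolding mneg_le_iff by (simp add: vexp_of_def)

lemma uexp_of_vexp_of: "u \<in> uexps n \<Longrightarrow> uexp_of n (u 0) (vexp_of n u) = u"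
  by (auto simp: uexp_of_def vexp_of_def uexps_def fun_eq_iff)

lemma vexp_of_uexp_of: "v \<in> exps n \<Longrightarrow> mneg n v \<le> int s \<Longrightarrow> vexp_of n (uexp_of n s v) = v"
  unfolding mneg_le_iff by (auto simp: uexp_of_def vexp_of_def exps_def fun_eq_iff)

lemma tx_of_inject:
  assumes "tx_of n F = tx_of n G" "u \<in> uexps n"
  shows "F u = G u"
  using fun_cong[OF fun_cong[OF assms(1)], of "u 0" "vexp_of n u"] assms(2)
  by (simp add: tx_of_def vexp_of_in mneg_vexp_of uexp_of_vexp_of)

lemma tx_of_add: "tx_of n (\<lambda>u. F u + G u) = (\<lambda>s v. tx_of n F s v + tx_of n G s v)"
  by (simp add: tx_of_def fun_eq_iff)

lemma tx_of_diff: "tx_of n (\<lambda>u. F u - G u) = (\<lambda>s v. tx_of n F s v - tx_of n G s v)"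
  by (simp add: tx_of_def fun_eq_iff)

lemma tx_of_sum: "tx_of n (\<lambda>u. \<Sum>i\<in>I. F i u) = (\<lambda>s v. \<Sum>i\<in>I. tx_of n (F i) s v)"
  by (auto simp: tx_of_def fun_eq_iff intro!: sum.neutral)

lemma udeg_uexp_of:
  assumes "mneg n v \<le> int s"
  shows "int (udeg n (uexp_of n s v)) = (int n + 1) * int s + (\<Sum>k=1..n. v k)"
proof -
  have "udeg n (uexp_of n s v) = s + (\<Sum>k=1..n. nat (v k + int s))"
    unfolding udeg_def by (simp add: atMost_atLeast0 sum.atLeast_Suc_atMost uexp_of_def)
  moreover have "(\<Sum>k=1..n. int (nat (v k + int s))) = (\<Sum>k=1..n. v k + int s)"
    using assms unfolding mneg_le_iff by (intro sum.cong) auto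
  ultimately show ?thesis by (simp add: sum.distrib algebra_simps)
qed

text \<open>The series with terms \<open>h d * x_k^d\<close>, \<open>d \<ge> 1\<close>, written in
  \<open>t\<close> and \<open>x\<close>; for \<open>k = 0\<close> the power \<open>x_0^d\<close>
  appears as \<open>t^d\<close> with exponent \<open>antidiag n d\<close>.\<close>

definition axis_series :: "(nat \<Rightarrow> 'k::field_char_0) \<Rightarrow> nat \<Rightarrow> nat \<Rightarrow> 'k tx_series" where
  "axis_series h n k = (\<lambda>s v. if k = 0 then (if s \<ge> 1 \<and> v = antidiag n s then h s else 0)
     else (if s = 0 \<and> v k \<ge> 1 \<and> v = axis k (nat (v k)) then h (nat (v k)) else 0))"

lemma tx_mult_antidiag:
  "tx_mult (axis_series h n 0) F s v = (\<Sum>d=1..s. h d * F (s - d) (\<lambda>j. v j - antidiag n d j))"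
proof -
  let ?t = "\<lambda>(s', v'). if s' \<le> s then axis_series h n 0 s' v' * F (s - s') (\<lambda>j. v j - v' j) else 0"
  let ?Z = "(\<lambda>d. (d, antidiag n d)) ` {1..s}"
  have "{x. ?t x \<noteq> 0} \<subseteq> ?Z" by (auto simp: axis_series_def split: if_splits)
  then have "Sum_any ?t = sum ?t ?Z" by (intro Sum_any.expand_superset) auto
  also have "\<dots> = (\<Sum>d=1..s. ?t (d, antidiag n d))"
    by (subst sum.reindex) (auto simp: inj_on_def)
  also have "\<dots> = (\<Sum>d=1..s. h d * F (s - d) (\<lambda>j. v j - antidiag n d j))"
    by (intro sum.cong) (auto simp: axis_series_def)
  finally show ?thesis by (simp add: tx_mult_def)
qed

text \<open>The support condition built into \<open>tx_of\<close> caps \<open>d\<close> at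
  \<open>v l + s\<close>. Finiteness is recorded with the value because a difference of two
  \<open>Sum_any\<close> may be split only for finite supports.\<close>

lemma tx_mult_axis:
  assumes l: "l \<in> {1..n}"
  shows "tx_mult (axis_series h n l) (tx_of n G) s v =
    (\<Sum>d=1..nat (v l + int s). h d * tx_of n G s (\<lambda>j. v j - axis l d j))"
    and "finite {(s', v'). (if s' \<le> s then axis_series h n l s' v' * tx_of n G (s - s') (\<lambda>j. v j - v' j) else 0) \<noteq> 0}"
proof -
  let ?t = "\<lambda>(s', v'). if s' \<le> s then axis_series h n l s' v' * tx_of n G (s - s') (\<lambda>j. v j - v' j) else 0"
  let ?Z = "(\<lambda>d. (0, axis l d)) ` {1..nat (v l + int s)}"
  have sub: "{x. ?t x \<noteq> 0} \<subseteq> ?Z"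
  proof
    fix x assume x: "x \<in> {x. ?t x \<noteq> 0}"
    obtain s' v' where [simp]: "x = (s', v')" by force
    have t: "axis_series h n l s' v' \<noteq> 0" "tx_of n G (s - s') (\<lambda>j. v j - v' j) \<noteq> 0"
      using x by (auto split: if_splits)
    then have 1: "s' = 0" "v' l \<ge> 1" "v' = axis l (nat (v' l))"
      using l by (auto simp: axis_series_def split: if_splits)
    then have "0 \<le> v l - v' l + int s"
      using t(2) l unfolding tx_of_def mneg_le_iff by (auto split: if_splits)
    then have "nat (v' l) \<in> {1..nat (v l + int s)}" using 1 by auto
    then show "x \<in> ?Z" using 1 by auto
  qed
  have inj: "inj_on (\<lambda>d. (0::nat, axis l d)) {1..nat (v l + int s)}"
    by (auto simp: inj_on_def axis_def dest: fun_cong[of _ _ l])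
  have "Sum_any ?t = sum ?t ?Z" using sub by (intro Sum_any.expand_superset) auto
  also have "\<dots> = (\<Sum>d=1..nat (v l + int s). ?t (0, axis l d))"
    by (subst sum.reindex[OF inj]) auto
  also have "\<dots> = (\<Sum>d=1..nat (v l + int s). h d * tx_of n G s (\<lambda>j. v j - axis l d j))"
    using l by (intro sum.cong) (auto simp: axis_series_def axis_def)
  finally show "tx_mult (axis_series h n l) (tx_of n G) s v =
    (\<Sum>d=1..nat (v l + int s). h d * tx_of n G s (\<lambda>j. v j - axis l d j))" by (simp add: tx_mult_def)
  show "finite {(s', v'). (if s' \<le> s then axis_series h n l s' v' * tx_of n G (s - s') (\<lambda>j. v j - v' j) else 0) \<noteq> 0}"
  proof (rule finite_subset)
    show "{(s', v'). (if s' \<le> s then axis_series h n l s' v' * tx_of n G (s - s') (\<lambda>j. v j - v' j) else 0) \<noteq> 0} \<subseteq> ?Z"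
      using sub by auto
  qed simp
qed

lemma finite_tx_mult_antidiag:
  "finite {(s', v'). (if s' \<le> s then axis_series h n 0 s' v' * F (s - s') (\<lambda>j. v j - v' j) else 0) \<noteq> 0}"
  by (rule finite_subset[of _ "(\<lambda>d. (d, antidiag n d)) ` {1..s}"]) (auto simp: axis_series_def split: if_splits)

lemma tx_mult_axis_series:
  assumes "k \<le> n"
  shows "tx_mult (axis_series h n k) (tx_of n G) = tx_of n (gmul h k G)"
proof (intro ext)
  fix s v
  show "tx_mult (axis_series h n k) (tx_of n G) s v = tx_of n (gmul h k G) s v"
  proof (cases "k = 0")
    case True
    have e1: "(\<lambda>j. v j - antidiag n d j) \<in> exps n \<longleftrightarrow> v \<in> exps n" for d
      by (auto simp: exps_def antidiag_def)
    have e2: "mneg n (\<lambda>j. v j - antidiag n d j) \<le> int (s - d) \<longleftrightarrow> mneg n v \<le> int s" if "d \<le> s" for d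
      unfolding mneg_le_iff using that by (auto simp: antidiag_def of_nat_diff)
    have e3: "uexp_of n (s - d) (\<lambda>j. v j - antidiag n d j) = (uexp_of n s v)(0 := s - d)" if "d \<le> s" for d
      using that by (auto simp: uexp_of_def antidiag_def fun_eq_iff of_nat_diff)
    have "tx_of n G (s - d) (\<lambda>j. v j - antidiag n d j) =
        (if v \<in> exps n \<and> mneg n v \<le> int s then G ((uexp_of n s v)(0 := s - d)) else 0)" if "d \<le> s" for d
      unfolding tx_of_def e1 e2[OF that] e3[OF that] ..
    then show ?thesis unfolding True tx_mult_antidiag
      by (auto simp: tx_of_def gmul_def uexp_of_def intro!: sum.cong sum.neutral)
  next
    case False
    then have k: "k \<in> {1..n}" using assms by auto
    have e1: "(\<lambda>j. v j - axis k d j) \<in> exps n \<longleftrightarrow> v \<in> exps n" for d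
      using k by (auto simp: exps_def axis_def)
    have e2: "mneg n (\<lambda>j. v j - axis k d j) \<le> int s \<longleftrightarrow> mneg n v \<le> int s" if "d \<in> {1..nat (v k + int s)}" for d
      unfolding mneg_le_iff
    proof (rule ball_cong[OF refl])
      fix j
      show "(0 \<le> v j - axis k d j + int s) = (0 \<le> v j + int s)" using that by (auto simp: axis_def)
    qed
    have e3: "uexp_of n s (\<lambda>j. v j - axis k d j) = (uexp_of n s v)(k := nat (v k + int s) - d)" for d
      using k by (auto simp: uexp_of_def axis_def fun_eq_iff)
    have "tx_of n G s (\<lambda>j. v j - axis k d j) =
        (if v \<in> exps n \<and> mneg n v \<le> int s then G ((uexp_of n s v)(k := nat (v k + int s) - d)) else 0)"
      if "d \<in> {1..nat (v k + int s)}" for d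
      using that by (simp add: tx_of_def e1 e2 e3)
    moreover have "uexp_of n s v k = nat (v k + int s)" using k by (simp add: uexp_of_def)
    ultimately show ?thesis unfolding tx_mult_axis(1)[OF k]
      by (auto simp: tx_of_def gmul_def intro!: sum.cong sum.neutral)
  qed
qed

text \<open>Since \<open>x_0 = t / (x_1 ... x_n)\<close>, the exponent of \<open>t\<close> is that
  of \<open>x_0\<close>, and the exponent of \<open>x_l\<close> in the old variables is the
  difference of the new exponents of \<open>x_l\<close> and \<open>x_0\<close>.\<close>

lemma theta_tx_of:
  "theta_t (tx_of n G) = tx_of n (\<lambda>u. of_nat (u 0) * G u)"
  "l \<in> {1..n} \<Longrightarrow> theta_x l (tx_of n G) = tx_of n (\<lambda>u. of_nat (u l) * G u - of_nat (u 0) * G u)"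
proof -
  show "theta_t (tx_of n G) = tx_of n (\<lambda>u. of_nat (u 0) * G u)"
    by (simp add: theta_t_def tx_of_def uexp_of_def fun_eq_iff)
  assume l: "l \<in> {1..n}"
  have "of_int (v l) = (of_nat (nat (v l + int s)) - of_nat s :: 'a)" if "mneg n v \<le> int s" for v s
  proof -
    have "int (nat (v l + int s)) = v l + int s" using that l unfolding mneg_le_iff by simp
    then have "(of_nat (nat (v l + int s)) :: 'a) = of_int (v l) + of_nat s"
      by (metis of_int_add of_int_of_nat_eq)
    then show ?thesis by simp
  qed
  then show "theta_x l (tx_of n G) = tx_of n (\<lambda>u. of_nat (u l) * G u - of_nat (u 0) * G u)"
    using l by (auto simp: theta_x_def tx_of_def uexp_of_def fun_eq_iff left_diff_distrib)
qed

lemma subst_pow_f_series: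
  assumes "P \<ge> 1"
  shows "subst_pow P (f_series n) s v =
    (if s = 0 \<and> (\<exists>j\<in>{1..n}. v = axis j P) \<or> s = P \<and> v = antidiag n P then 1 else 0)"
proof (cases "P dvd s \<and> (\<forall>j. int P dvd v j)")
  case True
  have 1: "s div P = 0 \<longleftrightarrow> s = 0" "s div P = 1 \<longleftrightarrow> s = P" using True assms by (auto elim!: dvdE)
  have vd: "v j = int P * (v j div int P)" for j using True by simp
  have 2: "(\<lambda>j. v j div int P) = (\<lambda>k. if k = j then 1 else 0) \<longleftrightarrow> v = axis j P" for j
  proof
    assume a: "(\<lambda>j. v j div int P) = (\<lambda>k. if k = j then 1 else 0)"
    show "v = axis j P"
    proof
      fix k show "v k = axis j P k" using vd[of k] fun_cong[OF a, of k] by (simp add: axis_def split: if_splits)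
    qed
  qed (use assms in \<open>auto simp: axis_def\<close>)
  have 3: "(\<lambda>j. v j div int P) = (\<lambda>k. if k \<in> {1..n} then - 1 else 0) \<longleftrightarrow> v = antidiag n P"
  proof
    assume a: "(\<lambda>j. v j div int P) = (\<lambda>k. if k \<in> {1..n} then - 1 else 0)"
    show "v = antidiag n P"
    proof
      fix k show "v k = antidiag n P k" using vd[of k] fun_cong[OF a, of k] by (simp add: antidiag_def split: if_splits)
    qed
  qed (use assms in \<open>auto simp: antidiag_def fun_eq_iff zdiv_zminus1_eq_if\<close>)
  show ?thesis using True by (simp only: subst_pow_def f_series_def if_True 1 2 3) auto
next
  case False
  then have "\<not> (s = 0 \<and> (\<exists>j\<in>{1..n}. v = axis j P) \<or> s = P \<and> v = antidiag n P)"
  proof -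
    have "int P dvd axis j P k" "int P dvd antidiag n P k" for j k
      by (simp_all add: axis_def antidiag_def)
    then show ?thesis using False by auto
  qed
  then show ?thesis using False by (simp only: subst_pow_def if_False)
qed

section \<open>The operators attached to \<open>H\<close>\<close>

locale kloosterman = complete_coefficients p ord \<Omega>
  for p :: nat and ord :: "'k::field_char_0 \<Rightarrow> ereal" and \<Omega> :: "'k set" +
  fixes n :: nat and \<gamma> :: 'k and b :: real
  assumes is_\<gamma>: "is_gamma p ord \<gamma>" and \<gamma>_mem: "\<gamma> \<in> \<Omega>" and n_pos: "n \<ge> 1"
    and b_gt: "1 / (real p - 1) < b" and b_le: "b \<le> real p / (real p - 1)"
begin

text \<open>The coefficients of \<open>x dH/dx\<close> for the one-variable series with terms
  \<open>\<gamma>_i x^(p^i)\<close>; at most one \<open>i\<close> contributes to a given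
  degree.\<close>

definition hcoeff :: "nat \<Rightarrow> 'k" where
  "hcoeff d = of_nat d * Sum_any (\<lambda>i. if d = p ^ i then gamma_sum p \<gamma> i else 0)"

abbreviation e :: real where "e \<equiv> 1 / (real p - 1)"
abbreviation c :: real where "c \<equiv> b - e"

lemma p_gt_1: "p > 1"
  using prime_gt_1_nat[OF prime_p] .

lemma e_plus_1: "e + 1 = real p * e"
  using p_gt_1 by (simp add: field_simps)

lemma Sum_any_power: "Sum_any (\<lambda>i. if p ^ j = p ^ i then g i else 0) = (g j :: 'k)"
proof -
  have eq: "(\<lambda>i. if p ^ j = p ^ i then g i else 0) = (\<lambda>i. if j = i then g i else 0)"
    using p_gt_1 by (simp add: fun_eq_iff)
  have "Sum_any (\<lambda>i. if j = i then g i else 0) = (\<Sum>i\<in>{j}. if j = i then g i else 0)"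
    by (rule Sum_any.expand_superset) auto
  then show ?thesis unfolding eq by simp
qed

lemma hcoeff_power: "hcoeff (p ^ i) = of_nat (p ^ i) * gamma_sum p \<gamma> i"
  unfolding hcoeff_def Sum_any_power ..

lemma hcoeff_not_power: "(\<And>i. d \<noteq> p ^ i) \<Longrightarrow> hcoeff d = 0"
  by (simp add: hcoeff_def)

text \<open>At \<open>d = p^i\<close> the factor \<open>d\<close> restores \<open>i\<close> of the
  loss \<open>i + 1\<close> in the bound for \<gamma>_i, which leaves
  \<open>(e + 1) d - 1\<close>.\<close>

lemma ordge_hcoeff:
  assumes "d \<ge> 1"
  shows "ordge ((e + 1) * (real d - 1) + e) (hcoeff d)"
proof (cases "\<exists>i. d = p ^ i")
  case True
  then obtain i where d: "d = p ^ i" by blast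
  have "ord (of_nat (p ^ i)) = ereal (real i)"
    using ord_power[of "of_nat p" 1 i] ord_p by (simp add: one_ereal_def)
  then have "ordge (real i) (of_nat (p ^ i))" by (simp add: ordge_def)
  from ordge_mult[OF this ordge_gamma_sum[OF is_\<gamma>, of i]]
  have "ordge (real i + (real p ^ (i + 1) / (real p - 1) - real (i + 1))) (hcoeff d)"
    by (simp only: d hcoeff_power)
  moreover have "(e + 1) * (real d - 1) + e = real i + (real p ^ (i + 1) / (real p - 1) - real (i + 1))"
  proof -
    have "(e + 1) * (real d - 1) + e = (e + 1) * real d - 1" by (simp only: right_diff_distrib) simp
    also have "\<dots> = real p * e * real p ^ i - 1" unfolding e_plus_1 d by simp
    also have "\<dots> = real p ^ (i + 1) / (real p - 1) - 1" by simp
    finally show ?thesis by simp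
  qed
  ultimately show ?thesis by simp
next
  case False
  then show ?thesis using hcoeff_not_power[of d] by auto
qed

lemma gamma_sum_in: "gamma_sum p \<gamma> i \<in> \<Omega>"
  unfolding gamma_sum_def using \<gamma>_mem by auto

lemma hcoeff_in: "hcoeff d \<in> \<Omega>"
proof (cases "\<exists>i. d = p ^ i")
  case True
  then show ?thesis using gamma_sum_in by (auto simp only: hcoeff_power \<Omega>_closed(4) \<Omega>_of_nat)
next
  case False
  then show ?thesis using hcoeff_not_power[of d] by auto
qed

sublocale dwork_operators p ord \<Omega> n \<gamma> hcoeff e
proof
  show "ord \<gamma> = ereal e" using is_\<gamma> by (simp add: is_gamma_def)
  show "e > 0" using p_gt_1 by simp
  show "hcoeff 1 = \<gamma>" using hcoeff_power[of 0] by (simp add: gamma_sum_def)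
qed (use \<gamma>_mem hcoeff_in ordge_hcoeff in auto)

lemma H_series_eq:
  "H_series p \<gamma> n s v = Sum_any (\<lambda>i. if s = 0 \<and> (\<exists>j\<in>{1..n}. v = axis j (p ^ i)) \<or> s = p ^ i \<and> v = antidiag n (p ^ i)
     then gamma_sum p \<gamma> i else 0)"
proof -
  have "p ^ i \<ge> 1" for i using p_gt_1 by simp
  then show ?thesis unfolding H_series_def by (simp add: subst_pow_f_series if_distrib cong: if_cong)
qed

lemma axis_eq_iff: "d \<ge> 1 \<Longrightarrow> axis j d = axis j' d' \<longleftrightarrow> j = j' \<and> d = d'"
  by (auto simp: axis_def fun_eq_iff split: if_splits)

lemma antidiag_eq_iff: "antidiag n d = antidiag n d' \<longleftrightarrow> d = d'"
  using n_pos by (auto simp: antidiag_def fun_eq_iff)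

lemma H_axis:
  assumes "j \<in> {1..n}" "d \<ge> 1"
  shows "of_nat d * H_series p \<gamma> n 0 (axis j d) = hcoeff d"
proof -
  have "(\<exists>j'\<in>{1..n}. axis j d = axis j' (p ^ i)) \<longleftrightarrow> d = p ^ i" for i
    using assms by (auto simp: axis_eq_iff)
  moreover have "p \<noteq> 0" using p_gt_1 by simp
  ultimately show ?thesis unfolding H_series_eq hcoeff_def by (simp cong: if_cong)
qed

lemma H_antidiag:
  assumes "s \<ge> 1"
  shows "of_nat s * H_series p \<gamma> n s (antidiag n s) = hcoeff s"
  unfolding H_series_eq hcoeff_def using assms by (simp add: antidiag_eq_iff cong: if_cong)

lemma H_eq_0:
  assumes "\<not> (s = 0 \<and> (\<exists>j\<in>{1..n}. \<exists>d\<ge>1. v = axis j d))" "\<not> (s \<ge> 1 \<and> v = antidiag n s)"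
  shows "H_series p \<gamma> n s v = 0"
proof -
  have "p ^ i \<ge> 1" for i using p_gt_1 by simp
  then have none: "\<not> (s = 0 \<and> (\<exists>j\<in>{1..n}. v = axis j (p ^ i)) \<or> s = p ^ i \<and> v = antidiag n (p ^ i))" for i
    using assms by metis
  show ?thesis by (simp only: H_series_eq none if_False) simp
qed

lemma theta_t_H: "theta_t (H_series p \<gamma> n) = axis_series hcoeff n 0"
proof (intro ext)
  fix s v
  show "theta_t (H_series p \<gamma> n) s v = axis_series hcoeff n 0 s v"
    using H_antidiag[of s] H_eq_0[of s v] by (cases "s = 0") (auto simp: theta_t_def axis_series_def)
qed

lemma theta_x_H:
  assumes l: "l \<in> {1..n}"
  shows "theta_x l (H_series p \<gamma> n) s v = axis_series hcoeff n l s v - axis_series hcoeff n 0 s v"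
proof -
  have l0: "l \<noteq> 0" using l by auto
  consider (axis) j d where "s = 0" "j \<in> {1..n}" "d \<ge> 1" "v = axis j d" | (anti) "s \<ge> 1" "v = antidiag n s"
    | (zero) "\<not> (s = 0 \<and> (\<exists>j\<in>{1..n}. \<exists>d\<ge>1. v = axis j d))" "\<not> (s \<ge> 1 \<and> v = antidiag n s)"
    by blast
  then show ?thesis
  proof cases
    case axis
    show ?thesis
    proof (cases "j = l")
      case True
      have "v l = int d" using axis True by (simp add: axis_def)
      then show ?thesis using axis H_axis[OF axis(2,3)] l0 True
        by (simp add: theta_x_def axis_series_def)
    next
      case False
      have "v l = 0" using axis False by (simp add: axis_def)
      then show ?thesis using axis l0 by (simp add: theta_x_def axis_series_def)
    qed
  next
    case anti
    have "v l = - int s" using anti l by (simp add: antidiag_def)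
    then show ?thesis using anti H_antidiag[OF anti(1)] l0 by (simp add: theta_x_def axis_series_def)
  next
    case zero
    have "axis_series hcoeff n l s v = 0"
    proof -
      have "\<not> (s = 0 \<and> v l \<ge> 1 \<and> v = axis l (nat (v l)))" using zero(1) l by (auto dest!: bspec[of _ _ l])
      then show ?thesis using l0 by (simp only: axis_series_def if_False)
    qed
    moreover have "axis_series hcoeff n 0 s v = 0" using zero(2) by (auto simp: axis_series_def)
    ultimately show ?thesis using H_eq_0[OF zero] by (simp add: theta_x_def)
  qed
qed

lemma Dt_op_tx_of: "Dt_op p \<gamma> n (tx_of n G) = tx_of n (nabla hcoeff 0 G)"
  unfolding Dt_op_def theta_t_H tx_mult_axis_series[OF le0] theta_tx_of nabla_def tx_of_add ..

lemma D_op_tx_of: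
  assumes l: "l \<in> {1..n}"
  shows "D_op p \<gamma> n l (tx_of n G) = tx_of n (Dop hcoeff l G)"
proof -
  let ?t = "\<lambda>k s v (s', v'). if s' \<le> s then axis_series hcoeff n k s' v' * tx_of n G (s - s') (\<lambda>j. v j - v' j) else 0"
  have "tx_mult (theta_x l (H_series p \<gamma> n)) (tx_of n G) s v =
      tx_mult (axis_series hcoeff n l) (tx_of n G) s v - tx_mult (axis_series hcoeff n 0) (tx_of n G) s v" for s v
  proof -
    have fin: "finite {x. ?t l s v x \<noteq> 0}" "finite {x. ?t 0 s v x \<noteq> 0}"
      using tx_mult_axis(2)[OF l, of s hcoeff G v] finite_tx_mult_antidiag[of s hcoeff n "tx_of n G" v]
      by (simp_all add: case_prod_unfold)
    let ?Z = "{x. ?t l s v x \<noteq> 0} \<union> {x. ?t 0 s v x \<noteq> 0}"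
    have diff: "(\<lambda>(s', v'). if s' \<le> s then theta_x l (H_series p \<gamma> n) s' v' * tx_of n G (s - s') (\<lambda>j. v j - v' j) else 0)
        = (\<lambda>x. ?t l s v x - ?t 0 s v x)"
      by (auto simp: fun_eq_iff theta_x_H[OF l] left_diff_distrib)
    have "Sum_any (\<lambda>x. ?t l s v x - ?t 0 s v x) = (\<Sum>x\<in>?Z. ?t l s v x - ?t 0 s v x)"
      using fin by (intro Sum_any.expand_superset) auto
    also have "\<dots> = (\<Sum>x\<in>?Z. ?t l s v x) - (\<Sum>x\<in>?Z. ?t 0 s v x)" by (rule sum_subtractf)
    also have "(\<Sum>x\<in>?Z. ?t l s v x) = Sum_any (?t l s v)"
      using fin by (intro Sum_any.expand_superset[symmetric]) auto
    also have "(\<Sum>x\<in>?Z. ?t 0 s v x) = Sum_any (?t 0 s v)"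
      using fin by (intro Sum_any.expand_superset[symmetric]) auto
    finally show ?thesis unfolding tx_mult_def diff .
  qed
  moreover have "l \<le> n" using l by simp
  ultimately show ?thesis
    by (simp add: D_op_def theta_tx_of(2)[OF l] tx_mult_axis_series Dop_def nabla_def tx_of_add tx_of_diff fun_eq_iff)
qed

lemma real_udeg_uexp_of:
  assumes "s = r + nat (mneg n v)"
  shows "real (udeg n (uexp_of n s v)) = (real n + 1) * real r + real_of_int (wtZ n v)"
proof -
  have s: "int s = int r + mneg n v" using assms mneg_nonneg[of n v] by simp
  then have "int (udeg n (uexp_of n s v)) = (int n + 1) * int r + wtZ n v"
    using udeg_uexp_of[of n v s] by (simp add: wtZ_def distrib_left)
  then have "real_of_int (int (udeg n (uexp_of n s v))) = real_of_int ((int n + 1) * int r + wtZ n v)"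
    by (simp only:)
  then show ?thesis by simp
qed

section \<open>The space K(b,b) and the images of the \<open>D_l\<close>\<close>

lemma K_space_tx_of:
  assumes "supp_in (uexps n) G" "G \<in> level (\<lambda>D. b * real D + \<rho>)"
  shows "tx_of n G \<in> K_space ord \<Omega> n b"
  unfolding K_space_def mem_Collect_eq
proof (intro conjI exI[of _ \<rho>] allI ballI impI)
  show "tx_of n G s v = 0" if "v \<notin> exps n \<or> int s < mneg n v" for s v
    using that by (auto simp: tx_of_def)
  fix r :: nat and v :: "nat \<Rightarrow> int" assume v: "v \<in> exps n"
  define s where "s = r + nat (mneg n v)"
  have "mneg n v \<le> int s" using mneg_nonneg[of n v] by (simp add: s_def)
  then have eq: "tx_of n G s v = G (uexp_of n s v)" using v by (simp add: tx_of_def)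
  have "b * (real n + 1) * real r + b * real_of_int (wtZ n v) + \<rho> = b * real (udeg n (uexp_of n s v)) + \<rho>"
    unfolding real_udeg_uexp_of[OF s_def] by (simp add: algebra_simps)
  then show "tx_of n G (r + nat (mneg n v)) v \<in> \<Omega>"
    "ereal (b * (real n + 1) * real r + b * real_of_int (wtZ n v) + \<rho>) \<le> ord (tx_of n G (r + nat (mneg n v)) v)"
    using assms(2) eq unfolding s_def[symmetric] by (auto simp: level_def ordge_def)
qed

lemma K_spaceE:
  assumes F: "F \<in> K_space ord \<Omega> n b"
  obtains G \<rho> where "F = tx_of n G" "supp_in (uexps n) G" "G \<in> level (\<lambda>D. b * real D + \<rho>)"
proof -
  obtain \<rho> where \<rho>: "\<And>r v. v \<in> exps n \<Longrightarrow> F (r + nat (mneg n v)) v \<in> \<Omega> \<and>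
      ereal (b * (real n + 1) * real r + b * real_of_int (wtZ n v) + \<rho>) \<le> ord (F (r + nat (mneg n v)) v)"
    and z: "\<And>s v. v \<notin> exps n \<or> int s < mneg n v \<Longrightarrow> F s v = 0"
    using F unfolding K_space_def by blast
  define G where "G u = (if u \<in> uexps n then F (u 0) (vexp_of n u) else 0)" for u
  have "F = tx_of n G"
  proof (intro ext)
    fix s v
    show "F s v = tx_of n G s v"
      using z[of v s] vexp_of_uexp_of[of v n s]
      by (cases "v \<in> exps n \<and> mneg n v \<le> int s") (auto simp: tx_of_def G_def uexp_of_in, simp add: uexp_of_def)
  qed
  moreover have "supp_in (uexps n) G" by (simp add: supp_in_def G_def)
  moreover have "G \<in> level (\<lambda>D. b * real D + \<rho>)"
  proof (rule levelI)
    fix u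
    have "G u \<in> \<Omega> \<and> ordge (b * real (udeg n u) + \<rho>) (G u)"
    proof (cases "u \<in> uexps n")
      case True
      define v where "v = vexp_of n u"
      define r where "r = u 0 - nat (mneg n v)"
      have s: "u 0 = r + nat (mneg n v)" using mneg_vexp_of[of n u] by (simp add: r_def v_def)
      have "real (udeg n u) = (real n + 1) * real r + real_of_int (wtZ n v)"
        using real_udeg_uexp_of[OF s] uexp_of_vexp_of[OF True] by (simp add: v_def)
      then have "b * real (udeg n u) + \<rho> = b * (real n + 1) * real r + b * real_of_int (wtZ n v) + \<rho>"
        by (simp add: algebra_simps)
      then show ?thesis using \<rho>[of v r] True s vexp_of_in unfolding G_def v_def ordge_def by simp
    qed (simp add: G_def)
    then show "G u \<in> \<Omega>" "ordge (b * real (udeg n u) + \<rho>) (G u)" by auto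
  qed
  ultimately show ?thesis using that by blast
qed

lemma DK_space_tx_of:
  assumes "\<And>l. l \<in> {1..n} \<Longrightarrow> supp_in (uexps n) (G l) \<and> (\<exists>\<rho>. G l \<in> level (\<lambda>D. b * real D + \<rho>))"
  shows "tx_of n (\<lambda>u. \<Sum>l=1..n. Dop hcoeff l (G l) u) \<in> DK_space p ord \<Omega> \<gamma> n b"
proof -
  have "tx_of n (\<lambda>u. \<Sum>l=1..n. Dop hcoeff l (G l) u) = (\<lambda>s v. \<Sum>l=1..n. D_op p \<gamma> n l (tx_of n (G l)) s v)"
    unfolding tx_of_sum by (intro ext sum.cong) (auto simp: D_op_tx_of)
  moreover have "\<forall>l\<in>{1..n}. tx_of n (G l) \<in> K_space ord \<Omega> n b"
    using assms K_space_tx_of by blast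
  ultimately show ?thesis unfolding DK_space_def
    by (intro CollectI exI[of _ "\<lambda>l. tx_of n (G l)"]) auto
qed

lemma DK_spaceE:
  assumes "F \<in> DK_space p ord \<Omega> \<gamma> n b"
  obtains G where "F = tx_of n (\<lambda>u. \<Sum>l=1..n. Dop hcoeff l (G l) u)"
    "\<And>l. l \<in> {1..n} \<Longrightarrow> supp_in (uexps n) (G l) \<and> (\<exists>\<rho>. G l \<in> level (\<lambda>D. b * real D + \<rho>))"
proof -
  obtain G where G: "F = (\<lambda>s v. \<Sum>l=1..n. D_op p \<gamma> n l (G l) s v)" "\<And>l. l \<in> {1..n} \<Longrightarrow> G l \<in> K_space ord \<Omega> n b"
    using assms unfolding DK_space_def by blast
  have "\<exists>g. G l = tx_of n g \<and> supp_in (uexps n) g \<and> (\<exists>\<rho>. g \<in> level (\<lambda>D. b * real D + \<rho>))"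
    if "l \<in> {1..n}" for l
    using K_spaceE[OF G(2)[OF that]] by metis
  then obtain g where g: "\<And>l. l \<in> {1..n} \<Longrightarrow> G l = tx_of n (g l)"
    "\<And>l. l \<in> {1..n} \<Longrightarrow> supp_in (uexps n) (g l) \<and> (\<exists>\<rho>. g l \<in> level (\<lambda>D. b * real D + \<rho>))" by metis
  have "F = tx_of n (\<lambda>u. \<Sum>l=1..n. Dop hcoeff l (g l) u)"
    unfolding tx_of_sum G(1) by (intro ext sum.cong) (auto simp: D_op_tx_of g(1))
  then show ?thesis using that g(2) by blast
qed

section \<open>Coordinates in the quotient\<close>

lemma ones_in_exps: "m \<le> n \<Longrightarrow> ones m \<in> exps n"
  by (auto simp: ones_def exps_def)

lemma mneg_ones: "mneg n (ones m) \<le> int s"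
  unfolding mneg_le_iff by (simp add: ones_def)

lemma stair_ones:
  assumes "m \<le> n"
  shows "stair n ((n + 1) * s + m) = uexp_of n s (ones m)"
proof -
  have "((n + 1) * s + m) div (n + 1) = s" "((n + 1) * s + m) mod (n + 1) = m"
    using assms by (simp_all add: div_mult_self4 del: mult_Suc)
  then show ?thesis by (auto simp: stair_def uexp_of_def ones_def fun_eq_iff nat_add_distrib)
qed

lemma ones_inject: "m \<le> n \<Longrightarrow> m' \<le> n \<Longrightarrow> ones m = ones m' \<Longrightarrow> m = m'"
proof (rule ccontr)
  assume eq: "ones m = ones m'" and ne: "m \<noteq> m'"
  have "ones m (max m m') \<noteq> ones m' (max m m')"
    using ne by (auto simp: ones_def max_def)
  then show False using eq by simp
qed

text \<open>Division of the degree by \<open>n + 1\<close> matches staircase monomials with the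
  pairs \<open>(s, m)\<close> of \<open>t^s e_m\<close>; the factor \<gamma>^m is part of
  \<open>e_m\<close>.\<close>

lemma basis_combination:
  assumes "\<And>m s. m \<le> n \<Longrightarrow> a ((n + 1) * s + m) = g m s * \<gamma> ^ m"
  shows "(\<lambda>s v. \<Sum>m\<le>n. t_mult (g m) (basis_e \<gamma> m) s v) = tx_of n (lift_stair n a)"
proof (intro ext)
  fix s v
  have basis: "basis_e \<gamma> m s v = (if s = 0 \<and> v = ones m then \<gamma> ^ m else 0)" for m s v
    by (simp add: basis_e_def ones_def)
  have tm: "t_mult (g m) (basis_e \<gamma> m) s v = (if v = ones m then g m s * \<gamma> ^ m else 0)" for m
  proof -
    have "t_mult (g m) (basis_e \<gamma> m) s v = (\<Sum>r\<le>s. if r = s then (if v = ones m then g m s * \<gamma> ^ m else 0) else 0)"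
      unfolding t_mult_def basis by (intro sum.cong) auto
    then show ?thesis by simp
  qed
  show "(\<Sum>m\<le>n. t_mult (g m) (basis_e \<gamma> m) s v) = tx_of n (lift_stair n a) s v"
  proof (cases "\<exists>m\<le>n. v = ones m")
    case True
    then obtain m where m: "m \<le> n" "v = ones m" by blast
    have "(\<Sum>m\<le>n. t_mult (g m) (basis_e \<gamma> m) s v) = (\<Sum>k\<le>n. if k = m then g m s * \<gamma> ^ m else 0)"
      unfolding tm using m ones_inject by (intro sum.cong) auto
    also have "\<dots> = a ((n + 1) * s + m)" using m assms by simp
    also have "\<dots> = lift_stair n a (uexp_of n s v)"
      unfolding m(2) stair_ones[OF m(1), symmetric] lift_stair_def udeg_stair by simp
    also have "\<dots> = tx_of n (lift_stair n a) s v"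
      using m ones_in_exps mneg_ones by (simp add: tx_of_def)
    finally show ?thesis .
  next
    case False
    have "tx_of n (lift_stair n a) s v = 0"
    proof (rule ccontr)
      assume "tx_of n (lift_stair n a) s v \<noteq> 0"
      then have v: "v \<in> exps n" "mneg n v \<le> int s" and l: "lift_stair n a (uexp_of n s v) \<noteq> 0"
        by (auto simp: tx_of_def split: if_splits)
      define D where "D = udeg n (uexp_of n s v)"
      have st: "uexp_of n s v = stair n D" using l unfolding D_def lift_stair_def by metis
      define m where "m = D mod (n + 1)"
      have m: "m \<le> n" by (simp add: m_def less_Suc_eq_le[symmetric])
      have "D div (n + 1) = s" using fun_cong[OF st, of 0] by (simp add: uexp_of_def stair_def)
      then have "D = (n + 1) * s + m" using div_mult_mod_eq[of D "n + 1"] by (simp add: m_def mult.commute)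
      then have "uexp_of n s v = uexp_of n s (ones m)" using st stair_ones[OF m] by simp
      then have "v = ones m" using vexp_of_uexp_of[OF v] vexp_of_uexp_of[OF ones_in_exps[OF m] mneg_ones] by metis
      then show False using False m by blast
    qed
    moreover have "(\<Sum>m\<le>n. t_mult (g m) (basis_e \<gamma> m) s v) = 0"
      unfolding tm using False by (intro sum.neutral) auto
    ultimately show ?thesis by simp
  qed
qed

text \<open>The slope \<open>b\<close> may equal the upper limit \<open>e + 1\<close>, where nothing
  is gained. A slope \<open>e + \<epsilon>\<close> leaves room on both sides:
  \<open>\<epsilon> \<le> 1 / 2\<close> for the upper limit and
  \<open>\<epsilon> \<le> c / 2\<close> to stay below \<open>b\<close>.\<close>

lemma exists_strict_slope: "\<exists>b' \<epsilon>. b' \<le> b \<and> \<epsilon> > 0 \<and> slope \<epsilon> (\<lambda>D. b' * real D)"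
proof -
  define \<epsilon> where "\<epsilon> = min (c / 2) (1 / 2)"
  define b' where "b' = e + \<epsilon>"
  have "c > 0" using b_gt by simp
  then have "\<epsilon> > 0" by (simp add: \<epsilon>_def)
  have "\<epsilon> \<le> c / 2" "\<epsilon> \<le> 1 / 2" by (simp_all only: \<epsilon>_def min.cobounded1 min.cobounded2)
  moreover have "y \<le> (b - x) / 2 \<Longrightarrow> b - x > 0 \<Longrightarrow> x + y \<le> b" for x y by (simp add: field_simps)
  ultimately have "b' \<le> b" using \<open>c > 0\<close> unfolding b'_def by blast
  have "b' = e + \<epsilon>" by (simp add: b'_def)
  then have "slope \<epsilon> (\<lambda>D. b' * real D)"
    unfolding slope_def using \<open>\<epsilon> \<le> 1 / 2\<close> by (simp add: distrib_left)
  with \<open>\<epsilon> > 0\<close> \<open>b' \<le> b\<close> show ?thesis by blast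
qed

text \<open>Lowering the slope from \<open>b\<close> to \<open>b'\<close> weakens every bound, so
  the given relation is also one for \<open>b'\<close>, where \<open>stair_unique\<close>
  applies.\<close>

lemma lift_stair_in_DK_imp_0:
  assumes a: "\<And>D. a D \<in> \<Omega>" "\<And>D. ordge (b * real D + \<tau>) (a D)"
    and DK: "tx_of n (lift_stair n a) = tx_of n (\<lambda>u. \<Sum>l=1..n. Dop hcoeff l (G l) u)"
    and G: "\<And>l. l \<in> {1..n} \<Longrightarrow> supp_in (uexps n) (G l) \<and> (\<exists>\<rho>. G l \<in> level (\<lambda>D. b * real D + \<rho>))"
  shows "a D = 0"
proof -
  obtain b' \<epsilon> where b': "b' \<le> b" "\<epsilon> > 0" "slope \<epsilon> (\<lambda>D. b' * real D)" using exists_strict_slope by blast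
  have bb: "b' * real D \<le> b * real D" for D using b'(1) by (simp add: mult_right_mono)
  show ?thesis
  proof (rule stair_unique[OF b'(3,2), where \<tau> = \<tau> and G = "\<lambda>l u. - 1 * G l u"])
    show "a D \<in> \<Omega>" for D by (rule a(1))
    show "ordge (b' * real D + \<tau>) (a D)" for D using a(2) bb ordge_mono by (meson add_right_mono)
    show "(\<lambda>u. - 1 * G l u) \<in> bounded_series (\<lambda>D. b' * real D) 0" if l: "l \<in> {1..n}" for l
    proof -
      obtain \<rho> where \<rho>: "G l \<in> level (\<lambda>D. b * real D + \<rho>)" and s: "supp_in (uexps n) (G l)"
        using G[OF l] by blast
      have "G l \<in> level (\<lambda>D. b' * real (Suc D) - e + (\<rho> - b' + e))"
        using bb by (intro level_mono[OF \<rho>]) (simp add: algebra_simps)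
      then have "(\<lambda>u. - 1 * G l u) \<in> level (\<lambda>D. b' * real (Suc D) - e + (\<rho> - b' + e))"
        using level_uminus by simp
      moreover have "{1..0::nat} = {}" by simp
      ultimately show ?thesis using s unfolding bounded_series_def
        by (auto simp only: mem_Collect_eq zexps_empty intro!: supp_in_cmult)
    qed
    show "lift_stair n a u + (\<Sum>l=1..n. Dop hcoeff l (\<lambda>u. - 1 * G l u) u) = 0" for u
    proof (cases "u \<in> uexps n")
      case True
      then show ?thesis using tx_of_inject[OF DK True] unfolding Dop_cmult by (simp add: sum_negf)
    next
      case False
      have "supp_in (uexps n) (Dop hcoeff l (\<lambda>u. - 1 * G l u))" if "l \<in> {1..n}" for l
        using G that by (intro supp_uexps_closed supp_in_cmult) auto
      moreover have "supp_in (uexps n) (lift_stair n a)"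
        using supp_lift_stair range_stair_subset supp_in_mono by blast
      ultimately show ?thesis using False by (simp add: supp_in_def)
    qed
  qed
qed

text \<open>Evaluating the definite description needs existence and uniqueness. For the latter, a
  second choice of coordinates gives a second staircase series, and the difference of the two lies
  in the image of the \<open>D_l\<close>.\<close>

lemma coords_eq:
  assumes F: "F = tx_of n (\<lambda>u. lift_stair n a u + (\<Sum>l=1..n. Dop hcoeff l (G l) u))"
    and a: "\<And>D. a D \<in> \<Omega>" "\<And>D. ordge (b * real D + \<tau>) (a D)"
    and G: "\<And>l. l \<in> {1..n} \<Longrightarrow> supp_in (uexps n) (G l) \<and> (\<exists>\<rho>. G l \<in> level (\<lambda>D. b * real D + \<rho>))"
  shows "coords p ord \<Omega> \<gamma> n b F = (\<lambda>m s. if m \<le> n then a ((n + 1) * s + m) * inverse (\<gamma> ^ m) else 0)"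
  unfolding coords_def
proof (rule the_equality)
  let ?g = "\<lambda>m s. if m \<le> n then a ((n + 1) * s + m) * inverse (\<gamma> ^ m) else 0"
  have e_nn: "e > 0" using p_gt_1 by simp
  have inv: "ordge (- (real m * e)) (inverse (\<gamma> ^ m))" for m
    using ord_inverse[of "\<gamma> ^ m"] ord_power[OF ord_\<gamma>, of m] \<gamma>_nz by (simp add: ordge_def)
  have pw: "ordge (real m * e) (\<gamma> ^ m)" for m
    using ord_power[OF ord_\<gamma>, of m] by (simp add: ordge_def)
  show "(\<forall>m\<le>n. ?g m \<in> L_space ord \<Omega> n b) \<and> (\<forall>m>n. ?g m = (\<lambda>_. 0)) \<and>
     (\<lambda>s v. F s v - (\<Sum>m\<le>n. t_mult (?g m) (basis_e \<gamma> m) s v)) \<in> DK_space p ord \<Omega> \<gamma> n b"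
  proof (intro conjI allI impI)
    fix m assume m: "m \<le> n"
    have "?g m s \<in> \<Omega> \<and> ordge (b * (real n + 1) * real s + (b * real m + \<tau> - real m * e)) (?g m s)" for s
    proof
      show "?g m s \<in> \<Omega>" using a(1) \<gamma>_mem by simp
      have key: "b * (real n + 1) * real s + (b * real m + \<tau> - real m * e) =
          (b * real ((n + 1) * s + m) + \<tau>) + - (real m * e)" by (simp add: algebra_simps)
      show "ordge (b * (real n + 1) * real s + (b * real m + \<tau> - real m * e)) (?g m s)"
        unfolding key if_P[OF m] by (rule ordge_mult[OF a(2) inv])
    qed
    then show "?g m \<in> L_space ord \<Omega> n b" unfolding L_space_def ordge_def by blast
  next
    have "(\<lambda>s v. \<Sum>m\<le>n. t_mult (?g m) (basis_e \<gamma> m) s v) = tx_of n (lift_stair n a)"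
      using \<gamma>_nz by (intro basis_combination) simp
    then have "(\<lambda>s v. F s v - (\<Sum>m\<le>n. t_mult (?g m) (basis_e \<gamma> m) s v)) =
        tx_of n (\<lambda>u. \<Sum>l=1..n. Dop hcoeff l (G l) u)"
      unfolding F by (simp add: tx_of_add fun_eq_iff)
    then show "(\<lambda>s v. F s v - (\<Sum>m\<le>n. t_mult (?g m) (basis_e \<gamma> m) s v)) \<in> DK_space p ord \<Omega> \<gamma> n b"
      using DK_space_tx_of[OF G] by simp
  qed simp
  fix g assume g: "(\<forall>m\<le>n. g m \<in> L_space ord \<Omega> n b) \<and> (\<forall>m>n. g m = (\<lambda>_. 0)) \<and>
     (\<lambda>s v. F s v - (\<Sum>m\<le>n. t_mult (g m) (basis_e \<gamma> m) s v)) \<in> DK_space p ord \<Omega> \<gamma> n b"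
  \<comment> \<open>The competing coordinates, reassembled into one sequence indexed by the degree
    \<open>(n + 1) s + m\<close>.\<close>
  define a' where "a' D = g (D mod (n + 1)) (D div (n + 1)) * \<gamma> ^ (D mod (n + 1))" for D
  have a': "a' ((n + 1) * s + m) = g m s * \<gamma> ^ m" if "m \<le> n" for m s
  proof -
    have "((n + 1) * s + m) div (n + 1) = s" "((n + 1) * s + m) mod (n + 1) = m"
      using that by (simp_all add: div_mult_self4 del: mult_Suc)
    then show ?thesis unfolding a'_def by (simp only:)
  qed
  have DK: "(\<lambda>s v. F s v - tx_of n (lift_stair n a') s v) \<in> DK_space p ord \<Omega> \<gamma> n b"
  proof -
    have "tx_of n (lift_stair n a') = (\<lambda>s v. \<Sum>m\<le>n. t_mult (g m) (basis_e \<gamma> m) s v)"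
      by (rule basis_combination[symmetric]) (rule a')
    then have "(\<lambda>s v. F s v - tx_of n (lift_stair n a') s v) =
        (\<lambda>s v. F s v - (\<Sum>m\<le>n. t_mult (g m) (basis_e \<gamma> m) s v))"
      by (simp only:)
    then show ?thesis using conjunct2[OF conjunct2[OF g]] by (simp only:)
  qed
  obtain G' where G': "(\<lambda>s v. F s v - tx_of n (lift_stair n a') s v) = tx_of n (\<lambda>u. \<Sum>l=1..n. Dop hcoeff l (G' l) u)"
    "\<And>l. l \<in> {1..n} \<Longrightarrow> supp_in (uexps n) (G' l) \<and> (\<exists>\<rho>. G' l \<in> level (\<lambda>D. b * real D + \<rho>))"
    by (rule DK_spaceE[OF DK]) (rule that; assumption)
  have "\<forall>m\<le>n. \<exists>\<rho>. \<forall>s. g m s \<in> \<Omega> \<and> ordge (b * (real n + 1) * real s + \<rho>) (g m s)"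
    using g unfolding L_space_def ordge_def by blast
  then obtain \<rho> where \<rho>: "\<And>m s. m \<le> n \<Longrightarrow> g m s \<in> \<Omega> \<and> ordge (b * (real n + 1) * real s + \<rho> m) (g m s)"
    by metis
  define \<rho>0 where "\<rho>0 = Min (\<rho> ` {..n})"
  have \<rho>0: "\<rho>0 \<le> \<rho> m" if "m \<le> n" for m unfolding \<rho>0_def using that by (intro Min_le) auto
  \<comment> \<open>A single constant must serve all \<open>m \<le> n\<close>; subtracting
    \<open>b * n\<close> compensates for the part \<open>b * m\<close> of
    \<open>b * D\<close>.\<close>
  have a'_bd: "a' D \<in> \<Omega> \<and> ordge (b * real D + (\<rho>0 - b * real n)) (a' D)" for D
  proof -
    define m s where "m = D mod (n + 1)" and "s = D div (n + 1)"
    have m: "m \<le> n" by (simp add: m_def less_Suc_eq_le[symmetric])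
    have D: "D = (n + 1) * s + m" using div_mult_mod_eq[of D "n + 1"] by (simp add: m_def s_def mult.commute)
    have "b * real D + (\<rho>0 - b * real n) \<le> (b * (real n + 1) * real s + \<rho> m) + real m * e"
    proof -
      have "b \<ge> 0" using b_gt e_nn by linarith
      then have "b * real m \<le> b * real n" using m by (simp add: mult_left_mono)
      moreover have "0 \<le> real m * e" using e_nn by simp
      moreover have "b * real D = b * (real n + 1) * real s + b * real m" unfolding D by (simp add: algebra_simps)
      ultimately show ?thesis using \<rho>0[OF m] by linarith
    qed
    moreover have "ordge ((b * (real n + 1) * real s + \<rho> m) + real m * e) (a' D)"
      unfolding D a'[OF m] using \<rho>[OF m] by (intro ordge_mult pw) auto
    moreover have "a' D \<in> \<Omega>" unfolding D a'[OF m] using \<rho>[OF m] \<gamma>_mem by auto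
    ultimately show ?thesis using ordge_mono by blast
  qed
  have "a' D - a D = 0" for D
  proof (rule lift_stair_in_DK_imp_0[where G = "\<lambda>l u. G l u - G' l u" and a = "\<lambda>D. a' D - a D" and
        \<tau> = "min \<tau> (\<rho>0 - b * real n)"])
    show "a' D - a D \<in> \<Omega>" for D using a'_bd a by auto
    show "ordge (b * real D + min \<tau> (\<rho>0 - b * real n)) (a' D - a D)" for D
    proof (rule ordge_diff)
      show "ordge (b * real D + min \<tau> (\<rho>0 - b * real n)) (a' D)"
        using conjunct2[OF a'_bd] by (rule ordge_mono) simp
      show "ordge (b * real D + min \<tau> (\<rho>0 - b * real n)) (a D)"
        using a(2) by (rule ordge_mono) simp
    qed
    have "lift_stair n (\<lambda>D. a' D - a D) = (\<lambda>u. lift_stair n a' u - lift_stair n a u)"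
      by (simp add: lift_stair_def fun_eq_iff)
    moreover have "tx_of n (lift_stair n a') s v - tx_of n (lift_stair n a) s v =
       tx_of n (\<lambda>u. \<Sum>l=1..n. Dop hcoeff l (G l) u) s v - tx_of n (\<lambda>u. \<Sum>l=1..n. Dop hcoeff l (G' l) u) s v" for s v
      using fun_cong[OF fun_cong[OF G'(1)], of s v] unfolding F tx_of_add by (simp add: algebra_simps)
    ultimately show "tx_of n (lift_stair n (\<lambda>D. a' D - a D)) =
        tx_of n (\<lambda>u. \<Sum>l=1..n. Dop hcoeff l (\<lambda>u. G l u - G' l u) u)"
      by (simp add: Dop_diff sum_subtractf tx_of_diff)
    show "supp_in (uexps n) (\<lambda>u. G l u - G' l u) \<and> (\<exists>\<rho>. (\<lambda>u. G l u - G' l u) \<in> level (\<lambda>D. b * real D + \<rho>))"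
      if l: "l \<in> {1..n}" for l
    proof -
      obtain \<rho>1 \<rho>2 where "G l \<in> level (\<lambda>D. b * real D + \<rho>1)" "G' l \<in> level (\<lambda>D. b * real D + \<rho>2)"
        using G[OF l] G'(2)[OF l] by blast
      then have "G l \<in> level (\<lambda>D. b * real D + min \<rho>1 \<rho>2)" "G' l \<in> level (\<lambda>D. b * real D + min \<rho>1 \<rho>2)"
        by (auto intro: level_mono)
      then show ?thesis using G[OF l] G'(2)[OF l] level_diff supp_in_diff by blast
    qed
  qed
  then have aa: "a' D = a D" for D by simp
  show "g = ?g"
  proof (intro ext)
    fix m s
    show "g m s = ?g m s"
    proof (cases "m \<le> n")
      case True
      then show ?thesis using a'[OF True, of s] \<gamma>_nz unfolding aa by simp
    next
      case False
      then show ?thesis using g by simp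
    qed
  qed
qed


text \<open>Below \<open>J\<close> the slope is \<open>b - c = e\<close>, above it is
  \<open>b\<close>; both lie between \<open>e\<close> and \<open>e + 1\<close>. As \<open>e\<close>
  is the least slope allowed, a gain of \<open>c\<close> per missing degree is the most this
  argument can give.\<close>

lemma slope_hinge: "slope 0 (\<lambda>D. b * real D + c * max 0 (J - real D) + \<rho>)"
proof -
  have c: "0 < c" using b_gt by simp
  have be: "b \<le> e + 1" using b_le e_plus_1 by simp
  have key: "x + y \<le> b + c * (M' - M) \<and> b + c * (M' - M) \<le> x + 1"
    if "x = e" "y = (0::real)" "M - 1 \<le> M'" "M' \<le> M" for M M' x y
  proof
    have "c * (M - M') \<le> c * 1" using c that by (intro mult_left_mono) auto
    then show "x + y \<le> b + c * (M' - M)" using that by (simp add: right_diff_distrib)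
    have "0 \<le> c * (M - M')" using c that by simp
    then show "b + c * (M' - M) \<le> x + 1" using that be by (simp add: right_diff_distrib)
  qed
  show ?thesis unfolding slope_def
  proof
    fix D
    have "max 0 (J - real D) - 1 \<le> max 0 (J - real (Suc D))" "max 0 (J - real (Suc D)) \<le> max 0 (J - real D)"
      by auto
    from key[OF refl refl this]
    show "b * real D + c * max 0 (J - real D) + \<rho> + e + 0 \<le> b * real (Suc D) + c * max 0 (J - real (Suc D)) + \<rho> \<and>
      b * real (Suc D) + c * max 0 (J - real (Suc D)) + \<rho> + 0 \<le> b * real D + c * max 0 (J - real D) + \<rho> + (e + 1)"
      by (simp only: of_nat_Suc distrib_left right_diff_distrib) linarith
  qed
qed

lemma reduction_hinge:
  assumes F: "F \<in> level (\<lambda>D. b * real D + c * max 0 (J - real D) + \<rho>)" "supp_in (uexps n) F"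
  shows "\<exists>a G \<rho>'. (\<forall>D. a D \<in> \<Omega> \<and> ordge (b * real D + c * max 0 (J - real D) + \<rho>) (a D)) \<and>
    (\<forall>l\<in>{1..n}. supp_in (uexps n) (G l) \<and> G l \<in> level (\<lambda>D. b * real D + \<rho>')) \<and>
    F = (\<lambda>u. lift_stair n a u + (\<Sum>l=1..n. Dop hcoeff l (G l) u))"
proof -
  obtain b' \<epsilon> where b': "b' \<le> b" "\<epsilon> > 0" "slope \<epsilon> (\<lambda>D. b' * real D)" using exists_strict_slope by blast
  have c: "0 < c" using b_gt by simp
  have "b' * real D + \<rho> \<le> b * real D + c * max 0 (J - real D) + \<rho>" for D
  proof -
    have "b' * real D \<le> b * real D" using b' by (simp add: mult_right_mono)
    moreover have "0 \<le> c * max 0 (J - real D)" using c by simp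
    ultimately show ?thesis by linarith
  qed
  from reduction_to_stair[OF slope_hinge b'(3,2) this F]
  obtain a G where a: "\<forall>D. a D \<in> \<Omega> \<and> ordge (b * real D + c * max 0 (J - real D) + \<rho>) (a D)"
    and G: "\<forall>l\<in>{1..n}. G l \<in> level (\<lambda>D. b * real (Suc D) + c * max 0 (J - real (Suc D)) + \<rho> - e) \<and> supp_in (uexps n) (G l)"
    and eq: "F = (\<lambda>u. lift_stair n a u + (\<Sum>l=1..n. Dop hcoeff l (G l) u))" by blast
  have "G l \<in> level (\<lambda>D. b * real D + (b + \<rho> - e))" if "l \<in> {1..n}" for l
  proof (rule level_mono)
    show "G l \<in> level (\<lambda>D. b * real (Suc D) + c * max 0 (J - real (Suc D)) + \<rho> - e)" using G that by blast
    fix D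
    have "0 \<le> c * max 0 (J - real (Suc D))" using c by simp
    then show "b * real D + (b + \<rho> - e) \<le> b * real (Suc D) + c * max 0 (J - real (Suc D)) + \<rho> - e"
      by (simp only: of_nat_Suc distrib_left)
  qed
  then show ?thesis using a G eq by blast
qed

section \<open>Reduction of the derivatives of the basis\<close>

definition basis_u :: "nat \<Rightarrow> (nat \<Rightarrow> nat) \<Rightarrow> 'k" where
  "basis_u j = (\<lambda>u. if u = uexp_of n 0 (ones j) then \<gamma> ^ j else 0)"

lemma udeg_ones: "j \<le> n \<Longrightarrow> udeg n (uexp_of n 0 (ones j)) = j"
  using udeg_stair[of n j] stair_ones[of j 0] by simp

lemma basis_e_tx_of:
  assumes "j \<le> n"
  shows "basis_e \<gamma> j = tx_of n (basis_u j)"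
proof (intro ext)
  fix s v
  have "v = ones j \<and> s = 0" if "v \<in> exps n" "mneg n v \<le> int s" "uexp_of n s v = uexp_of n 0 (ones j)"
  proof -
    have "s = 0" using fun_cong[OF that(3), of 0] by (simp add: uexp_of_def)
    have "v = vexp_of n (uexp_of n s v)" by (rule vexp_of_uexp_of[OF that(1,2), symmetric])
    also have "\<dots> = vexp_of n (uexp_of n 0 (ones j))" unfolding that(3) ..
    also have "\<dots> = ones j" by (rule vexp_of_uexp_of[OF ones_in_exps[OF assms] mneg_ones])
    finally show ?thesis using \<open>s = 0\<close> by blast
  qed
  then show "basis_e \<gamma> j s v = tx_of n (basis_u j) s v"
    using ones_in_exps[OF assms] mneg_ones[of j 0]
    by (auto simp: basis_e_def tx_of_def basis_u_def ones_def[abs_def])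
qed

text \<open>The variable \<open>x_k\<close> does not occur in \<open>e_j\<close>, so the derivation
  kills \<open>e_j\<close> and each exponent receives at most one term
  \<open>h d * \<gamma>^j\<close>. The case \<open>k = 0\<close> is the connection;
  \<open>k = 1\<close> with \<open>j = 0\<close> yields the precise leading term.\<close>

lemma nabla_basis:
  assumes j: "j \<le> n" "k \<notin> {1..j}" "k \<le> n"
  shows "u \<notin> uexps n \<Longrightarrow> nabla hcoeff k (basis_u j) u = 0"
    and "\<exists>d\<ge>1. nabla hcoeff k (basis_u j) u = 0 \<or>
      nabla hcoeff k (basis_u j) u = hcoeff d * \<gamma> ^ j \<and> udeg n u = d + j \<and> u k = d"
    and "u k = 1 \<Longrightarrow> nabla hcoeff k (basis_u j) u = \<gamma> * xmul k (basis_u j) u"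
proof -
  let ?v = "uexp_of n 0 (ones j)"
  have vk: "?v k = 0" using j by (simp add: uexp_of_def ones_def)
  have th: "of_nat (u k) * basis_u j u = 0" using vk by (auto simp: basis_u_def)
  have "gmul hcoeff k (basis_u j) u = (\<Sum>d=1..u k. if d = u k then hcoeff (u k) * basis_u j (u(k := 0)) else 0)"
    unfolding gmul_def
  proof (rule sum.cong[OF refl])
    fix d assume d: "d \<in> {1..u k}"
    show "hcoeff d * basis_u j (u(k := u k - d)) = (if d = u k then hcoeff (u k) * basis_u j (u(k := 0)) else 0)"
    proof (cases "d = u k")
      case False
      then have "(u(k := u k - d)) k \<noteq> ?v k" using d vk by simp
      then have "u(k := u k - d) \<noteq> ?v" by metis
      then show ?thesis using False by (simp add: basis_u_def)
    qed simp
  qed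
  then have eq: "nabla hcoeff k (basis_u j) u = (if u k \<ge> 1 then hcoeff (u k) * basis_u j (u(k := 0)) else 0)"
    by (simp add: nabla_def th)
  show "nabla hcoeff k (basis_u j) u = 0" if "u \<notin> uexps n"
  proof -
    have "u(k := 0) \<noteq> ?v" using that uexps_upd[OF j(3), of u 0] uexp_of_in by metis
    then show ?thesis unfolding eq by (simp add: basis_u_def)
  qed
  show "\<exists>d\<ge>1. nabla hcoeff k (basis_u j) u = 0 \<or>
      nabla hcoeff k (basis_u j) u = hcoeff d * \<gamma> ^ j \<and> udeg n u = d + j \<and> u k = d"
  proof (cases "u k \<ge> 1 \<and> u(k := 0) = ?v")
    case True
    then have "udeg n u = u k + j" using udeg_upd[OF j(3), of u 0] udeg_ones[OF j(1)] by simp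
    then show ?thesis using True unfolding eq by (intro exI[of _ "u k"]) (simp add: basis_u_def)
  next
    case False
    then have "nabla hcoeff k (basis_u j) u = 0" unfolding eq by (auto simp: basis_u_def)
    then show ?thesis by blast
  qed
  show "nabla hcoeff k (basis_u j) u = \<gamma> * xmul k (basis_u j) u" if "u k = 1"
    using that h_1 by (simp add: eq xmul_def)
qed

lemma ordge_\<gamma>_power: "ordge (real j * e) (\<gamma> ^ j)"
  using ord_power[OF ord_\<gamma>, of j] by (simp add: ordge_def)

text \<open>Replacing the slope \<open>e + 1\<close> by \<open>b\<close> bounds the order below by
  \<open>b (d - 1) + (j + 1) e\<close>, which is \<open>b (d + j) - (j + 1) c\<close>.\<close>

lemma ordge_hcoeff_power:
  assumes "d \<ge> 1"
  shows "ordge (b * real (d + j) - (real j + 1) * c) (hcoeff d * \<gamma> ^ j)"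
proof -
  have be: "b \<le> e + 1" using b_le e_plus_1 by simp
  have "b * (real d - 1) \<le> (e + 1) * (real d - 1)" using be assms by (intro mult_right_mono) auto
  moreover have "b * (d' - 1) \<le> (x + 1) * (d' - 1) \<Longrightarrow>
      b * (d' + j') - (j' + 1) * (b - x) \<le> ((x + 1) * (d' - 1) + x) + j' * x" for x d' j'
    by (simp add: algebra_simps)
  ultimately have "b * real (d + j) - (real j + 1) * c \<le> ((e + 1) * (real d - 1) + e) + real j * e"
    unfolding of_nat_add by blast
  then show ?thesis by (rule ordge_mono[OF ordge_mult[OF ordge_h[OF assms] ordge_\<gamma>_power]])
qed

lemma nabla_basis_in: "nabla hcoeff k (basis_u j) u \<in> \<Omega>"
  using \<gamma>_mem hcoeff_in by (auto simp: nabla_def gmul_def basis_u_def)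

text \<open>
  In degree \<open>(n + 1) s + m \<le> j\<close> the coefficients of \<open>\<partial>(e\<^sub>j)\<close> are smaller than the general bound: the
  series representing \<open>\<partial>(e\<^sub>j)\<close> starts in degree \<open>j + 1\<close>, and lowering the degree by one in the reduction
  gains \<open>c\<close>.
\<close>

lemma Dt_basis_decomposition:
  assumes j: "j \<le> n"
  shows "\<exists>a G \<rho>'. (\<forall>D. a D \<in> \<Omega> \<and>
      ordge (b * real D + c * max 0 (real j + 1 - real D) - (real j + 1) * c) (a D)) \<and>
    (j = 0 \<longrightarrow> ordge b (a 1 - \<gamma>)) \<and>
    (\<forall>l\<in>{1..n}. supp_in (uexps n) (G l) \<and> G l \<in> level (\<lambda>D. b * real D + \<rho>')) \<and>
    nabla hcoeff 0 (basis_u j) = (\<lambda>u. lift_stair n a u + (\<Sum>l=1..n. Dop hcoeff l (G l) u))"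
proof -
  have c: "0 < c" using b_gt by simp
  show ?thesis
  proof (cases "j = 0")
    case False
    have "nabla hcoeff 0 (basis_u j) \<in>
        level (\<lambda>D. b * real D + c * max 0 ((real j + 1) - real D) + - ((real j + 1) * c))"
    proof (rule levelI[OF nabla_basis_in])
      fix u
      obtain d where d: "d \<ge> 1" "nabla hcoeff 0 (basis_u j) u = 0 \<or>
          nabla hcoeff 0 (basis_u j) u = hcoeff d * \<gamma> ^ j \<and> udeg n u = d + j"
        using nabla_basis(2)[OF j, of 0 u] by auto
      have "max 0 ((real j + 1) - real (d + j)) = 0" using d(1) by simp
      then show "ordge (b * real (udeg n u) + c * max 0 ((real j + 1) - real (udeg n u)) + - ((real j + 1) * c))
          (nabla hcoeff 0 (basis_u j) u)"
        using d ordge_hcoeff_power[OF d(1), of j] by auto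
    qed
    moreover have "supp_in (uexps n) (nabla hcoeff 0 (basis_u j))"
      using nabla_basis(1)[OF j] by (simp add: supp_in_def)
    ultimately show ?thesis using reduction_hinge[of "nabla hcoeff 0 (basis_u j)" "real j + 1" "- ((real j + 1) * c)"]
      False by simp
  next
    case True
    \<comment> \<open>Modulo the image of \<open>D_1\<close>, \<open>nabla 0\<close> may be replaced
      by \<open>nabla 1\<close>, whose leading term on \<open>1\<close> is already the staircase
      monomial of \<open>e_1\<close>. Without it the series starts in degree 2, so a hinge at 2
      gives order \<open>b + c - c = b\<close> to the correction in degree 1.\<close>
    define F where "F = (\<lambda>u. nabla hcoeff 1 (basis_u 0) u - \<gamma> * xmul 1 (basis_u 0) u)"
    have n1: "1 \<le> n" by (rule n_pos)
    have lev: "F \<in> level (\<lambda>D. b * real D + c * max 0 (2 - real D) + - c)"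
    proof (rule levelI)
      fix u
      show "F u \<in> \<Omega>" unfolding F_def using nabla_basis_in \<gamma>_mem by (auto simp: xmul_def basis_u_def)
      show "ordge (b * real (udeg n u) + c * max 0 (2 - real (udeg n u)) + - c) (F u)"
      proof (cases "u 1 = 1")
        case True
        then show ?thesis using nabla_basis(3)[OF le0 _ n1, of u] by (simp add: F_def)
      next
        case u1: False
        have "xmul 1 (basis_u 0) u = 0"
        proof (cases "u 1 = 0")
          case False
          have "(u(1 := u 1 - 1)) 1 \<noteq> uexp_of n 0 (ones 0) 1" using u1 False by (simp add: uexp_of_def ones_def)
          then have "u(1 := u 1 - 1) \<noteq> uexp_of n 0 (ones 0)" by metis
          then show ?thesis by (simp add: xmul_def basis_u_def)
        qed (simp add: xmul_def)
        then have Fu: "F u = nabla hcoeff 1 (basis_u 0) u" by (simp add: F_def)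
        obtain d where d: "d \<ge> 1" "F u = 0 \<or> F u = hcoeff d * \<gamma> ^ 0 \<and> udeg n u = d + 0 \<and> u 1 = d"
          using nabla_basis(2)[OF le0 _ n1, of u] unfolding Fu by auto
        show ?thesis
        proof (cases "F u = 0")
          case False
          then have *: "F u = hcoeff d * \<gamma> ^ 0" "udeg n u = d + 0" "u 1 = d" using d by auto
          have "d \<ge> 2" using d(1) *(3) u1 by simp
          then have "b * real (d + 0) + c * max 0 (2 - real (d + 0)) + - c = b * real (d + 0) - (real 0 + 1) * c"
            by simp
          then show ?thesis using ordge_hcoeff_power[OF d(1), of 0] by (simp only: *(1,2))
        qed simp
      qed
    qed
    have sup: "supp_in (uexps n) F"
    proof -
      have "xmul 1 (basis_u 0) u = 0" if "u \<notin> uexps n" for u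
      proof -
        have "u(1 := u 1 - 1) \<noteq> uexp_of n 0 (ones 0)" using that uexps_upd[OF n1] uexp_of_in by metis
        then show ?thesis by (simp add: xmul_def basis_u_def)
      qed
      then show ?thesis using nabla_basis(1)[OF le0 _ n1] by (simp add: supp_in_def F_def)
    qed
    from reduction_hinge[OF lev sup] obtain a G \<rho> where a: "\<forall>D. a D \<in> \<Omega> \<and> ordge (b * real D + c * max 0 (2 - real D) + - c) (a D)"
      and G: "\<forall>l\<in>{1..n}. supp_in (uexps n) (G l) \<and> G l \<in> level (\<lambda>D. b * real D + \<rho>)"
      and F: "F = (\<lambda>u. lift_stair n a u + (\<Sum>l=1..n. Dop hcoeff l (G l) u))"
      by blast
    define a' where "a' D = a D + (if D = 1 then \<gamma> else 0)" for D
    \<comment> \<open>The correction at \<open>l = 1\<close> accounts for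
      \<open>nabla 0 = nabla 1 - D_1\<close> applied to \<open>e_0\<close>.\<close>
    define G' where "G' l = (\<lambda>u. G l u - (if l = 1 then basis_u 0 u else 0))" for l
    have st: "stair n 1 = (uexp_of n 0 (ones 0))(1 := 1)"
      using stair_ones[OF n1, of 0] n1 by (auto simp: uexp_of_def ones_def fun_eq_iff)
    have x1: "\<gamma> * xmul 1 (basis_u 0) u = lift_stair n (\<lambda>D. if D = 1 then \<gamma> else 0) u" for u
    proof -
      have "u 1 \<noteq> 0 \<and> u(1 := u 1 - 1) = uexp_of n 0 (ones 0) \<longleftrightarrow> u = stair n 1"
      proof
        assume a: "u 1 \<noteq> 0 \<and> u(1 := u 1 - 1) = uexp_of n 0 (ones 0)"
        have "u 1 - 1 = 0" using fun_cong[OF conjunct2[OF a], of 1] by (simp add: uexp_of_def ones_def)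
        then have "u 1 = 1" using a by simp
        then have "(uexp_of n 0 (ones 0))(1 := 1) = u" using a by (metis fun_upd_triv fun_upd_upd)
        then show "u = stair n 1" using st by simp
      next
        assume u: "u = stair n 1"
        have "uexp_of n 0 (ones 0) 1 = 0" by (simp add: uexp_of_def ones_def)
        then show "u 1 \<noteq> 0 \<and> u(1 := u 1 - 1) = uexp_of n 0 (ones 0)" unfolding u st by (simp add: fun_upd_idem)
      qed
      moreover have "u = stair n (udeg n u) \<and> udeg n u = 1 \<longleftrightarrow> u = stair n 1" using udeg_stair by metis
      ultimately have "(u 1 \<noteq> 0 \<and> u(1 := u 1 - 1) = uexp_of n 0 (ones 0)) = (u = stair n (udeg n u) \<and> udeg n u = 1)"
        by (simp only:)
      then show ?thesis by (auto simp: xmul_def basis_u_def lift_stair_def)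
    qed
    have "nabla hcoeff 0 (basis_u 0) u = lift_stair n a' u + (\<Sum>l=1..n. Dop hcoeff l (G' l) u)" for u
    proof -
      have "(\<Sum>l=1..n. Dop hcoeff l (G' l) u) = (\<Sum>l=1..n. Dop hcoeff l (G l) u - (if l = 1 then Dop hcoeff 1 (basis_u 0) u else 0))"
        by (intro sum.cong) (auto simp: G'_def Dop_diff Dop_0)
      also have "\<dots> = (\<Sum>l=1..n. Dop hcoeff l (G l) u) - Dop hcoeff 1 (basis_u 0) u"
        using n1 by (simp add: sum_subtractf)
      finally have "(\<Sum>l=1..n. Dop hcoeff l (G' l) u) = F u - lift_stair n a u - Dop hcoeff 1 (basis_u 0) u"
        by (simp add: F)
      moreover have "lift_stair n a' u = lift_stair n a u + \<gamma> * xmul 1 (basis_u 0) u"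
        unfolding x1 by (simp add: lift_stair_def a'_def)
      ultimately show ?thesis by (simp add: F_def Dop_def)
    qed
    moreover have "supp_in (uexps n) (G' l) \<and> G' l \<in> level (\<lambda>D. b * real D + min \<rho> 0)" if l: "l \<in> {1..n}" for l
    proof
      have bs: "supp_in (uexps n) (\<lambda>u. if l = 1 then basis_u 0 u else 0)"
        using uexp_of_in by (auto simp: supp_in_def basis_u_def)
      show "supp_in (uexps n) (G' l)" unfolding G'_def using G l bs by (intro supp_in_diff) auto
      have "basis_u 0 \<in> level (\<lambda>D. b * real D + min \<rho> 0)"
      proof (rule levelI)
        fix u
        show "basis_u 0 u \<in> \<Omega>" by (simp add: basis_u_def)
        show "ordge (b * real (udeg n u) + min \<rho> 0) (basis_u 0 u)"
        proof (cases "u = uexp_of n 0 (ones 0)")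
          case True
          have "ordge (min \<rho> 0) 1" by (rule ordge_mono[OF ordge_1]) simp
          then show ?thesis using udeg_ones[OF le0] unfolding True by (simp add: basis_u_def)
        qed (simp add: basis_u_def)
      qed
      then have "(\<lambda>u. if l = 1 then basis_u 0 u else 0) \<in> level (\<lambda>D. b * real D + min \<rho> 0)"
        by (auto simp: level_def)
      moreover have "G l \<in> level (\<lambda>D. b * real D + min \<rho> 0)"
        using G l by (auto intro: level_mono[of _ "\<lambda>D. b * real D + \<rho>"])
      ultimately show "G' l \<in> level (\<lambda>D. b * real D + min \<rho> 0)" unfolding G'_def by (intro level_diff)
    qed
    moreover have "ordge b (a' 1 - \<gamma>)"
    proof -
      have "ordge (b * real 1 + c * max 0 (2 - real 1) + - c) (a 1)" using a by blast
      then show ?thesis by (simp add: a'_def)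
    qed
    moreover have "a' D \<in> \<Omega> \<and> ordge (b * real D + c * max 0 (real 0 + 1 - real D) - (real 0 + 1) * c) (a' D)" for D
    proof
      show "a' D \<in> \<Omega>" unfolding a'_def using a \<gamma>_mem by simp
      have "c * max 0 (1 - real D) \<le> c * max 0 (2 - real D)" using c by (intro mult_left_mono) auto
      then have "ordge (b * real D + c * max 0 (1 - real D) - c) (a D)"
        using a by (auto intro: ordge_mono)
      moreover have "ordge (b * real D + c * max 0 (1 - real D) - c) (if D = 1 then \<gamma> else 0)"
        using ordge_\<gamma> by (auto intro: ordge_mono)
      ultimately show "ordge (b * real D + c * max 0 (real 0 + 1 - real D) - (real 0 + 1) * c) (a' D)"
        unfolding a'_def using ordge_add by simp
    qed
    ultimately show ?thesis unfolding True
      by - (rule exI[of _ a'], rule exI[of _ G'], rule exI[of _ "min \<rho> 0"], blast)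
  qed
qed

text \<open>Passing from staircase coefficients to coordinates divides by \<gamma>^m, which costs
  \<open>m e\<close> and turns \<open>b m\<close> into \<open>c m\<close>. Likewise the correction
  of order \<open>b\<close> to \<gamma> in degree 1 becomes one of order \<open>b - e = c\<close> to
  the entry \<open>1\<close>.\<close>

lemma conn_matrix_bounds:
  assumes j: "j \<le> n" and m: "m \<le> n"
  defines "A \<equiv> conn_matrix p ord \<Omega> \<gamma> n b"
  shows "A j m s \<in> \<Omega>"
    and "ordge (b * (real n + 1) * real s + c * (real m - real j - 1) +
      c * max 0 (real j + 1 - ((real n + 1) * real s + real m))) (A j m s)"
    and "ordge c (A 0 1 0 - 1)"
proof -
  have inv: "ordge (- (real m * e)) (inverse (\<gamma> ^ m))" for m
    using ord_inverse[of "\<gamma> ^ m"] ord_power[OF ord_\<gamma>, of m] \<gamma>_nz by (simp add: ordge_def)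
  have "\<exists>a. (\<forall>D. a D \<in> \<Omega> \<and> ordge (b * real D + c * max 0 (real j + 1 - real D) - (real j + 1) * c) (a D)) \<and>
      (j = 0 \<longrightarrow> ordge b (a 1 - \<gamma>)) \<and>
      A j = (\<lambda>m s. if m \<le> n then a ((n + 1) * s + m) * inverse (\<gamma> ^ m) else 0)" if j: "j \<le> n" for j
  proof -
    obtain a G \<rho>' where a: "\<forall>D. a D \<in> \<Omega> \<and> ordge (b * real D + c * max 0 (real j + 1 - real D) - (real j + 1) * c) (a D)"
      "j = 0 \<longrightarrow> ordge b (a 1 - \<gamma>)"
      and G: "\<forall>l\<in>{1..n}. supp_in (uexps n) (G l) \<and> G l \<in> level (\<lambda>D. b * real D + \<rho>')"
      and eq: "nabla hcoeff 0 (basis_u j) = (\<lambda>u. lift_stair n a u + (\<Sum>l=1..n. Dop hcoeff l (G l) u))"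
      using Dt_basis_decomposition[OF j] by blast
    have c: "0 < c" using b_gt by simp
    have "A j = (\<lambda>m s. if m \<le> n then a ((n + 1) * s + m) * inverse (\<gamma> ^ m) else 0)"
      unfolding A_def conn_matrix_def basis_e_tx_of[OF j] Dt_op_tx_of eq
    proof (rule coords_eq[OF refl, where \<tau> = "- ((real j + 1) * c)"])
      show "a D \<in> \<Omega>" for D using a(1) by blast
      show "ordge (b * real D + - ((real j + 1) * c)) (a D)" for D
      proof -
        have "0 \<le> c * max 0 (real j + 1 - real D)" using c by simp
        then have "b * real D + - ((real j + 1) * c) \<le>
            b * real D + c * max 0 (real j + 1 - real D) - (real j + 1) * c" by linarith
        then show ?thesis using a(1) ordge_mono by blast
      qed
    qed (use G in blast)
    then show ?thesis using a by blast
  qed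
  note ex = this
  obtain a where a: "\<forall>D. a D \<in> \<Omega> \<and> ordge (b * real D + c * max 0 (real j + 1 - real D) - (real j + 1) * c) (a D)"
    and A: "A j = (\<lambda>m s. if m \<le> n then a ((n + 1) * s + m) * inverse (\<gamma> ^ m) else 0)"
    using ex[OF j] by blast
  show "A j m s \<in> \<Omega>" using a m \<gamma>_mem by (simp add: A)
  have D: "real ((n + 1) * s + m) = (real n + 1) * real s + real m" by (simp add: algebra_simps)
  have "ordge ((b * ((real n + 1) * real s + real m) + c * max 0 (real j + 1 - ((real n + 1) * real s + real m))
      - (real j + 1) * c) + - (real m * e)) (A j m s)"
  proof -
    have "A j m s = a ((n + 1) * s + m) * inverse (\<gamma> ^ m)" using m by (simp add: A)
    moreover have "ordge (b * ((real n + 1) * real s + real m) + c * max 0 (real j + 1 - ((real n + 1) * real s + real m))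
      - (real j + 1) * c) (a ((n + 1) * s + m))" using a unfolding D[symmetric] by blast
    ultimately show ?thesis using ordge_mult inv by metis
  qed
  moreover have "(b * ((real n + 1) * real s + real m) + M - (real j + 1) * (b - x)) + - (real m * x) =
      b * (real n + 1) * real s + (b - x) * (real m - real j - 1) + M" for M x
    by (simp add: algebra_simps)
  ultimately show "ordge (b * (real n + 1) * real s + c * (real m - real j - 1) +
      c * max 0 (real j + 1 - ((real n + 1) * real s + real m))) (A j m s)" by (simp only:)
  obtain a0 where a0: "ordge b (a0 1 - \<gamma>)"
    and A0: "A 0 = (\<lambda>m s. if m \<le> n then a0 ((n + 1) * s + m) * inverse (\<gamma> ^ m) else 0)"
    using ex[OF le0] by blast
  have "A 0 1 0 - 1 = (a0 1 - \<gamma>) * inverse (\<gamma> ^ 1)"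
    using n_pos \<gamma>_nz by (simp add: A0 left_diff_distrib)
  then show "ordge c (A 0 1 0 - 1)" using ordge_mult[OF a0 inv[of 1]] by simp
qed

end

section \<open>The connection on \<open>S(b,c)\<close>\<close>

lemma sum_upd:
  fixes f :: "nat \<Rightarrow> nat \<Rightarrow> nat"
  assumes "k \<in> {1..n}"
  shows "(\<Sum>j=1..n. f j ((\<mu>(k := a)) j)) + f k (\<mu> k) = (\<Sum>j=1..n. f j (\<mu> j)) + f k a"
proof -
  have "(\<Sum>j=1..n. f j (\<nu> j)) = f k (\<nu> k) + (\<Sum>j\<in>{1..n} - {k}. f j (\<nu> j))" for \<nu> :: "nat \<Rightarrow> nat"
    using assms by (intro sum.remove) auto
  moreover have "(\<Sum>j\<in>{1..n} - {k}. f j ((\<mu>(k := a)) j)) = (\<Sum>j\<in>{1..n} - {k}. f j (\<mu> j))"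
    by (rule sum.cong) auto
  ultimately show ?thesis by simp
qed

lemma wt_upd: "k \<in> {1..n} \<Longrightarrow> wt n (\<mu>(k := a)) + k * \<mu> k = wt n \<mu> + k * a"
  unfolding wt_def by (rule sum_upd)

lemma len_upd: "k \<in> {1..n} \<Longrightarrow> len n (\<mu>(k := a)) + \<mu> k = len n \<mu> + a"
  unfolding len_def by (rule sum_upd)

lemma wt_mul_e: "m \<le> n \<Longrightarrow> wt n (mul_e m \<mu>) = wt n \<mu> + m"
  using wt_upd[of m n \<mu> "\<mu> m + 1"] by (auto simp: mul_e_def)

lemma len_mul_e: "m \<le> n \<Longrightarrow> len n (mul_e m \<mu>) = len n \<mu> + (if m = 0 then 0 else 1)"
  using len_upd[of m n \<mu> "\<mu> m + 1"] by (auto simp: mul_e_def)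

lemma wt_lower: "j \<in> {1..n} \<Longrightarrow> i j \<noteq> 0 \<Longrightarrow> wt n (i(j := i j - 1)) + j = wt n i"
  using wt_upd[of j n i "i j - 1"] by (cases "i j") auto

lemma len_lower: "j \<in> {1..n} \<Longrightarrow> i j \<noteq> 0 \<Longrightarrow> len n (i(j := i j - 1)) + 1 = len n i"
  using len_upd[of j n i "i j - 1"] by (cases "i j") auto

lemma len_le_wt: "len n \<mu> \<le> wt n \<mu>"
  unfolding len_def wt_def by (rule sum_mono) auto

lemma mul_e_in_exps: "m \<le> n \<Longrightarrow> \<mu> \<in> exps n \<Longrightarrow> mul_e m \<mu> \<in> exps n"
  by (auto simp: mul_e_def exps_def)

text \<open>A finite set of indices outside which nothing contributes to \<open>t^s e^\<nu>\<close>: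
  forming the connection lowers at most one exponent, and by at most one. It replaces
  \<open>Sum_any\<close> by an ordinary sum.\<close>

definition near :: "nat \<Rightarrow> nat \<Rightarrow> (nat \<Rightarrow> nat) \<Rightarrow> (nat \<times> (nat \<Rightarrow> nat)) set" where
  "near n s \<nu> = {..s} \<times> {i \<in> exps n. \<forall>j. i j \<le> \<nu> j + 1}"

lemma finite_near: "finite (near n s \<nu>)"
proof -
  let ?B = "\<Sum>j=1..n. \<nu> j + 1"
  have "{i \<in> exps n. \<forall>j. i j \<le> \<nu> j + 1} \<subseteq>
      {f. \<forall>j. (j \<in> {1..n} \<longrightarrow> f j \<in> {..?B}) \<and> (j \<notin> {1..n} \<longrightarrow> f j = 0)}"
  proof
    fix i assume i: "i \<in> {i \<in> exps n. \<forall>j. i j \<le> \<nu> j + 1}"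
    have "i j \<le> ?B" if "j \<in> {1..n}" for j
    proof -
      have "\<nu> j + 1 \<le> ?B" using that by (intro member_le_sum[of j "{1..n}" "\<lambda>j. \<nu> j + 1"]) auto
      then show ?thesis using i by (auto intro: order_trans)
    qed
    then show "i \<in> {f. \<forall>j. (j \<in> {1..n} \<longrightarrow> f j \<in> {..?B}) \<and> (j \<notin> {1..n} \<longrightarrow> f j = 0)}"
      using i by (auto simp: exps_def)
  qed
  moreover have "finite {f. \<forall>j. (j \<in> {1..n} \<longrightarrow> f j \<in> {..?B}) \<and> (j \<notin> {1..n} \<longrightarrow> f j = (0::nat))}"
    by (rule finite_set_of_finite_funs) auto
  ultimately show ?thesis unfolding near_def by (blast intro: finite_cartesian_product finite_subset finite_atMost)
qed

definition kappa_fall :: "'k::field_char_0 \<Rightarrow> nat \<Rightarrow> 'k" where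
  "kappa_fall \<kappa> l = (\<Prod>k<l. \<kappa> - of_nat k)"

text \<open>The contribution of the term of index \<open>j\<close> and of the entry \<open>A j m\<close> to \<open>\<partial>(t ^ r e\<^sub>\<kappa> ^ i)\<close>.\<close>

definition conn_entry ::
    "'k::field_char_0 \<Rightarrow> nat \<Rightarrow> (nat \<Rightarrow> nat \<Rightarrow> nat \<Rightarrow> 'k) \<Rightarrow> nat \<Rightarrow> nat \<Rightarrow> nat \<Rightarrow> (nat \<Rightarrow> nat) \<Rightarrow> 'k te_series" where
  "conn_entry \<kappa> n A j m r i = (\<lambda>s \<nu>.
     kfall \<kappa> n i * (if j = 0 then \<kappa> - of_nat (len n i) else of_nat (i j)) *
     (if \<nu> = mul_e m (if j = 0 then i else i(j := i j - 1)) \<and> r \<le> s then A j m (s - r) * inverse (kfall \<kappa> n \<nu>) else 0))"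

lemma conn_mono_entries:
  "conn_mono \<kappa> n A r i s \<nu> = (if s = r \<and> \<nu> = i then of_nat r else 0) +
     (\<Sum>j\<le>n. \<Sum>m\<le>n. conn_entry \<kappa> n A j m r i s \<nu>)"
proof -
  have "(\<Sum>j\<le>n. \<Sum>m\<le>n. conn_entry \<kappa> n A j m r i s \<nu>) =
      (\<Sum>m\<le>n. conn_entry \<kappa> n A 0 m r i s \<nu>) + (\<Sum>j=1..n. \<Sum>m\<le>n. conn_entry \<kappa> n A j m r i s \<nu>)"
    by (simp add: atMost_atLeast0 sum.atLeast_Suc_atMost)
  moreover have "(\<Sum>m\<le>n. conn_entry \<kappa> n A 0 m r i s \<nu>) =
      kfall \<kappa> n i * (\<kappa> - of_nat (len n i)) * mono_times_conn \<kappa> n A r i 0 s \<nu>"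
    by (simp add: conn_entry_def mono_times_conn_def sum_distrib_left)
  moreover have "(\<Sum>j=1..n. \<Sum>m\<le>n. conn_entry \<kappa> n A j m r i s \<nu>) =
      (\<Sum>j=1..n. kfall \<kappa> n i * of_nat (i j) * mono_times_conn \<kappa> n A r (i(j := i j - 1)) j s \<nu>)"
    by (rule sum.cong) (auto simp: conn_entry_def mono_times_conn_def sum_distrib_left)
  ultimately show ?thesis by (simp add: conn_mono_def)
qed

lemma conn_entry_neq_0:
  assumes "conn_entry \<kappa> n A j m r i s \<nu> \<noteq> 0" "i \<in> exps n" "j \<le> n" "m \<le> n"
  shows "(r, i) \<in> near n s \<nu>" "\<nu> \<in> exps n"
proof -
  let ?\<mu> = "if j = 0 then i else i(j := i j - 1)"
  have *: "\<nu> = mul_e m ?\<mu>" "r \<le> s" using assms(1) by (auto simp: conn_entry_def split: if_splits)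
  have "i k \<le> ?\<mu> k + 1" for k by auto
  moreover have "?\<mu> k \<le> mul_e m ?\<mu> k" for k by (simp add: mul_e_def)
  ultimately have "i k \<le> \<nu> k + 1" for k unfolding *(1) by (meson add_le_mono1 order_trans)
  then show "(r, i) \<in> near n s \<nu>" using *(2) assms(2) by (auto simp: near_def)
  have "?\<mu> \<in> exps n" using assms(2,3) by (auto simp: exps_def)
  then show "\<nu> \<in> exps n" unfolding *(1) using mul_e_in_exps assms(4) by blast
qed

lemma conn_mono_neq_0:
  assumes "conn_mono \<kappa> n A r i s \<nu> \<noteq> 0" "i \<in> exps n"
  shows "(r, i) \<in> near n s \<nu>" "\<nu> \<in> exps n"
proof -
  have "(s = r \<and> \<nu> = i) \<or> (\<exists>j\<le>n. \<exists>m\<le>n. conn_entry \<kappa> n A j m r i s \<nu> \<noteq> 0)"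
  proof (rule ccontr)
    assume "\<not> ?thesis"
    then have "\<not> (s = r \<and> \<nu> = i)" "\<And>j m. j \<le> n \<Longrightarrow> m \<le> n \<Longrightarrow> conn_entry \<kappa> n A j m r i s \<nu> = 0" by blast+
    then have "conn_mono \<kappa> n A r i s \<nu> = 0"
      unfolding conn_mono_entries by (subst if_not_P) simp_all
    then show False using assms(1) by contradiction
  qed
  then have "(r, i) \<in> near n s \<nu> \<and> \<nu> \<in> exps n"
  proof
    assume "s = r \<and> \<nu> = i"
    then show ?thesis using assms(2) by (simp add: near_def)
  next
    assume "\<exists>j\<le>n. \<exists>m\<le>n. conn_entry \<kappa> n A j m r i s \<nu> \<noteq> 0"
    then show ?thesis using conn_entry_neq_0[OF _ assms(2)] by blast
  qed
  then show "(r, i) \<in> near n s \<nu>" "\<nu> \<in> exps n" by auto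
qed

lemma connection_eq_sum:
  assumes "\<And>r i. i \<notin> exps n \<Longrightarrow> \<xi> r i = 0"
  shows "connection \<kappa> n A \<xi> s \<nu> = (\<Sum>(r, i)\<in>near n s \<nu>. \<xi> r i * conn_mono \<kappa> n A r i s \<nu>)"
  unfolding connection_def
proof (rule Sum_any.expand_superset[OF finite_near])
  show "{x. (case x of (r, i) \<Rightarrow> \<xi> r i * conn_mono \<kappa> n A r i s \<nu>) \<noteq> 0} \<subseteq> near n s \<nu>"
  proof
    fix x assume x: "x \<in> {x. (case x of (r, i) \<Rightarrow> \<xi> r i * conn_mono \<kappa> n A r i s \<nu>) \<noteq> 0}"
    obtain r i where [simp]: "x = (r, i)" by force
    have "\<xi> r i \<noteq> 0" "conn_mono \<kappa> n A r i s \<nu> \<noteq> 0" using x by auto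
    moreover have "i \<in> exps n" using assms \<open>\<xi> r i \<noteq> 0\<close> by blast
    ultimately show "x \<in> near n s \<nu>" using conn_mono_neq_0(1) by simp
  qed
qed

section \<open>Entries of the connection in the two weights\<close>

locale kloosterman_power = kloosterman p ord \<Omega> n \<gamma> b
  for p :: nat and ord :: "'k::field_char_0 \<Rightarrow> ereal" and \<Omega> :: "'k set" and n :: nat and \<gamma> :: 'k and b :: real +
  fixes \<kappa> :: 'k
  assumes \<kappa>: "\<kappa> \<in> Zp ord - range of_nat"
begin

abbreviation A where "A \<equiv> conn_matrix p ord \<Omega> \<gamma> n b"
abbreviation conn where "conn \<equiv> connection \<kappa> n A"
abbreviation S where "S \<equiv> S_space ord \<Omega> n b c"
abbreviation R where "R \<equiv> R_space ord \<Omega> n b c"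

lemma c_pos: "c > 0"
  using b_gt by simp

lemma \<kappa>_in: "\<kappa> \<in> \<Omega>"
  using \<kappa> Qp_subset by (auto simp: Zp_def)

lemma ordge_\<kappa>: "ordge 0 (\<kappa> - of_nat l)"
  using \<kappa> ordge_of_nat by (intro ordge_diff) (auto simp: Zp_def ordge_def zero_ereal_def)

lemma kappa_fall_nz: "kappa_fall \<kappa> l \<noteq> 0"
  using \<kappa> by (auto simp: kappa_fall_def)

lemma kappa_fall_Suc: "kappa_fall \<kappa> (Suc l) = kappa_fall \<kappa> l * (\<kappa> - of_nat l)"
  by (simp add: kappa_fall_def)

lemma kfall_eq: "kfall \<kappa> n i = kappa_fall \<kappa> (len n i)"
  by (simp add: kfall_def kappa_fall_def)

text \<open>The factors \<open>\<kappa> ^ i\<close> cancel up to an integral factor, which for the leading term is \<open>1\<close>.\<close>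

lemma conn_entry_cases:
  assumes "conn_entry \<kappa> n A j m r i s \<nu> \<noteq> 0" "j \<le> n" "m \<le> n" "i \<in> exps n"
  obtains q where "conn_entry \<kappa> n A j m r i s \<nu> = q * A j m (s - r)" "q \<in> \<Omega>" "ordge 0 q" "r \<le> s"
    "real (wt n \<nu>) = real (wt n i) + real m - real j"
    "real (len n \<nu>) = real (len n i) + (if m = 0 then 0 else 1) - (if j = 0 then 0 else 1)"
    "j = 0 \<Longrightarrow> m = 1 \<Longrightarrow> q = 1 \<and> \<nu> = i(1 := i 1 + 1)"
proof -
  let ?\<mu> = "if j = 0 then i else i(j := i j - 1)"
  let ?f = "if j = 0 then \<kappa> - of_nat (len n i) else of_nat (i j)"
  define q where "q = kfall \<kappa> n i * ?f * inverse (kfall \<kappa> n \<nu>)"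
  have \<nu>: "\<nu> = mul_e m ?\<mu>" and rs: "r \<le> s" and ij: "j \<noteq> 0 \<Longrightarrow> i j \<noteq> 0"
    using assms(1) by (auto simp: conn_entry_def split: if_splits)
  have eq: "conn_entry \<kappa> n A j m r i s \<nu> = q * A j m (s - r)"
    using rs by (simp add: conn_entry_def q_def \<nu>[symmetric])
  have wt: "real (wt n \<nu>) = real (wt n i) + real m - real j"
  proof (cases "j = 0")
    case False
    then have "wt n (i(j := i j - 1)) + j = wt n i" using assms(2) ij by (intro wt_lower) auto
    then show ?thesis using False assms(3) unfolding \<nu> by (simp add: wt_mul_e)
  qed (use assms(3) in \<open>simp add: \<nu> wt_mul_e\<close>)
  have len\<nu>: "len n \<nu> = len n ?\<mu> + (if m = 0 then 0 else 1)" unfolding \<nu> by (rule len_mul_e[OF assms(3)])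
  have len\<mu>: "len n ?\<mu> + (if j = 0 then 0 else 1) = len n i"
    using len_lower[of j n i] assms(2) ij by auto
  \<comment> \<open>The quotient of falling factorials depends only on the change of length.
    Together with the other factor it leaves \<kappa> minus a natural number or \<open>1\<close> if
    \<open>j = 0\<close>, and \<open>i j\<close>, possibly times such a difference, otherwise; these
    are integral as \<kappa> lies in Z_p.\<close>
  have "q \<in> \<Omega> \<and> ordge 0 q \<and> (j = 0 \<longrightarrow> m = 1 \<longrightarrow> q = 1)"
  proof (cases "j = 0")
    case True
    show ?thesis
    proof (cases "m = 0")
      case m: True
      have "q = \<kappa> - of_nat (len n i)"
        using True m len\<nu> kappa_fall_nz by (simp add: q_def kfall_eq)
      then show ?thesis using m \<kappa>_in ordge_\<kappa> by auto
    next
      case False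
      then have "len n \<nu> = Suc (len n i)" using True len\<nu> by simp
      then have "q = 1" using True kappa_fall_nz by (simp add: q_def kfall_eq kappa_fall_Suc[symmetric])
      then show ?thesis using ordge_1 by auto
    qed
  next
    case False
    then have L: "len n i = Suc (len n ?\<mu>)" using len\<mu> by simp
    show ?thesis
    proof (cases "m = 0")
      case m: True
      then have "len n \<nu> = len n ?\<mu>" using len\<nu> by simp
      then have "q = (\<kappa> - of_nat (len n ?\<mu>)) * of_nat (i j)"
        unfolding q_def kfall_eq L using False kappa_fall_nz by (simp add: kappa_fall_Suc)
      then show ?thesis using False \<kappa>_in ordge_mult[OF ordge_\<kappa> ordge_of_nat] by auto
    next
      case m: False
      then have "len n \<nu> = len n i" using len\<nu> L by simp
      then have "q = of_nat (i j)" unfolding q_def kfall_eq using False kappa_fall_nz by simp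
      then show ?thesis using False ordge_of_nat by auto
    qed
  qed
  moreover have "real (len n \<nu>) = real (len n i) + (if m = 0 then 0 else 1) - (if j = 0 then 0 else 1)"
    unfolding len\<nu> len\<mu>[symmetric] by simp
  moreover have "j = 0 \<Longrightarrow> m = 1 \<Longrightarrow> \<nu> = i(1 := i 1 + 1)" unfolding \<nu> by (simp add: mul_e_def)
  ultimately show ?thesis using eq rs wt that by blast
qed

text \<open>
  \<open>S(b,c)\<close> is measured by \<open>w\<close>. In the weight \<open>w'\<close> multiplication by \<open>e\<^sub>1\<close> strictly dominates \<open>\<partial>\<close>: every
  other term gains valuation, raises the degree \<open>(n + 1) s + wt\<close>, or has smaller length.
\<close>

definition w :: "nat \<Rightarrow> (nat \<Rightarrow> nat) \<Rightarrow> real" where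
  "w s \<nu> = b * (real n + 1) * real s + c * real (wt n \<nu>)"

definition w' :: "nat \<Rightarrow> (nat \<Rightarrow> nat) \<Rightarrow> real" where
  "w' s \<nu> = w s \<nu> - (c / 2) * ((real n + 1) * real s + real (wt n \<nu>)) + (c / 2) * real (len n \<nu>)"

lemma w'_le_w: "w' s \<nu> \<le> w s \<nu>"
proof -
  have "real (len n \<nu>) \<le> (real n + 1) * real s + real (wt n \<nu>)"
    using len_le_wt[of n \<nu>] by (simp add: add_increasing)
  then have "(c / 2) * real (len n \<nu>) \<le> (c / 2) * ((real n + 1) * real s + real (wt n \<nu>))"
    using c_pos by (intro mult_left_mono) auto
  then show ?thesis by (simp only: w'_def)
qed

lemma wt_up: "real (wt n (\<nu>(1 := \<nu> 1 + 1))) = real (wt n \<nu>) + 1"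
  using wt_upd[of 1 n \<nu> "\<nu> 1 + 1"] n_pos by simp

lemma len_up: "real (len n (\<nu>(1 := \<nu> 1 + 1))) = real (len n \<nu>) + 1"
  using len_upd[of 1 n \<nu> "\<nu> 1 + 1"] n_pos by simp

lemma w_up: "w s (\<nu>(1 := \<nu> 1 + 1)) = w s \<nu> + c"
  unfolding w_def wt_up by (simp only: distrib_left mult_1_right)

lemma w'_up: "w' s (\<nu>(1 := \<nu> 1 + 1)) = w' s \<nu> + c"
proof -
  have "x + y - y' / 2 * (N + (W + 1)) + y' / 2 * (L + 1) = (x - y' / 2 * (N + W) + y' / 2 * L) + y" for x y y' N W L :: real
    by (simp add: field_simps)
  then show ?thesis unfolding w'_def w_up wt_up len_up by blast
qed

text \<open>The weight changes by \<open>b (n + 1) (s - r) + c (m - j)\<close>, and the bound for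
  \<open>A j m\<close> falls short of this by exactly \<open>c\<close>, the weight of
  \<open>e_1\<close>.\<close>

lemma ordge_conn_entry:
  assumes "j \<le> n" "m \<le> n" "i \<in> exps n"
  shows "ordge (w s \<nu> - w r i - c) (conn_entry \<kappa> n A j m r i s \<nu>)"
proof (cases "conn_entry \<kappa> n A j m r i s \<nu> = 0")
  case False
  then obtain q where q: "conn_entry \<kappa> n A j m r i s \<nu> = q * A j m (s - r)" "ordge 0 q" "r \<le> s"
    "real (wt n \<nu>) = real (wt n i) + real m - real j"
    using conn_entry_cases[OF False assms] by metis
  define M where "M = c * max 0 (real j + 1 - ((real n + 1) * real (s - r) + real m))"
  have "M \<ge> 0" using c_pos by (simp add: M_def)
  have "w s \<nu> - w r i - c = b * (real n + 1) * real (s - r) + c * (real m - real j - 1)"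
  proof -
    have "b * N * s' + x * (W + m' - j') - (b * N * r' + x * W) - x = b * N * (s' - r') + x * (m' - j' - 1)"
      for N s' x W m' j' r' :: real by (simp add: algebra_simps)
    then show ?thesis unfolding w_def q(4) of_nat_diff[OF q(3)] by blast
  qed
  then have "w s \<nu> - w r i - c \<le> 0 + (b * (real n + 1) * real (s - r) + c * (real m - real j - 1) + M)"
    using \<open>M \<ge> 0\<close> by linarith
  then show ?thesis unfolding q(1)
    using ordge_mult_le[OF q(2) conn_matrix_bounds(2)[OF assms(1,2), of "s - r"]] by (simp only: M_def)
qed simp

text \<open>With \<open>l\<close> the change of length and \<open>k\<close> the excess of degree
  over the leading term, the claim amounts to \<open>l - k \<le> 2 * max 0 (- k)\<close>: for
  \<open>k \<ge> 1\<close> because \<open>l \<le> 1\<close>, for \<open>k \<le> -1\<close> because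
  of the extra gain of \<open>A\<close> in low degree. The factor \<open>c / 2\<close> in
  \<open>w'\<close> makes both fit.\<close>

lemma ordge_conn_entry':
  assumes "j \<le> n" "m \<le> n" "i \<in> exps n" "\<not> (j = 0 \<and> m = 1 \<and> s = r)"
  shows "ordge (w' s \<nu> - w' r i - c + c / 2) (conn_entry \<kappa> n A j m r i s \<nu>)"
proof (cases "conn_entry \<kappa> n A j m r i s \<nu> = 0")
  case False
  then obtain q where q: "conn_entry \<kappa> n A j m r i s \<nu> = q * A j m (s - r)" "ordge 0 q" "r \<le> s"
    "real (wt n \<nu>) = real (wt n i) + real m - real j"
    "real (len n \<nu>) = real (len n i) + (if m = 0 then 0 else 1) - (if j = 0 then 0 else 1)"
    using conn_entry_cases[OF False assms(1-3)] by metis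
  define t where "t = s - r"
  have t: "real s - real r = real t" using q(3) by (simp add: t_def of_nat_diff)
  define l :: real where "l = (if m = 0 then 0 else 1) - (if j = 0 then 0 else 1)"
  define k where "k = (real n + 1) * real t + real m - real j - 1"
  have "l - k \<le> 2 * max 0 (- k)"
  proof -
    \<comment> \<open>The excess is an integer, so only \<open>K = 0\<close> is delicate. There the
      length can grow only for \<open>j = 0\<close> and \<open>m \<noteq> 0\<close>, which forces
      \<open>m = 1\<close> and \<open>s = r\<close>, the excluded leading entry.\<close>
    define K :: int where "K = (int n + 1) * int t + int m - int j - 1"
    have kK: "k = real_of_int K" by (simp add: k_def K_def)
    consider "K \<ge> 1" | "K = 0" | "K \<le> - 1" by linarith
    then show ?thesis
    proof cases
      case 1
      then show ?thesis unfolding kK l_def by auto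
    next
      case 2
      have "l \<le> 0"
      proof (rule ccontr)
        assume "\<not> l \<le> 0"
        then have jm: "j = 0" "m \<noteq> 0" by (auto simp: l_def split: if_splits)
        then have eq: "(int n + 1) * int t + int m = 1" using 2 by (simp add: K_def)
        have "t = 0"
        proof (rule ccontr)
          assume "t \<noteq> 0"
          then have "int t \<le> (int n + 1) * int t" "int t \<ge> 1" by (auto simp: algebra_simps)
          then show False using eq jm by linarith
        qed
        then have "m = 1" "s = r" using eq q(3) by (auto simp: t_def)
        then show False using assms(4) jm by blast
      qed
      then show ?thesis using 2 unfolding kK by simp
    next
      case 3
      then show ?thesis unfolding kK l_def by auto
    qed
  qed
  then have lk: "c / 2 * (l - k) \<le> c / 2 * (2 * max 0 (- k))" using c_pos by (intro mult_left_mono) auto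
  have "w' s \<nu> - w' r i - c + c / 2 = b * (real n + 1) * real t + c * (real m - real j - 1) + c / 2 * (l - k)"
  proof -
    have arith: "b * N * s' + x * (W + m' - j') - x / 2 * (N * s' + (W + m' - j')) + x / 2 * (L + l)
        - (b * N * r' + x * W - x / 2 * (N * r' + W) + x / 2 * L) - x + x / 2 =
        b * N * (s' - r') + x * (m' - j' - 1) + x / 2 * (l - (N * (s' - r') + m' - j' - 1))"
      for N s' x W m' j' r' L :: real by (simp add: field_simps)
    have len: "real (len n \<nu>) = real (len n i) + l" using q(5) by (simp add: l_def)
    show ?thesis unfolding w'_def w_def q(4) k_def t[symmetric] len by (rule arith)
  qed
  moreover have "- k = real j + 1 - ((real n + 1) * real t + real m)" by (simp add: k_def)
  moreover have "c / 2 * (2 * max 0 (- k)) = c * max 0 (- k)" by simp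
  ultimately have "w' s \<nu> - w' r i - c + c / 2 \<le> 0 + (b * (real n + 1) * real t + c * (real m - real j - 1) +
      c * max 0 (real j + 1 - ((real n + 1) * real t + real m)))"
    using lk by (simp only:)
  then show ?thesis unfolding q(1)
    using ordge_mult_le[OF q(2) conn_matrix_bounds(2)[OF assms(1,2), of t]] by (simp only: t_def)
qed simp

lemma conn_entry_in:
  assumes "j \<le> n" "m \<le> n" "i \<in> exps n"
  shows "conn_entry \<kappa> n A j m r i s \<nu> \<in> \<Omega>"
proof (cases "conn_entry \<kappa> n A j m r i s \<nu> = 0")
  case False
  then show ?thesis using conn_entry_cases[OF False assms] conn_matrix_bounds(1)[OF assms(1,2)]
    by (metis \<Omega>_closed(4))
qed simp

lemma conn_mono_in: "i \<in> exps n \<Longrightarrow> conn_mono \<kappa> n A r i s \<nu> \<in> \<Omega>"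
  unfolding conn_mono_entries by (intro \<Omega>_closed(3) \<Omega>_sum conn_entry_in) auto

lemma ordge_conn_mono:
  assumes "i \<in> exps n"
  shows "ordge (w s \<nu> - w r i - c) (conn_mono \<kappa> n A r i s \<nu>)"
proof -
  have "ordge (w s \<nu> - w r i - c) (if s = r \<and> \<nu> = i then of_nat r else 0)"
    using c_pos by (auto intro: ordge_mono[OF ordge_of_nat])
  then show ?thesis unfolding conn_mono_entries using assms
    by (intro ordge_add ordge_sum ordge_conn_entry) auto
qed

text \<open>The matrix of \<open>1 - e\<^sub>1\<^sup>-\<^sup>1 \<partial>\<close>.\<close>

definition defect :: "nat \<Rightarrow> (nat \<Rightarrow> nat) \<Rightarrow> nat \<Rightarrow> (nat \<Rightarrow> nat) \<Rightarrow> 'k" where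
  "defect r i s \<nu> = (if r = s \<and> i = \<nu> then 1 else 0) - conn_mono \<kappa> n A r i s (\<nu>(1 := \<nu> 1 + 1))"

lemma ordge_defect:
  assumes "i \<in> exps n"
  shows "ordge (w s \<nu> - w r i) (defect r i s \<nu>)"
proof -
  have "ordge (w s \<nu> - w r i) (if r = s \<and> i = \<nu> then 1 else 0)" using ordge_1 by auto
  moreover have "ordge (w s \<nu> - w r i) (conn_mono \<kappa> n A r i s (\<nu>(1 := \<nu> 1 + 1)))"
    using ordge_conn_mono[OF assms, of s "\<nu>(1 := \<nu> 1 + 1)" r] unfolding w_up by (simp add: add_diff_eq)
  ultimately show ?thesis unfolding defect_def by (rule ordge_diff)
qed

text \<open>The identity cancels the leading entry up to \<open>A 0 1 0 - 1\<close>, of order at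
  least \<open>c\<close>; all other entries gain \<open>c / 2\<close> by
  \<open>ordge_conn_entry'\<close>; the term from \<open>t d/dt\<close> lacks the factor
  \<open>e_1\<close> and is handled by weight alone.\<close>

lemma ordge_defect':
  assumes i: "i \<in> exps n"
  shows "ordge (w' s \<nu> - w' r i + c / 2) (defect r i s \<nu>)"
proof -
  let ?\<nu> = "\<nu>(1 := \<nu> 1 + 1)"
  let ?I = "{..n} \<times> {..n} - {(0, 1)}"
  let ?t = "\<lambda>(j, m). conn_entry \<kappa> n A j m r i s ?\<nu>"
  let ?W = "w' s \<nu> - w' r i + c / 2"
  have W: "w' s ?\<nu> - w' r i - c + c / 2 = ?W" unfolding w'_up by simp
  have "(\<Sum>j\<le>n. \<Sum>m\<le>n. conn_entry \<kappa> n A j m r i s ?\<nu>) = (\<Sum>x\<in>{..n} \<times> {..n}. ?t x)"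
    by (rule sum.cartesian_product)
  also have "\<dots> = ?t (0, 1) + (\<Sum>x\<in>?I. ?t x)" using n_pos by (intro sum.remove) auto
  finally have eq: "defect r i s \<nu> = ((if r = s \<and> i = \<nu> then 1 else 0) - ?t (0, 1))
      - (if s = r \<and> ?\<nu> = i then of_nat r else 0) - (\<Sum>x\<in>?I. ?t x)"
    by (simp add: defect_def conn_mono_entries)
  have 1: "ordge ?W ((if r = s \<and> i = \<nu> then 1 else 0) - ?t (0, 1))"
  proof (cases "s = r")
    case True
    have entry: "conn_entry \<kappa> n A 0 1 r i s ?\<nu> = (if i = \<nu> then A 0 1 0 else 0)"
    proof (cases "i = \<nu>")
      case i: True
      have "len n ?\<nu> = Suc (len n \<nu>)" using len_up[of \<nu>] by linarith
      then have "kfall \<kappa> n i * (\<kappa> - of_nat (len n i)) * inverse (kfall \<kappa> n ?\<nu>) = 1"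
        using kappa_fall_nz unfolding i kfall_eq by (simp add: kappa_fall_Suc[symmetric])
      then show ?thesis using i True by (simp add: conn_entry_def mul_e_def mult.assoc mult.left_commute mult.commute)
    next
      case False
      have "?\<nu> \<noteq> i(1 := i 1 + 1)"
      proof
        assume eq: "?\<nu> = i(1 := i 1 + 1)"
        have "\<nu> k = i k" for k using fun_cong[OF eq, of k] by (cases "k = 1") auto
        then show False using False by (simp add: fun_eq_iff)
      qed
      then show ?thesis using False by (simp add: conn_entry_def mul_e_def)
    qed
    show ?thesis
    proof (cases "i = \<nu>")
      case i: True
      have "ordge (c / 2) (1 - A 0 1 0)"
        using conn_matrix_bounds(3)[OF le0 le0] c_pos by (subst ordge_minus_commute) (auto intro: ordge_mono)
      then show ?thesis using i True entry by simp
    qed (use entry in simp)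
  next
    case False
    then have "ordge ?W (?t (0, 1))"
      using ordge_conn_entry'[of 0 1 i s r ?\<nu>] n_pos i unfolding W by simp
    then show ?thesis using False by simp
  qed
  \<comment> \<open>The source exponent exceeds \<nu> by one factor \<open>e_1\<close>, so the
    required order is \<open>- c + c / 2\<close>, which is negative, and an integral factor
    suffices.\<close>
  have 2: "ordge ?W (if s = r \<and> ?\<nu> = i then of_nat r else 0)"
  proof (cases "s = r \<and> ?\<nu> = i")
    case True
    have "a - (a + y) + y / 2 \<le> 0" if "y > 0" for a y :: real using that by simp
    moreover have "w' r i = w' s \<nu> + c" using True w'_up by metis
    ultimately have "?W \<le> 0" using c_pos by (simp only:)
    then have "ordge ?W (of_nat r)" by (rule ordge_mono[OF ordge_of_nat])
    then show ?thesis unfolding if_P[OF True] .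
  next
    case False
    show ?thesis unfolding if_not_P[OF False] by simp
  qed
  have 3: "ordge ?W (\<Sum>x\<in>?I. ?t x)"
  proof (rule ordge_sum)
    fix x assume x: "x \<in> ?I"
    obtain j m where "x = (j, m)" by force
    then show "ordge ?W (?t x)" using ordge_conn_entry'[of j m i s r ?\<nu>] x i unfolding W by auto
  qed
  show ?thesis unfolding eq by (intro ordge_diff 1 2 3)
qed

lemma defect_in: "i \<in> exps n \<Longrightarrow> defect r i s \<nu> \<in> \<Omega>"
  using conn_mono_in by (simp add: defect_def)

section \<open>Linearity of the connection on S(b,c)\<close>

lemma S_space_iff:
  "\<xi> \<in> S \<longleftrightarrow> (\<forall>r i. i \<notin> exps n \<longrightarrow> \<xi> r i = 0) \<and> (\<exists>\<rho>. \<forall>r i. \<xi> r i \<in> \<Omega> \<and> ordge (w r i + \<rho>) (\<xi> r i))"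
proof
  assume "\<xi> \<in> S"
  then obtain \<rho> where z: "\<forall>r i. i \<notin> exps n \<longrightarrow> \<xi> r i = 0"
    and \<rho>: "\<forall>r. \<forall>i\<in>exps n. \<xi> r i \<in> \<Omega> \<and> ereal (b * (real n + 1) * real r + c * real (wt n i) + \<rho>) \<le> ord (\<xi> r i)"
    unfolding S_space_def S_space_rho_def by blast
  have "\<xi> r i \<in> \<Omega> \<and> ordge (w r i + \<rho>) (\<xi> r i)" for r i
    using z \<rho> by (cases "i \<in> exps n") (simp_all add: ordge_def w_def)
  then show "(\<forall>r i. i \<notin> exps n \<longrightarrow> \<xi> r i = 0) \<and> (\<exists>\<rho>. \<forall>r i. \<xi> r i \<in> \<Omega> \<and> ordge (w r i + \<rho>) (\<xi> r i))"
    using z by blast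
next
  assume "(\<forall>r i. i \<notin> exps n \<longrightarrow> \<xi> r i = 0) \<and> (\<exists>\<rho>. \<forall>r i. \<xi> r i \<in> \<Omega> \<and> ordge (w r i + \<rho>) (\<xi> r i))"
  then show "\<xi> \<in> S" unfolding S_space_def S_space_rho_def ordge_def w_def by blast
qed

lemma R_space_iff: "\<xi> \<in> R \<longleftrightarrow> \<xi> \<in> S \<and> (\<forall>r i. i 1 \<noteq> 0 \<longrightarrow> \<xi> r i = 0)"
  unfolding R_space_def R_space_rho_def S_space_def by blast

lemma S_supp: "\<xi> \<in> S \<Longrightarrow> i \<notin> exps n \<Longrightarrow> \<xi> r i = 0"
  unfolding S_space_iff by blast

lemma S_in: "\<xi> \<in> S \<Longrightarrow> \<xi> r i \<in> \<Omega>"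
  unfolding S_space_iff by blast

lemma S_add: "\<xi> \<in> S \<Longrightarrow> \<eta> \<in> S \<Longrightarrow> (\<lambda>r i. \<xi> r i + \<eta> r i) \<in> S"
proof -
  assume a: "\<xi> \<in> S" "\<eta> \<in> S"
  obtain \<rho> \<tau> where b: "\<And>r i. ordge (w r i + \<rho>) (\<xi> r i)" "\<And>r i. ordge (w r i + \<tau>) (\<eta> r i)"
    using a unfolding S_space_iff by meson
  have "ordge (w r i + min \<rho> \<tau>) (\<xi> r i + \<eta> r i)" for r i
    by (intro ordge_add ordge_mono[OF b(1)] ordge_mono[OF b(2)]) auto
  then show ?thesis using S_supp[OF a(1)] S_supp[OF a(2)] S_in[OF a(1)] S_in[OF a(2)]
    unfolding S_space_iff by auto
qed

lemma S_smult:
  assumes a: "a \<in> \<Omega>" and \<xi>: "\<xi> \<in> S"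
  shows "(\<lambda>r i. a * \<xi> r i) \<in> S"
proof -
  obtain \<rho> where b: "\<And>r i. ordge (w r i + \<rho>) (\<xi> r i)"
    using \<xi> unfolding S_space_iff by meson
  obtain t where t: "ordge t a"
    by (cases rule: ord_cases[of a]) (auto simp: ordge_def)
  have "ordge (w r i + (\<rho> + t)) (a * \<xi> r i)" for r i
    by (rule ordge_mult_le[OF t b]) simp
  then show ?thesis using S_supp[OF \<xi>] S_in[OF \<xi>] a unfolding S_space_iff by auto
qed

lemma S_0: "(\<lambda>r i. 0) \<in> S"
  unfolding S_space_iff by auto

lemma S_uminus: "\<xi> \<in> S \<Longrightarrow> (\<lambda>r i. - \<xi> r i) \<in> S"
  using S_smult[of "-1" \<xi>] by simp

lemma S_diff: "\<xi> \<in> S \<Longrightarrow> \<eta> \<in> S \<Longrightarrow> (\<lambda>r i. \<xi> r i - \<eta> r i) \<in> S"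
  using S_add[OF _ S_uminus, of \<xi> \<eta>] by simp

lemma conn_eq:
  assumes "\<xi> \<in> S"
  shows "conn \<xi> s \<nu> = (\<Sum>(r, i)\<in>near n s \<nu>. \<xi> r i * conn_mono \<kappa> n A r i s \<nu>)"
  using S_supp[OF assms] by (intro connection_eq_sum)

lemma conn_add: "\<xi> \<in> S \<Longrightarrow> \<eta> \<in> S \<Longrightarrow> conn (\<lambda>r i. \<xi> r i + \<eta> r i) = (\<lambda>s \<nu>. conn \<xi> s \<nu> + conn \<eta> s \<nu>)"
  by (intro ext) (simp add: conn_eq S_add case_prod_unfold distrib_right sum.distrib)

lemma conn_smult: "a \<in> \<Omega> \<Longrightarrow> \<xi> \<in> S \<Longrightarrow> conn (\<lambda>r i. a * \<xi> r i) = (\<lambda>s \<nu>. a * conn \<xi> s \<nu>)"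
  by (intro ext) (simp add: conn_eq S_smult case_prod_unfold sum_distrib_left mult.assoc)

lemma conn_S:
  assumes \<xi>: "\<xi> \<in> S"
  shows "conn \<xi> \<in> S"
proof -
  obtain \<rho> where b: "\<And>r i. ordge (w r i + \<rho>) (\<xi> r i)"
    using \<xi> unfolding S_space_iff by meson
  have i: "i \<in> exps n" if "(r, i) \<in> near n s \<nu>" for r i s \<nu> using that by (simp add: near_def)
  have "conn \<xi> s \<nu> = 0" if "\<nu> \<notin> exps n" for s \<nu>
    unfolding conn_eq[OF \<xi>]
  proof (rule sum.neutral, clarify)
    fix r i assume "(r, i) \<in> near n s \<nu>"
    then have "conn_mono \<kappa> n A r i s \<nu> = 0" using conn_mono_neq_0(2) i that by blast
    then show "\<xi> r i * conn_mono \<kappa> n A r i s \<nu> = 0" by simp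
  qed
  moreover have "conn \<xi> s \<nu> \<in> \<Omega>" for s \<nu>
    unfolding conn_eq[OF \<xi>] using S_in[OF \<xi>] conn_mono_in i by (intro \<Omega>_sum) (auto simp: case_prod_unfold)
  moreover have "ordge (w s \<nu> + (\<rho> - c)) (conn \<xi> s \<nu>)" for s \<nu>
    unfolding conn_eq[OF \<xi>]
  proof (rule ordge_sum, clarify)
    fix r i assume "(r, i) \<in> near n s \<nu>"
    then show "ordge (w s \<nu> + (\<rho> - c)) (\<xi> r i * conn_mono \<kappa> n A r i s \<nu>)"
      by (intro ordge_mult_le[OF b ordge_conn_mono[OF i]]) auto
  qed
  ultimately show ?thesis unfolding S_space_iff by blast
qed

text \<open>\<open>e\<^sub>1\<^sup>-\<^sup>1 \<partial>\<close>, where the terms of \<open>\<partial>\<close> free of \<open>e\<^sub>1\<close> are dropped.\<close>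

definition conn_up :: "(nat \<times> (nat \<Rightarrow> nat) \<Rightarrow> 'k) \<Rightarrow> nat \<times> (nat \<Rightarrow> nat) \<Rightarrow> 'k" where
  "conn_up y = (\<lambda>(s, \<nu>). if \<nu> \<in> exps n
     then \<Sum>x\<in>near n s (\<nu>(1 := \<nu> 1 + 1)). y x * conn_mono \<kappa> n A (fst x) (snd x) s (\<nu>(1 := \<nu> 1 + 1)) else 0)"

lemma sum_defect:
  assumes "\<nu> \<in> exps n"
  shows "y (s, \<nu>) - conn_up y (s, \<nu>) =
    (\<Sum>x\<in>near n s (\<nu>(1 := \<nu> 1 + 1)). y x * defect (fst x) (snd x) s \<nu>)"
proof -
  let ?N = "near n s (\<nu>(1 := \<nu> 1 + 1))"
  have "(s, \<nu>) \<in> ?N" using assms by (auto simp: near_def)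
  then have "y (s, \<nu>) = (\<Sum>x\<in>?N. if x = (s, \<nu>) then y x else 0)" by (simp add: finite_near)
  also have "\<dots> = (\<Sum>x\<in>?N. y x * (if fst x = s \<and> snd x = \<nu> then 1 else 0))"
    by (intro sum.cong) auto
  finally show ?thesis using assms by (simp add: conn_up_def defect_def right_diff_distrib sum_subtractf)
qed

lemma near_exps: "x \<in> near n s \<nu> \<Longrightarrow> snd x \<in> exps n"
  by (auto simp: near_def)

lemma sum_defect_rweighted:
  assumes "\<And>s r \<nu> i. i \<in> exps n \<Longrightarrow> ordge (\<alpha> (s, \<nu>) - \<alpha> (r, i) + \<epsilon>) (defect r i s \<nu>)" "y \<in> rweighted \<alpha> \<sigma>"
  shows "(\<Sum>x\<in>near n s (\<nu>(1 := \<nu> 1 + 1)). y x * defect (fst x) (snd x) s \<nu>) \<in> \<Omega>"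
    "ordge (\<alpha> (s, \<nu>) + (\<sigma> + \<epsilon>)) (\<Sum>x\<in>near n s (\<nu>(1 := \<nu> 1 + 1)). y x * defect (fst x) (snd x) s \<nu>)"
proof -
  have y: "y x \<in> \<Omega>" "ordge (\<alpha> x + \<sigma>) (y x)" for x using assms(2) unfolding rweighted_iff by blast+
  show "(\<Sum>x\<in>near n s (\<nu>(1 := \<nu> 1 + 1)). y x * defect (fst x) (snd x) s \<nu>) \<in> \<Omega>"
    using y near_exps defect_in by (intro \<Omega>_sum \<Omega>_closed(4)) blast+
  show "ordge (\<alpha> (s, \<nu>) + (\<sigma> + \<epsilon>)) (\<Sum>x\<in>near n s (\<nu>(1 := \<nu> 1 + 1)). y x * defect (fst x) (snd x) s \<nu>)"
  proof (rule ordge_sum)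
    fix x assume "x \<in> near n s (\<nu>(1 := \<nu> 1 + 1))"
    then have "ordge (\<alpha> (s, \<nu>) - \<alpha> (fst x, snd x) + \<epsilon>) (defect (fst x) (snd x) s \<nu>)"
      using assms(1) near_exps by blast
    then show "ordge (\<alpha> (s, \<nu>) + (\<sigma> + \<epsilon>)) (y x * defect (fst x) (snd x) s \<nu>)"
      by (intro ordge_mult_le[OF y(2)]) auto
  qed
qed

lemma sum_defect_w':
  assumes "y \<in> rweighted (\<lambda>(s, \<nu>). w' s \<nu>) \<sigma>"
  shows "(\<Sum>x\<in>near n s (\<nu>(1 := \<nu> 1 + 1)). y x * defect (fst x) (snd x) s \<nu>) \<in> \<Omega>"
    "ordge (w' s \<nu> + (\<sigma> + c / 2)) (\<Sum>x\<in>near n s (\<nu>(1 := \<nu> 1 + 1)). y x * defect (fst x) (snd x) s \<nu>)"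
proof -
  have "ordge ((case (s, \<nu>) of (s, \<nu>) \<Rightarrow> w' s \<nu>) - (case (r, i) of (s, \<nu>) \<Rightarrow> w' s \<nu>) + c / 2) (defect r i s \<nu>)"
    if "i \<in> exps n" for r i s \<nu>
    unfolding prod.case using that by (rule ordge_defect')
  note * = sum_defect_rweighted[OF this assms, of s \<nu>, unfolded prod.case]
  show "(\<Sum>x\<in>near n s (\<nu>(1 := \<nu> 1 + 1)). y x * defect (fst x) (snd x) s \<nu>) \<in> \<Omega>" by (rule *(1))
  show "ordge (w' s \<nu> + (\<sigma> + c / 2)) (\<Sum>x\<in>near n s (\<nu>(1 := \<nu> 1 + 1)). y x * defect (fst x) (snd x) s \<nu>)"
    by (rule *(2))
qed

lemma sum_defect_w:
  assumes "y \<in> rweighted (\<lambda>(s, \<nu>). w s \<nu>) \<sigma>"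
  shows "(\<Sum>x\<in>near n s (\<nu>(1 := \<nu> 1 + 1)). y x * defect (fst x) (snd x) s \<nu>) \<in> \<Omega>"
    "ordge (w s \<nu> + \<sigma>) (\<Sum>x\<in>near n s (\<nu>(1 := \<nu> 1 + 1)). y x * defect (fst x) (snd x) s \<nu>)"
proof -
  have "ordge ((case (s, \<nu>) of (s, \<nu>) \<Rightarrow> w s \<nu>) - (case (r, i) of (s, \<nu>) \<Rightarrow> w s \<nu>) + 0) (defect r i s \<nu>)"
    if "i \<in> exps n" for r i s \<nu>
    unfolding prod.case add_0_right using that by (rule ordge_defect)
  note * = sum_defect_rweighted[OF this assms, of s \<nu>, unfolded prod.case add_0_right]
  show "(\<Sum>x\<in>near n s (\<nu>(1 := \<nu> 1 + 1)). y x * defect (fst x) (snd x) s \<nu>) \<in> \<Omega>" by (rule *(1))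
  show "ordge (w s \<nu> + \<sigma>) (\<Sum>x\<in>near n s (\<nu>(1 := \<nu> 1 + 1)). y x * defect (fst x) (snd x) s \<nu>)"
    by (rule *(2))
qed

section \<open>Solving for the multiples of \<open>e_1\<close>\<close>

definition pair_supp :: "(nat \<times> (nat \<Rightarrow> nat) \<Rightarrow> 'k) \<Rightarrow> bool" where
  "pair_supp y \<longleftrightarrow> (\<forall>s \<nu>. \<nu> \<notin> exps n \<longrightarrow> y (s, \<nu>) = 0)"

lemma defect_gain:
  assumes "y \<in> rweighted (\<lambda>(s, \<nu>). w' s \<nu>) \<sigma>" "pair_supp y"
  shows "(\<lambda>x. y x - conn_up y x) \<in> rweighted (\<lambda>(s, \<nu>). w' s \<nu>) (\<sigma> + c / 2)"
  unfolding rweighted_iff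
proof (intro allI)
  fix x :: "nat \<times> (nat \<Rightarrow> nat)"
  obtain s \<nu> where x: "x = (s, \<nu>)" by force
  show "y x - conn_up y x \<in> \<Omega> \<and> ordge ((case x of (s, \<nu>) \<Rightarrow> w' s \<nu>) + (\<sigma> + c / 2)) (y x - conn_up y x)"
  proof (cases "\<nu> \<in> exps n")
    case True
    show ?thesis unfolding x sum_defect[OF True] prod.case using sum_defect_w'[OF assms(1)] by blast
  next
    case False
    then show ?thesis using assms(2) unfolding x by (simp add: conn_up_def pair_supp_def)
  qed
qed

text \<open>The approximate inverse is the identity: the residual is the defect, which keeps the
  bound in \<open>w\<close> and gains \<open>c / 2\<close> in \<open>w'\<close>.\<close>

lemma conn_up_solve:
  assumes F: "pair_supp F" "F \<in> rweighted (\<lambda>(s, \<nu>). w s \<nu>) \<rho>"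
  shows "\<exists>y. pair_supp y \<and> y \<in> rweighted (\<lambda>(s, \<nu>). w s \<nu>) \<rho> \<and> conn_up y = F"
proof -
  define \<alpha> where "\<alpha> = (\<lambda>(s, \<nu>). if \<nu> \<in> exps n then ereal (w s \<nu> + \<rho>) else \<infinity>)"
  have \<alpha>: "y \<in> weighted \<alpha> \<longleftrightarrow> pair_supp y \<and> y \<in> rweighted (\<lambda>(s, \<nu>). w s \<nu>) \<rho>" for y
  proof
    assume y: "y \<in> weighted \<alpha>"
    have "y (s, \<nu>) = 0" if "\<nu> \<notin> exps n" for s \<nu>
    proof -
      have "\<alpha> (s, \<nu>) \<le> ord (y (s, \<nu>))" using y unfolding weighted_def by blast
      then show ?thesis using that by (simp add: \<alpha>_def ord_eq_infinity_iff)
    qed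
    moreover have "y (s, \<nu>) \<in> \<Omega> \<and> ordge (w s \<nu> + \<rho>) (y (s, \<nu>))" for s \<nu>
    proof -
      have "y (s, \<nu>) \<in> \<Omega>" "\<alpha> (s, \<nu>) \<le> ord (y (s, \<nu>))" using y unfolding weighted_def by blast+
      then show ?thesis using calculation by (cases "\<nu> \<in> exps n") (simp_all add: \<alpha>_def ordge_def)
    qed
    ultimately show "pair_supp y \<and> y \<in> rweighted (\<lambda>(s, \<nu>). w s \<nu>) \<rho>"
      unfolding rweighted_iff pair_supp_def by auto
  next
    assume y: "pair_supp y \<and> y \<in> rweighted (\<lambda>(s, \<nu>). w s \<nu>) \<rho>"
    have "y (s, \<nu>) \<in> \<Omega> \<and> \<alpha> (s, \<nu>) \<le> ord (y (s, \<nu>))" for s \<nu>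
    proof -
      have "y (s, \<nu>) \<in> \<Omega> \<and> ordge ((case (s, \<nu>) of (s, \<nu>) \<Rightarrow> w s \<nu>) + \<rho>) (y (s, \<nu>))"
        using y unfolding rweighted_iff by blast
      then show ?thesis using y by (auto simp: \<alpha>_def ordge_def pair_supp_def)
    qed
    then show "y \<in> weighted \<alpha>" unfolding weighted_def by auto
  qed
  have w'w: "y \<in> rweighted (\<lambda>(s, \<nu>). w' s \<nu>) \<rho>" if "y \<in> rweighted (\<lambda>(s, \<nu>). w s \<nu>) \<rho>" for y
    unfolding rweighted_iff
  proof
    fix x :: "nat \<times> (nat \<Rightarrow> nat)"
    obtain s \<nu> where x: "x = (s, \<nu>)" by force
    have "y x \<in> \<Omega> \<and> ordge ((case x of (s, \<nu>) \<Rightarrow> w s \<nu>) + \<rho>) (y x)" using that unfolding rweighted_iff by blast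
    then show "y x \<in> \<Omega> \<and> ordge ((case x of (s, \<nu>) \<Rightarrow> w' s \<nu>) + \<rho>) (y x)"
      using w'_le_w[of s \<nu>] ordge_mono unfolding x by auto
  qed
  have "\<exists>y. y \<in> weighted \<alpha> \<and> y \<in> rweighted (\<lambda>(s, \<nu>). w' s \<nu>) \<rho> \<and> conn_up y = F"
  proof (rule successive_approximation[where \<Phi> = "\<lambda>F. F" and \<alpha> = \<alpha> and \<epsilon> = "c / 2" and C = 0])
    show "c / 2 > 0" using c_pos by simp
    show "(\<lambda>u. y u - conn_up y u) \<in> weighted \<alpha>" if y: "y \<in> weighted \<alpha>" for y
    proof -
      have y': "y \<in> rweighted (\<lambda>(s, \<nu>). w s \<nu>) \<rho>" "pair_supp y" using y \<alpha> by auto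
      have "pair_supp (\<lambda>u. y u - conn_up y u)" using y'(2) by (simp add: pair_supp_def conn_up_def)
      moreover have "(\<lambda>u. y u - conn_up y u) \<in> rweighted (\<lambda>(s, \<nu>). w s \<nu>) \<rho>"
        unfolding rweighted_iff
      proof
        fix x :: "nat \<times> (nat \<Rightarrow> nat)"
        obtain s \<nu> where x: "x = (s, \<nu>)" by force
        show "y x - conn_up y x \<in> \<Omega> \<and> ordge ((case x of (s, \<nu>) \<Rightarrow> w s \<nu>) + \<rho>) (y x - conn_up y x)"
        proof (cases "\<nu> \<in> exps n")
          case True
          show ?thesis unfolding x sum_defect[OF True] prod.case using sum_defect_w[OF y'(1)] by blast
        next
          case False
          then show ?thesis using y'(2) unfolding x by (simp add: conn_up_def pair_supp_def)
        qed
      qed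
      ultimately show ?thesis using \<alpha> by blast
    qed
    show "(\<lambda>u. y u - conn_up y u) \<in> rweighted (\<lambda>(s, \<nu>). w' s \<nu>) (\<sigma> + c / 2)"
      if "y \<in> weighted \<alpha>" "y \<in> rweighted (\<lambda>(s, \<nu>). w' s \<nu>) \<sigma>" for y \<sigma>
      using defect_gain that \<alpha> by blast
    show "conn_up (\<lambda>i. y i + z i) = (\<lambda>u. conn_up y u + conn_up z u)" for y z
      by (auto simp: conn_up_def fun_eq_iff distrib_right sum.distrib)
    show "conn_up y \<in> rweighted (\<lambda>(s, \<nu>). w' s \<nu>) (\<sigma> - 0)"
      if y: "y \<in> rweighted (\<lambda>(s, \<nu>). w' s \<nu>) \<sigma>" for y \<sigma>
      unfolding rweighted_iff
    proof
      fix x :: "nat \<times> (nat \<Rightarrow> nat)"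
      obtain s \<nu> where x: "x = (s, \<nu>)" by force
      show "conn_up y x \<in> \<Omega> \<and> ordge ((case x of (s, \<nu>) \<Rightarrow> w' s \<nu>) + (\<sigma> - 0)) (conn_up y x)"
      proof (cases "\<nu> \<in> exps n")
        case True
        let ?S = "\<Sum>x\<in>near n s (\<nu>(1 := \<nu> 1 + 1)). y x * defect (fst x) (snd x) s \<nu>"
        have eq: "conn_up y x = y (s, \<nu>) - ?S" unfolding x sum_defect[OF True, symmetric] by simp
        have "?S \<in> \<Omega>" "ordge (w' s \<nu> + (\<sigma> + c / 2)) ?S"
          using sum_defect_w'[OF y] by blast+
        moreover have "y (s, \<nu>) \<in> \<Omega> \<and> ordge ((case (s, \<nu>) of (s, \<nu>) \<Rightarrow> w' s \<nu>) + \<sigma>) (y (s, \<nu>))"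
          using y unfolding rweighted_iff by blast
        moreover have "w' s \<nu> + \<sigma> \<le> w' s \<nu> + (\<sigma> + c / 2)" using c_pos by simp
        ultimately show ?thesis unfolding eq unfolding x prod.case diff_zero
          using ordge_diff ordge_mono \<Omega>_diff by blast
      next
        case False
        then show ?thesis unfolding x by (simp add: conn_up_def)
      qed
    qed
    show "F \<in> weighted \<alpha>" "F \<in> rweighted (\<lambda>(s, \<nu>). w' s \<nu>) \<rho>" using F \<alpha> w'w by blast+
  qed
  then show ?thesis using \<alpha> by blast
qed

lemma conn_up_conn:
  assumes "\<xi> \<in> S"
  shows "conn_up (\<lambda>(r, i). \<xi> r i) (s, \<nu>) = (if \<nu> \<in> exps n then conn \<xi> s (\<nu>(1 := \<nu> 1 + 1)) else 0)"
  unfolding conn_eq[OF assms] by (simp add: conn_up_def case_prod_unfold)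

lemma S_pair:
  assumes "\<xi> \<in> S"
  obtains \<rho> where "pair_supp (\<lambda>(r, i). \<xi> r i)" "(\<lambda>(r, i). \<xi> r i) \<in> rweighted (\<lambda>(s, \<nu>). w s \<nu>) \<rho>"
  using assms that unfolding S_space_iff pair_supp_def rweighted_iff by auto

text \<open>Dividing the terms of \<open>F\<close> that contain \<open>e_1\<close> by
  \<open>e_1\<close> and solving for them matches \<open>F\<close> and the image on every exponent
  with \<open>e_1\<close>. The terms left over are free of \<open>e_1\<close>.\<close>

lemma decompose:
  assumes F: "F \<in> S"
  shows "\<exists>\<xi>\<in>S. (\<lambda>s \<nu>. F s \<nu> - conn \<xi> s \<nu>) \<in> R"
proof -
  obtain \<rho> where \<rho>: "\<And>r i. ordge (w r i + \<rho>) (F r i)" using F unfolding S_space_iff by meson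
  define F' where "F' = (\<lambda>(s, \<nu>). if \<nu> \<in> exps n then F s (\<nu>(1 := \<nu> 1 + 1)) else 0)"
  have "pair_supp F'" by (simp add: pair_supp_def F'_def)
  moreover have "F' \<in> rweighted (\<lambda>(s, \<nu>). w s \<nu>) (\<rho> + c)"
    unfolding rweighted_iff
  proof
    fix x :: "nat \<times> (nat \<Rightarrow> nat)"
    obtain s \<nu> where x: "x = (s, \<nu>)" by force
    have "ordge (w s \<nu> + (\<rho> + c)) (F s (\<nu>(1 := \<nu> 1 + 1)))"
      using \<rho>[of s "\<nu>(1 := \<nu> 1 + 1)"] unfolding w_up by (simp only: add.assoc add.commute[of c])
    then show "F' x \<in> \<Omega> \<and> ordge ((case x of (s, \<nu>) \<Rightarrow> w s \<nu>) + (\<rho> + c)) (F' x)"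
      using S_in[OF F] unfolding x by (simp add: F'_def)
  qed
  ultimately obtain y where y: "pair_supp y" "y \<in> rweighted (\<lambda>(s, \<nu>). w s \<nu>) (\<rho> + c)" "conn_up y = F'"
    using conn_up_solve by blast
  define \<xi> where "\<xi> r i = y (r, i)" for r i
  have yx: "y = (\<lambda>(r, i). \<xi> r i)" by (simp add: \<xi>_def)
  have "\<xi> r i \<in> \<Omega> \<and> ordge (w r i + (\<rho> + c)) (\<xi> r i)" for r i
  proof -
    have "y (r, i) \<in> \<Omega> \<and> ordge ((case (r, i) of (s, \<nu>) \<Rightarrow> w s \<nu>) + (\<rho> + c)) (y (r, i))"
      using y(2) unfolding rweighted_iff by blast
    then show ?thesis by (simp add: \<xi>_def)
  qed
  then have \<xi>: "\<xi> \<in> S" using y(1) unfolding S_space_iff pair_supp_def \<xi>_def by blast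
  have "F s \<nu> - conn \<xi> s \<nu> = 0" if "\<nu> 1 \<noteq> 0" for s \<nu>
  proof (cases "\<nu> \<in> exps n")
    case True
    define \<mu> where "\<mu> = \<nu>(1 := \<nu> 1 - 1)"
    have up: "\<mu>(1 := \<mu> 1 + 1) = \<nu>" using that by (auto simp: \<mu>_def)
    have \<mu>: "\<mu> \<in> exps n" unfolding \<mu>_def using True n_pos by (auto simp: exps_def)
    have "conn_up y (s, \<mu>) = F' (s, \<mu>)" by (simp add: y(3))
    then have "conn \<xi> s (\<mu>(1 := \<mu> 1 + 1)) = F s (\<mu>(1 := \<mu> 1 + 1))"
      unfolding yx conn_up_conn[OF \<xi>] F'_def using \<mu> by simp
    then show ?thesis unfolding up by simp
  next
    case False
    then show ?thesis using S_supp[OF F] S_supp[OF conn_S[OF \<xi>]] by simp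
  qed
  moreover have "(\<lambda>s \<nu>. F s \<nu> - conn \<xi> s \<nu>) \<in> S" by (intro S_diff F conn_S \<xi>)
  ultimately show ?thesis using \<xi> unfolding R_space_iff by blast
qed

text \<open>If the image has no term with \<open>e_1\<close>, then \<open>conn_up\<close> vanishes
  on \<xi>, so \<xi> equals its own defect and gains \<open>c / 2\<close> indefinitely. As
  \<open>R\<close> contains zero, this gives both the trivial intersection and the trivial
  kernel.\<close>

lemma conn_in_R_imp_0:
  assumes \<xi>: "\<xi> \<in> S" and R: "conn \<xi> \<in> R"
  shows "\<xi> = (\<lambda>r i. 0)"
proof -
  obtain \<rho> where y: "pair_supp (\<lambda>(r, i). \<xi> r i)" "(\<lambda>(r, i). \<xi> r i) \<in> rweighted (\<lambda>(s, \<nu>). w s \<nu>) \<rho>"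
    using S_pair[OF \<xi>] by blast
  let ?y = "\<lambda>(r, i). \<xi> r i"
  have "conn_up ?y x = 0" for x
  proof -
    obtain s \<nu> where x: "x = (s, \<nu>)" by force
    have "conn \<xi> s (\<nu>(1 := \<nu> 1 + 1)) = 0" using R unfolding R_space_iff by simp
    then show ?thesis unfolding x conn_up_conn[OF \<xi>] by simp
  qed
  then have step: "?y \<in> rweighted (\<lambda>(s, \<nu>). w' s \<nu>) (\<sigma> + c / 2)"
    if "?y \<in> rweighted (\<lambda>(s, \<nu>). w' s \<nu>) \<sigma>" for \<sigma>
    using defect_gain[OF that y(1)] by simp
  have "?y \<in> rweighted (\<lambda>(s, \<nu>). w' s \<nu>) (\<rho> + real N * (c / 2))" for N
  proof (induct N)
    case 0
    show ?case unfolding rweighted_iff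
    proof
      fix x :: "nat \<times> (nat \<Rightarrow> nat)"
      obtain s \<nu> where x: "x = (s, \<nu>)" by force
      have "?y x \<in> \<Omega> \<and> ordge ((case x of (s, \<nu>) \<Rightarrow> w s \<nu>) + \<rho>) (?y x)" using y(2) unfolding rweighted_iff by blast
      then show "?y x \<in> \<Omega> \<and> ordge ((case x of (s, \<nu>) \<Rightarrow> w' s \<nu>) + (\<rho> + real 0 * (c / 2))) (?y x)"
        using w'_le_w[of s \<nu>] ordge_mono unfolding x by auto
    qed
  next
    case (Suc N)
    have "(\<rho> + real N * (c / 2)) + c / 2 = \<rho> + real (Suc N) * (c / 2)" by (simp only: of_nat_Suc distrib_right mult_1_left add.assoc add.commute)
    then show ?case using step[OF Suc] by (simp only:)
  qed
  from rweighted_all_imp_0[OF this] c_pos have "?y x = 0" for x by simp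
  from this[of "(r, i)" for r i] show ?thesis by (simp add: fun_eq_iff)
qed


section \<open>The cohomology spaces\<close>

lemma R_subset_S: "R \<subseteq> S"
  using R_space_iff by blast

lemma R_0: "(\<lambda>r i. 0) \<in> R"
  using R_space_iff S_0 by simp

lemma conn_0: "conn (\<lambda>r i. 0) = (\<lambda>r i. 0)"
  using conn_smult[OF \<Omega>_closed(1) S_0] by simp

lemma R_Int_image: "R \<inter> conn ` S = {\<lambda>r i. 0}"
proof
  show "R \<inter> conn ` S \<subseteq> {\<lambda>r i. 0}" using conn_in_R_imp_0 conn_0 by auto
  have "(\<lambda>r i. 0) \<in> conn ` S" using conn_0 S_0 by (metis image_eqI)
  then show "{\<lambda>r i. 0} \<subseteq> R \<inter> conn ` S" using R_0 by simp
qed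

lemma kernel_conn: "{\<xi> \<in> S. conn \<xi> = (\<lambda>r i. 0)} = {\<lambda>r i. 0}"
proof
  show "{\<xi> \<in> S. conn \<xi> = (\<lambda>r i. 0)} \<subseteq> {\<lambda>r i. 0}"
  proof
    fix \<xi> assume "\<xi> \<in> {\<xi> \<in> S. conn \<xi> = (\<lambda>r i. 0)}"
    then have "\<xi> \<in> S" "conn \<xi> = (\<lambda>r i. 0)" by blast+
    then show "\<xi> \<in> {\<lambda>r i. 0}" using conn_in_R_imp_0[of \<xi>] R_0 by (simp only: singleton_iff)
  qed
  show "{\<lambda>r i. 0} \<subseteq> {\<xi> \<in> S. conn \<xi> = (\<lambda>r i. 0)}" using S_0 conn_0 by blast
qed

lemma image_0: "(\<lambda>r i. 0) \<in> conn ` S"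
  using R_Int_image by blast

lemma image_add: "\<xi> \<in> conn ` S \<Longrightarrow> \<eta> \<in> conn ` S \<Longrightarrow> (\<lambda>r i. \<xi> r i + \<eta> r i) \<in> conn ` S"
proof (elim imageE)
  fix \<xi>' \<eta>' assume *: "\<xi> = conn \<xi>'" "\<xi>' \<in> S" "\<eta> = conn \<eta>'" "\<eta>' \<in> S"
  have "(\<lambda>r i. \<xi> r i + \<eta> r i) = conn (\<lambda>r i. \<xi>' r i + \<eta>' r i)" unfolding *(1,3) by (rule conn_add[OF *(2,4), symmetric])
  then show "(\<lambda>r i. \<xi> r i + \<eta> r i) \<in> conn ` S" using S_add[OF *(2,4)] by (rule image_eqI)
qed

lemma image_smult: "a \<in> \<Omega> \<Longrightarrow> \<xi> \<in> conn ` S \<Longrightarrow> (\<lambda>r i. a * \<xi> r i) \<in> conn ` S"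
proof (elim imageE)
  fix \<xi>' assume *: "a \<in> \<Omega>" "\<xi> = conn \<xi>'" "\<xi>' \<in> S"
  have "(\<lambda>r i. a * \<xi> r i) = conn (\<lambda>r i. a * \<xi>' r i)" unfolding *(2) by (rule conn_smult[OF *(1,3), symmetric])
  then show "(\<lambda>r i. a * \<xi> r i) \<in> conn ` S" using S_smult[OF *(1,3)] by (rule image_eqI)
qed

lemma image_uminus: "\<xi> \<in> conn ` S \<Longrightarrow> (\<lambda>r i. - \<xi> r i) \<in> conn ` S"
  using image_smult[of "-1" \<xi>] by simp

lemma image_diff: "\<xi> \<in> conn ` S \<Longrightarrow> \<eta> \<in> conn ` S \<Longrightarrow> (\<lambda>r i. \<xi> r i - \<eta> r i) \<in> conn ` S"
  using image_add[OF _ image_uminus, of \<xi> \<eta>] by simp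

lemma te_module_simps:
  "carrier (te_module V) = V" "\<xi> \<oplus>\<^bsub>te_module V\<^esub> \<eta> = (\<lambda>r i. \<xi> r i + \<eta> r i)"
  "\<zero>\<^bsub>te_module V\<^esub> = (\<lambda>r i. 0)" "a \<odot>\<^bsub>te_module V\<^esub> \<xi> = (\<lambda>r i. a * \<xi> r i)"
  by (simp_all add: te_module_def)

lemma submodule_image: "submodule (conn ` S) (scalars \<Omega>) (te_module S)"
proof (rule submodule.intro)
  show "subgroup (conn ` S) (add_monoid (te_module S))"
  proof
    show "conn ` S \<subseteq> carrier (add_monoid (te_module S))"
      using conn_S by (auto simp: te_module_simps)
    show "x \<otimes>\<^bsub>add_monoid (te_module S)\<^esub> y \<in> conn ` S" if "x \<in> conn ` S" "y \<in> conn ` S" for x y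
      using image_add[OF that] by (simp add: te_module_simps)
    show "\<one>\<^bsub>add_monoid (te_module S)\<^esub> \<in> conn ` S" using image_0 by (simp add: te_module_simps)
    show "inv\<^bsub>add_monoid (te_module S)\<^esub> x \<in> conn ` S" if x: "x \<in> conn ` S" for x
    proof -
      have "x \<in> S" using x conn_S by auto
      have "inv\<^bsub>add_monoid (te_module S)\<^esub> x = (\<lambda>r i. - x r i)" unfolding m_inv_def
      proof (rule the_equality)
        show "(\<lambda>r i. - x r i) \<in> carrier (add_monoid (te_module S)) \<and>
          x \<otimes>\<^bsub>add_monoid (te_module S)\<^esub> (\<lambda>r i. - x r i) = \<one>\<^bsub>add_monoid (te_module S)\<^esub> \<and>
          (\<lambda>r i. - x r i) \<otimes>\<^bsub>add_monoid (te_module S)\<^esub> x = \<one>\<^bsub>add_monoid (te_module S)\<^esub>"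
          using S_uminus[OF \<open>x \<in> S\<close>] by (simp add: te_module_simps)
        fix y assume "y \<in> carrier (add_monoid (te_module S)) \<and>
          x \<otimes>\<^bsub>add_monoid (te_module S)\<^esub> y = \<one>\<^bsub>add_monoid (te_module S)\<^esub> \<and>
          y \<otimes>\<^bsub>add_monoid (te_module S)\<^esub> x = \<one>\<^bsub>add_monoid (te_module S)\<^esub>"
        then show "y = (\<lambda>r i. - x r i)" by (simp add: te_module_simps fun_eq_iff eq_neg_iff_add_eq_0)
      qed
      then show ?thesis using image_uminus[OF x] by simp
    qed
  qed
  show "submodule_axioms (conn ` S) (scalars \<Omega>) (te_module S)"
    by standard (use image_smult in \<open>simp add: scalars_def te_module_simps\<close>)
qed

lemma coset_eq: "conn ` S +>\<^bsub>te_module S\<^esub> \<xi> = {\<eta>. (\<lambda>r i. \<eta> r i - \<xi> r i) \<in> conn ` S}"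
proof
  show "conn ` S +>\<^bsub>te_module S\<^esub> \<xi> \<subseteq> {\<eta>. (\<lambda>r i. \<eta> r i - \<xi> r i) \<in> conn ` S}"
    by (auto simp: a_r_coset_def r_coset_def te_module_simps)
  show "{\<eta>. (\<lambda>r i. \<eta> r i - \<xi> r i) \<in> conn ` S} \<subseteq> conn ` S +>\<^bsub>te_module S\<^esub> \<xi>"
  proof
    fix \<eta> assume "\<eta> \<in> {\<eta>. (\<lambda>r i. \<eta> r i - \<xi> r i) \<in> conn ` S}"
    then have "(\<lambda>r i. \<eta> r i - \<xi> r i) \<in> conn ` S" by simp
    moreover have "\<eta> = (\<lambda>r i. \<eta> r i - \<xi> r i) \<oplus>\<^bsub>te_module S\<^esub> \<xi>" by (simp add: te_module_simps)
    ultimately show "\<eta> \<in> conn ` S +>\<^bsub>te_module S\<^esub> \<xi>"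
      unfolding a_r_coset_def r_coset_def by auto
  qed
qed

lemma coset_eq_iff:
  "conn ` S +>\<^bsub>te_module S\<^esub> \<xi> = conn ` S +>\<^bsub>te_module S\<^esub> \<eta> \<longleftrightarrow> (\<lambda>r i. \<xi> r i - \<eta> r i) \<in> conn ` S"
proof
  assume "conn ` S +>\<^bsub>te_module S\<^esub> \<xi> = conn ` S +>\<^bsub>te_module S\<^esub> \<eta>"
  moreover have "\<xi> \<in> conn ` S +>\<^bsub>te_module S\<^esub> \<xi>" unfolding coset_eq using image_0 by simp
  ultimately show "(\<lambda>r i. \<xi> r i - \<eta> r i) \<in> conn ` S" unfolding coset_eq by blast
next
  assume d: "(\<lambda>r i. \<xi> r i - \<eta> r i) \<in> conn ` S"
  have "(\<lambda>r i. \<zeta> r i - \<xi> r i) \<in> conn ` S \<longleftrightarrow> (\<lambda>r i. \<zeta> r i - \<eta> r i) \<in> conn ` S" for \<zeta>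
    using image_add[OF d, of "\<lambda>r i. \<zeta> r i - \<xi> r i"] image_diff[OF _ d, of "\<lambda>r i. \<zeta> r i - \<eta> r i"] by auto
  then show "conn ` S +>\<^bsub>te_module S\<^esub> \<xi> = conn ` S +>\<^bsub>te_module S\<^esub> \<eta>" unfolding coset_eq by simp
qed

text \<open>Injectivity is the trivial intersection of \<open>R\<close> with the image, surjectivity
  is \<open>decompose\<close>. The rest checks that the operations on cosets do not depend on
  representatives.\<close>

lemma module_iso_cosets:
  "(\<lambda>\<xi>. conn ` S +>\<^bsub>te_module S\<^esub> \<xi>)
    \<in> module_iso (scalars \<Omega>) (te_module R) (quotient_module (te_module S) (conn ` S))"
proof -
  let ?h = "\<lambda>\<xi>. conn ` S +>\<^bsub>te_module S\<^esub> \<xi>"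
  have "bij_betw ?h R (a_rcosets\<^bsub>te_module S\<^esub> (conn ` S))"
    unfolding bij_betw_def
  proof
    show "inj_on ?h R"
    proof (rule inj_onI)
      fix \<xi> \<eta> assume R: "\<xi> \<in> R" "\<eta> \<in> R" and "?h \<xi> = ?h \<eta>"
      then have "(\<lambda>r i. \<xi> r i - \<eta> r i) \<in> conn ` S" unfolding coset_eq_iff by blast
      moreover have "(\<lambda>r i. \<xi> r i - \<eta> r i) \<in> R" using R S_diff unfolding R_space_iff by auto
      ultimately have "(\<lambda>r i. \<xi> r i - \<eta> r i) = (\<lambda>r i. 0)" using R_Int_image by blast
      then show "\<xi> = \<eta>" by (simp add: fun_eq_iff)
    qed
    have "?h \<xi> \<in> ?h ` R" if \<xi>: "\<xi> \<in> S" for \<xi>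
    proof -
      obtain \<zeta> where \<zeta>: "\<zeta> \<in> S" "(\<lambda>r i. \<xi> r i - conn \<zeta> r i) \<in> R" using decompose[OF \<xi>] by blast
      then have "?h \<xi> = ?h (\<lambda>r i. \<xi> r i - conn \<zeta> r i)" unfolding coset_eq_iff by simp
      then show ?thesis using \<zeta>(2) by (rule image_eqI)
    qed
    then show "?h ` R = a_rcosets\<^bsub>te_module S\<^esub> (conn ` S)"
      using R_subset_S by (auto simp: A_RCOSETS_def RCOSETS_def a_r_coset_def te_module_simps)
  qed
  moreover have "?h (\<lambda>r i. \<xi> r i + \<eta> r i) = ?h \<xi> <+>\<^bsub>te_module S\<^esub> ?h \<eta>" for \<xi> \<eta>
  proof
    show "?h (\<lambda>r i. \<xi> r i + \<eta> r i) \<subseteq> ?h \<xi> <+>\<^bsub>te_module S\<^esub> ?h \<eta>"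
    proof
      fix \<zeta> assume "\<zeta> \<in> ?h (\<lambda>r i. \<xi> r i + \<eta> r i)"
      then have "(\<lambda>r i. \<zeta> r i - \<eta> r i) \<in> ?h \<xi>" unfolding coset_eq by (simp add: diff_diff_eq add.commute)
      moreover have "\<eta> \<in> ?h \<eta>" unfolding coset_eq using image_0 by simp
      moreover have "\<zeta> = (\<lambda>r i. \<zeta> r i - \<eta> r i) \<oplus>\<^bsub>te_module S\<^esub> \<eta>" by (simp add: te_module_simps)
      ultimately show "\<zeta> \<in> ?h \<xi> <+>\<^bsub>te_module S\<^esub> ?h \<eta>" unfolding set_add_def' by blast
    qed
    show "?h \<xi> <+>\<^bsub>te_module S\<^esub> ?h \<eta> \<subseteq> ?h (\<lambda>r i. \<xi> r i + \<eta> r i)"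
    proof
      fix \<zeta> assume "\<zeta> \<in> ?h \<xi> <+>\<^bsub>te_module S\<^esub> ?h \<eta>"
      then obtain x y where x: "(\<lambda>r i. x r i - \<xi> r i) \<in> conn ` S" and y: "(\<lambda>r i. y r i - \<eta> r i) \<in> conn ` S"
        and \<zeta>: "\<zeta> = (\<lambda>r i. x r i + y r i)"
        unfolding set_add_def' coset_eq te_module_simps by blast
      have "(\<lambda>r i. \<zeta> r i - (\<xi> r i + \<eta> r i)) = (\<lambda>r i. (x r i - \<xi> r i) + (y r i - \<eta> r i))"
        unfolding \<zeta> by (simp add: algebra_simps)
      then show "\<zeta> \<in> ?h (\<lambda>r i. \<xi> r i + \<eta> r i)" unfolding coset_eq using image_add[OF x y] by simp
    qed
  qed
  moreover have "?h (\<lambda>r i. a * \<xi> r i) = (\<Union>\<eta>\<in>?h \<xi>. ?h (\<lambda>r i. a * \<eta> r i))" if "a \<in> \<Omega>" for a \<xi>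
  proof -
    have "?h (\<lambda>r i. a * \<eta> r i) = ?h (\<lambda>r i. a * \<xi> r i)" if "\<eta> \<in> ?h \<xi>" for \<eta>
    proof -
      have "(\<lambda>r i. a * (\<eta> r i - \<xi> r i)) \<in> conn ` S"
        using that image_smult[OF \<open>a \<in> \<Omega>\<close>] unfolding coset_eq by blast
      then show ?thesis unfolding coset_eq_iff by (simp add: right_diff_distrib)
    qed
    moreover have "\<xi> \<in> ?h \<xi>" unfolding coset_eq using image_0 by simp
    ultimately show ?thesis by blast
  qed
  ultimately show ?thesis
    unfolding module_iso_def by (simp add: quotient_module_def te_module_simps scalars_def)
qed

end

theorem theorem3p8:
  fixes p a n :: nat
    and ord :: "'k::field_char_0 \<Rightarrow> ereal"
    and Qq :: "'k set"
    and \<gamma> \<delta> \<kappa> :: 'k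
    and b c :: real
  defines "\<Omega> \<equiv> generate_field ring_of_type_algebra (insert \<delta> Qq)"
  defines "S \<equiv> S_space ord \<Omega> n b c"
    and "R \<equiv> R_space ord \<Omega> n b c"
    and "d \<equiv> connection \<kappa> n (conn_matrix p ord \<Omega> \<gamma> n b)"
  assumes "padic_closure p ord"
    and "a \<ge> 1"
    and "unramified_extension ord a Qq"
    and "is_gamma p ord \<gamma>"
    and "\<delta> ^ (p ^ a) = \<gamma>"
    and "n \<ge> 1"
    and "\<kappa> \<in> Zp ord - range of_nat"
    and "1 / (real p - 1) < b"
    and "b \<le> real p / (real p - 1)"
    and "c = b - 1 / (real p - 1)"
  shows "R \<inter> d ` S = {\<lambda>_ _. 0} \<and>
    submodule (d ` S) (scalars \<Omega>) (te_module S) \<and>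
    (\<lambda>\<xi>. d ` S +>\<^bsub>te_module S\<^esub> \<xi>)
      \<in> module_iso (scalars \<Omega>) (te_module R) (quotient_module (te_module S) (d ` S)) \<and>
    {\<xi> \<in> S. d \<xi> = (\<lambda>_ _. 0)} = {\<lambda>_ _. 0}"
proof -
  interpret P: padic_closure p ord by fact
  note \<Omega> = P.subfield_and_complete_generate_field[OF \<open>unramified_extension ord a Qq\<close>, of \<delta>, folded \<Omega>_def]
  interpret C: complete_coefficients p ord \<Omega>
    by (intro complete_coefficients.intro complete_coefficients_axioms.intro
      \<Omega>(1-3) \<open>padic_closure p ord\<close>)
  have "\<gamma> \<in> \<Omega>" using C.\<Omega>_power[OF \<Omega>(4), of "p ^ a"] \<open>\<delta> ^ (p ^ a) = \<gamma>\<close> by simp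
  then interpret K: kloosterman_power p ord \<Omega> n \<gamma> b \<kappa>
    by (intro kloosterman_power.intro kloosterman.intro kloosterman_axioms.intro
      kloosterman_power_axioms.intro C.complete_coefficients_axioms assms)
  show ?thesis
    unfolding S_def R_def d_def \<open>c = b - 1 / (real p - 1)\<close>
    using K.R_Int_image K.submodule_image K.module_iso_cosets K.kernel_conn by blast
qed

end
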